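(* Let $(x_n)_{n\ge0}$ be a time-homogeneous Markov chain on $S=\{1,\dots,d\}$ with arbitrary initial distribution, whose transition matrix $P=(p_{jk})$ has all entries positive. Let $\mathbf h=(h_{jk})\in M(d,\mathbb R)$ be such that there are no constants $c\in\mathbb R$, $r\ne0$ and vector $H\in\mathbb R^d$ with $rh_{jk}=c+H(k)-H(j)\bmod2\pi$ for all $j,k$. Let $X_n=h_{x_nx_{n+1}}$, $S_N=X_1+\dots+X_N$, assume $\lim_N\mathbb E(S_N)/N=0$, and let $B=\lim_{n\to\infty}B_n/n$ with $B_n=\sup\{\sum_{j=1}^nh_{x_{j-1}x_j}:x_0,\dots,x_n\in S\}$. Then $S_N$ admits the strong asymptotic expansion of order $0$ for large deviations in the range $(0,B)$: for each $a\in(0,B)$ there is $D_0(a)$ with $\mathbb P(S_N\ge aN)e^{I(a)N}=D_0(a)N^{-1/2}+o(N^{-1/2})$.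
   Context: Rate function: $I(a)=\sup_{\theta>0}[a\theta-\Lambda(\theta)]$ with $\Lambda(\theta)=\lim_N\frac1N\log\mathbb E(e^{\theta S_N})$. *)

theory Defs
  imports Complex_Main "HOL-Library.Landau_Symbols"
begin

text \<open>Markov chain on a finite state space 's (playing the role of S = {1..d}),
 initial distribution mu, transition matrix P. A trajectory x_0,...,x_{n-1}
 is a list of length n.\<close>

definition paths :: "nat \<Rightarrow> ('s::finite) list set" where
  "paths n = {xs. length xs = n}"

definition path_prob :: "('s \<Rightarrow> real) \<Rightarrow> ('s \<Rightarrow> 's \<Rightarrow> real) \<Rightarrow> 's list \<Rightarrow> real" where
  "path_prob mu P xs = mu (xs ! 0) * (\<Prod>i<length xs - 1. P (xs ! i) (xs ! (i + 1)))"

definition SN :: "('s \<Rightarrow> 's \<Rightarrow> real) \<Rightarrow> nat \<Rightarrow> 's list \<Rightarrow> real" where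
  "SN h N xs = (\<Sum>n = 1..N. h (xs ! n) (xs ! (n + 1)))"

definition expect :: "('s::finite \<Rightarrow> real) \<Rightarrow> ('s \<Rightarrow> 's \<Rightarrow> real) \<Rightarrow> nat \<Rightarrow> ('s list \<Rightarrow> real) \<Rightarrow> real" where
  "expect mu P N f = (\<Sum>xs\<in>paths (N + 2). path_prob mu P xs * f xs)"

definition prob_SN_ge :: "('s::finite \<Rightarrow> real) \<Rightarrow> ('s \<Rightarrow> 's \<Rightarrow> real) \<Rightarrow> ('s \<Rightarrow> 's \<Rightarrow> real) \<Rightarrow> nat \<Rightarrow> real \<Rightarrow> real" where
  "prob_SN_ge mu P h N t = expect mu P N (\<lambda>xs. if SN h N xs \<ge> t then 1 else 0)"

definition Lambda :: "('s::finite \<Rightarrow> real) \<Rightarrow> ('s \<Rightarrow> 's \<Rightarrow> real) \<Rightarrow> ('s \<Rightarrow> 's \<Rightarrow> real) \<Rightarrow> real \<Rightarrow> real" where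
  "Lambda mu P h \<theta> = lim (\<lambda>N. ln (expect mu P N (\<lambda>xs. exp (\<theta> * SN h N xs))) / real N)"

definition rate :: "('s::finite \<Rightarrow> real) \<Rightarrow> ('s \<Rightarrow> 's \<Rightarrow> real) \<Rightarrow> ('s \<Rightarrow> 's \<Rightarrow> real) \<Rightarrow> real \<Rightarrow> real" where
  "rate mu P h a = (SUP \<theta>\<in>{0<..}. a * \<theta> - Lambda mu P h \<theta>)"

definition Bn :: "('s::finite \<Rightarrow> 's \<Rightarrow> real) \<Rightarrow> nat \<Rightarrow> real" where
  "Bn h n = Max ((\<lambda>xs. \<Sum>j = 1..n. h (xs ! (j - 1)) (xs ! j)) ` paths (n + 1))"

definition Bmax :: "('s::finite \<Rightarrow> 's \<Rightarrow> real) \<Rightarrow> real" where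
  "Bmax h = lim (\<lambda>n. Bn h n / real n)"

end

theory Submission
  imports Defs "HOL-Probability.Probability"
begin

text \<open>
  For a real parameter \<open>\<theta>\<close> let \<open>M \<theta> j k = P j k * exp (\<theta> * h j k)\<close>, with Perron eigenvalue \<open>l\<close> and positive right
  eigenvector \<open>r\<close>; then \<open>Lambda \<theta> = ln l\<close>. Since \<open>Lambda\<close> has slope \<open>0\<close> at the origin and grows like \<open>Bmax h * \<theta>\<close>,
  the function \<open>Lambda \<theta> - a * \<theta>\<close> has a minimiser \<open>\<theta> > 0\<close>, the rate is \<open>a * \<theta> - ln l\<close>, and the tilted stochastic
  matrix \<open>Q j k = M \<theta> j k * r k / (l * r j)\<close> gives \<open>h\<close> the stationary mean \<open>a\<close>. Changing measure from \<open>P\<close> to \<open>Q\<close> turns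
  the claim into the convergence of \<open>sqrt N * E [w * exp (- \<theta> * Y) ; Y \<ge> 0]\<close>, where \<open>Y = S\<^sub>N - a * N\<close> is centred under \<open>Q\<close> and
  \<open>w\<close> depends on the first and last state only: a local limit theorem.

  Its Fourier input consists of the limit of the characteristic function of \<open>Y / sqrt N\<close>, obtained from an approximate
  eigenvector of the twisted kernel \<open>Q j k * exp (i * t * h j k)\<close>, and of a Gaussian domination on compact sets of \<open>t\<close>. For
  the latter, the non-lattice condition says that for each \<open>t \<noteq> 0\<close> the phases of the two-step paths from some \<open>j\<close> to some \<open>l\<close> are not
  all equal, which makes the cube of the twisted kernel a strict contraction. Since nothing is known for large \<open>t\<close>, the law
  of \<open>Y\<close> is multiplied by a positive kernel with compactly supported Fourier transform; Levy's continuity theorem then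
  gives weak convergence.
\<close>

section \<open>Positive matrices and sums over walks\<close>

text \<open>Three obstacles shape the proof. Derivatives of the Perron eigenvalue are replaced by
  test vectors: a positive \<open>V\<close> with \<open>mapp (M \<theta>) V j \<le> l * V j\<close>
  for all \<open>j\<close> bounds \<open>logmgf \<theta>\<close> by \<open>ln l\<close>, and such a
  one-sided first-order bound suffices at a minimiser, since a drift other than \<open>a\<close>
  would make \<open>logmgf t - a * t\<close> smaller on one side of it. Second, the contraction of
  the twisted kernels is uniform only for \<open>t\<close> in compact sets avoiding
  \<open>0\<close>, so the half-line indicator cannot be handled by direct Fourier inversion; a
  kernel with compactly supported transform sees only a bounded range of \<open>t\<close>. This
  kernel must be positive everywhere because it is divided out again, and it must decay more slowly
  than the exponential weight so that the quotient stays bounded. The jump of the quotient at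
  \<open>0\<close> is harmless because the weak limit has a density. Third, the sum starts with the
  step from x_1 to x_2, so walks start at x_1, whose law charges every state whatever the initial
  distribution is.\<close>

definition mapp :: "('s::finite \<Rightarrow> 's \<Rightarrow> 'a::comm_semiring_1) \<Rightarrow> ('s \<Rightarrow> 'a) \<Rightarrow> 's \<Rightarrow> 'a" where
  "mapp A g j = (\<Sum>k\<in>UNIV. A j k * g k)"

lemma mapp_cmult: "mapp A (\<lambda>k. c * g k) = (\<lambda>j. c * mapp A g j)"
  by (simp add: mapp_def sum_distrib_left mult.left_commute fun_eq_iff)

lemma mapp_diff: "mapp A (\<lambda>k. f k - g k) = (\<lambda>j. mapp A f j - mapp A g j)"
  for A :: "'s::finite \<Rightarrow> 's \<Rightarrow> 'a::comm_ring_1"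
  by (simp add: mapp_def right_diff_distrib sum_subtractf fun_eq_iff)

lemma mapp_mono:
  fixes A :: "'s::finite \<Rightarrow> 's \<Rightarrow> real"
  assumes "\<And>j k. 0 \<le> A j k" "\<And>k. f k \<le> g k"
  shows "mapp A f j \<le> mapp A g j"
  unfolding mapp_def by (intro sum_mono mult_left_mono assms)

lemma mapp_funpow_cmult: "(mapp A ^^ n) (\<lambda>k. c * g k) = (\<lambda>j. c * (mapp A ^^ n) g j)"
  by (induction n) (simp_all add: mapp_cmult)

lemma mapp_funpow_diff:
  fixes A :: "'s::finite \<Rightarrow> 's \<Rightarrow> 'a::comm_ring_1"
  shows "(mapp A ^^ n) (\<lambda>k. f k - g k) = (\<lambda>j. (mapp A ^^ n) f j - (mapp A ^^ n) g j)"
  by (induction n) (simp_all add: mapp_diff)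

lemma mapp_funpow_mono:
  fixes A :: "'s::finite \<Rightarrow> 's \<Rightarrow> real"
  assumes "\<And>j k. 0 \<le> A j k" "\<And>k. f k \<le> g k"
  shows "(mapp A ^^ n) f j \<le> (mapp A ^^ n) g j"
  using assms(2) by (induction n arbitrary: j) (auto intro!: mapp_mono assms(1))

lemma mapp_funpow_eigen:
  assumes "\<And>j. mapp A g j = l * g j"
  shows "(mapp A ^^ n) g = (\<lambda>j. l ^ n * g j)"
proof (induction n)
  case (Suc n)
  then show ?case by (simp add: mapp_cmult assms mult.left_commute mult.assoc)
qed simp

text \<open>A nonnegative kernel preserves inequalities, so a supersolution controls every power.
  The upper bounds on \<open>logmgf\<close> by test vectors rest on this.\<close>

lemma mapp_funpow_upper:
  fixes A :: "'s::finite \<Rightarrow> 's \<Rightarrow> real"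
  assumes "\<And>j k. 0 \<le> A j k" "\<And>j. mapp A g j \<le> l * g j" "0 \<le> l"
  shows "(mapp A ^^ n) g j \<le> l ^ n * g j"
proof (induction n arbitrary: j)
  case (Suc n)
  have "(mapp A ^^ Suc n) g j \<le> mapp A (\<lambda>k. l ^ n * g k) j"
    using Suc by (auto intro!: mapp_mono assms)
  also have "\<dots> = l ^ n * mapp A g j" by (simp add: mapp_cmult)
  also have "\<dots> \<le> l ^ n * (l * g j)" using assms by (intro mult_left_mono) auto
  finally show ?case by (simp add: mult_ac)
qed simp

lemma mapp_norm_le:
  fixes A :: "'s::finite \<Rightarrow> 's \<Rightarrow> complex"
  assumes "\<And>k. norm (g k) \<le> B" "(\<Sum>k\<in>UNIV. norm (A j k)) \<le> c" "0 \<le> B"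
  shows "norm (mapp A g j) \<le> c * B"
proof -
  have "norm (mapp A g j) \<le> (\<Sum>k\<in>UNIV. norm (A j k) * B)"
    unfolding mapp_def
    by (rule order_trans[OF norm_sum]) (auto simp: norm_mult intro!: sum_mono mult_left_mono assms)
  also have "\<dots> \<le> c * B" unfolding sum_distrib_right[symmetric] by (intro mult_right_mono assms)
  finally show ?thesis .
qed

lemma finite_pos_lower_bound:
  fixes f :: "'s::finite \<Rightarrow> real"
  assumes "\<And>x. f x > 0"
  obtains c where "c > 0" "\<And>x. c \<le> f x"
proof
  show "Min (range f) > 0" using assms by (subst Min_gr_iff) auto
  show "Min (range f) \<le> f x" for x by simp
qed

lemma finite_pos_lower_bound2:
  fixes f :: "'s::finite \<Rightarrow> 't::finite \<Rightarrow> real"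
  assumes "\<And>x y. f x y > 0"
  obtains c where "c > 0" "\<And>x y. c \<le> f x y"
proof -
  obtain c where "c > 0" "\<And>p. c \<le> f (fst p) (snd p)"
    using finite_pos_lower_bound[of "\<lambda>p. f (fst p) (snd p)"] assms by blast
  then show ?thesis using that[of c] by (metis fst_conv snd_conv)
qed

lemma finite_upper_bound:
  fixes f :: "'s::finite \<Rightarrow> real"
  obtains c where "c > 0" "\<And>x. f x \<le> c"
proof
  show "max 1 (Max (range f)) > 0" by auto
  show "f x \<le> max 1 (Max (range f))" for x by (simp add: le_max_iff_disj)
qed

lemma finite_upper_bound2:
  fixes f :: "'s::finite \<Rightarrow> 't::finite \<Rightarrow> real"
  obtains c where "c > 0" "\<And>x y. f x y \<le> c"
proof -
  obtain c where "c > 0" "\<And>p. f (fst p) (snd p) \<le> c"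
    using finite_upper_bound[of "\<lambda>p. f (fst p) (snd p)"] by blast
  then show ?thesis using that[of c] by (metis fst_conv snd_conv)
qed

text \<open>Brouwer's theorem for the normalised map x -> A x / total(A x) on the standard simplex.
  The eigenvalue of the fixed point is the normalising total. Positive entries of \<open>A\<close>
  make the image of any simplex point strictly positive, hence the fixed point too.\<close>

lemma perron_eigenvector:
  fixes A :: "'s::finite \<Rightarrow> 's \<Rightarrow> real"
  assumes pos: "\<And>j k. A j k > 0"
  obtains l r where "l > 0" "\<And>j. r j > 0" "\<And>j. mapp A r j = l * r j"
proof -
  define S :: "(real ^ 's) set" where "S = {x. (\<forall>i. 0 \<le> x $ i) \<and> (\<Sum>i\<in>UNIV. x $ i) = 1}"
  define tot where "tot = (\<lambda>x :: real ^ 's. \<Sum>i\<in>UNIV. mapp A (($) x) i)"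
  define f where "f = (\<lambda>x :: real ^ 's. \<chi> i. mapp A (($) x) i / tot x)"
  have ex_pos: "\<exists>i. x $ i > 0" if "x \<in> S" for x
  proof (rule ccontr)
    assume "\<nexists>i. x $ i > 0"
    then have "\<forall>i. x $ i = 0" using that unfolding S_def by (smt (verit) mem_Collect_eq)
    then show False using that by (simp add: S_def)
  qed
  have mpos: "mapp A (($) x) j > 0" if x: "x \<in> S" for x j
  proof -
    obtain i where "x $ i > 0" using ex_pos[OF x] by auto
    then show ?thesis unfolding mapp_def using x pos[of j]
      by (intro sum_pos2[of _ i]) (auto simp: S_def less_imp_le)
  qed
  have tot_pos: "tot x > 0" if "x \<in> S" for x
    unfolding tot_def by (intro sum_pos mpos that) auto
  have S_eq: "S = (\<Inter>i. {x. 0 \<le> x $ i}) \<inter> {x. (\<Sum>i\<in>UNIV. x $ i) = 1}"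
    by (auto simp: S_def)
  have "closed S" unfolding S_eq
    by (intro closed_Int closed_INT ballI closed_Collect_le closed_Collect_eq continuous_intros)
  moreover have "bounded S"
  proof (rule boundedI)
    fix x assume x: "x \<in> S"
    have "norm x \<le> (\<Sum>i\<in>UNIV. \<bar>x $ i\<bar>)" by (rule norm_le_l1_cart)
    also have "\<dots> = (\<Sum>i\<in>UNIV. x $ i)" using x by (intro sum.cong) (auto simp: S_def)
    finally show "norm x \<le> 1" using x by (simp add: S_def)
  qed
  ultimately have "compact S" by (simp add: compact_eq_bounded_closed)
  moreover have "convex S"
    by (rule convexI) (auto simp: S_def sum.distrib sum_distrib_left[symmetric])
  moreover have "(\<chi> i. 1 / real CARD('s)) \<in> S" by (simp add: S_def)
  then have "S \<noteq> {}" by blast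
  moreover have "continuous_on S f"
    unfolding f_def
    by (intro continuous_intros continuous_on_vec_lambda)
       (auto simp: tot_def[symmetric] mapp_def[abs_def] tot_def intro!: continuous_intros
         dest!: tot_pos[unfolded tot_def mapp_def])
  moreover have "f x \<in> S" if "x \<in> S" for x
  proof -
    have "(\<Sum>i\<in>UNIV. f x $ i) = tot x / tot x"
      by (simp add: f_def sum_divide_distrib[symmetric] tot_def)
    moreover have "0 \<le> f x $ i" for i
      using mpos[OF that, of i] tot_pos[OF that] by (simp add: f_def)
    ultimately show ?thesis using tot_pos[OF that] by (simp add: S_def)
  qed
  then have "f \<in> S \<rightarrow> S" by blast
  ultimately obtain x where x: "x \<in> S" "f x = x" using brouwer by blast
  have eig: "mapp A (($) x) j = tot x * x $ j" for j
    using arg_cong[OF x(2), of "\<lambda>y. y $ j"] tot_pos[OF x(1)] by (simp add: f_def field_simps)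
  show ?thesis
  proof (rule that)
    show "tot x > 0" by (rule tot_pos[OF x(1)])
    show "x $ j > 0" for j using mpos[OF x(1), of j] tot_pos[OF x(1)]
      unfolding eig by (simp add: zero_less_mult_iff)
    show "mapp A (($) x) j = tot x * x $ j" for j by (rule eig)
  qed
qed

section \<open>Walks, encoded as a starting state together with the list of later states\<close>

primrec walk_prod :: "('s \<Rightarrow> 's \<Rightarrow> 'a::comm_monoid_mult) \<Rightarrow> 's \<Rightarrow> 's list \<Rightarrow> 'a" where
  "walk_prod A x [] = 1"
| "walk_prod A x (y # ys) = A x y * walk_prod A y ys"

primrec walk_sum :: "('s \<Rightarrow> 's \<Rightarrow> real) \<Rightarrow> 's \<Rightarrow> 's list \<Rightarrow> real" where
  "walk_sum h x [] = 0"
| "walk_sum h x (y # ys) = h x y + walk_sum h y ys"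

primrec walk_end :: "'s \<Rightarrow> 's list \<Rightarrow> 's" where
  "walk_end x [] = x"
| "walk_end x (y # ys) = walk_end y ys"

lemma finite_paths [simp]: "finite (paths n :: 's::finite list set)"
  using finite_lists_length_eq[of "UNIV :: 's set" n] by (simp add: paths_def)

lemma paths_0 [simp]: "paths 0 = {[]}"
  by (auto simp: paths_def)

lemma paths_Suc: "paths (Suc n) = (\<lambda>(y, ys). y # ys) ` (UNIV \<times> paths n)"
  by (auto simp: paths_def length_Suc_conv image_iff)

lemma sum_paths_Suc:
  fixes F :: "'s::finite list \<Rightarrow> 'a::comm_monoid_add"
  shows "(\<Sum>ys\<in>paths (Suc n). F ys) = (\<Sum>y\<in>UNIV. \<Sum>ys\<in>paths n. F (y # ys))"
  unfolding paths_Suc by (subst sum.reindex) (auto simp: inj_on_def sum.cartesian_product case_prod_beta)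

text \<open>Each step of a walk is one application of the kernel. Choosing \<open>A\<close> turns
  total masses, moment generating functions and characteristic functions into matrix powers.\<close>

lemma sum_walks_eq_funpow:
  "(\<Sum>ys\<in>paths n. walk_prod A x ys * g (walk_end x ys)) = (mapp A ^^ n) g x"
  by (induction n arbitrary: x)
     (simp_all add: sum_paths_Suc mapp_def sum_distrib_left[symmetric] mult.assoc)

lemma walk_prod_pos: "(\<And>j k. A j k > 0) \<Longrightarrow> walk_prod A x ys > 0"
  for A :: "'s \<Rightarrow> 's \<Rightarrow> real"
  by (induction ys arbitrary: x) auto

lemma walk_prod_ge: "0 \<le> c \<Longrightarrow> (\<And>j k. c \<le> A j k) \<Longrightarrow> c ^ length ys \<le> walk_prod A x ys"
  for A :: "'s \<Rightarrow> 's \<Rightarrow> real"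
  by (induction ys arbitrary: x) (auto intro!: mult_mono intro: order_trans)

lemma walk_sum_diff_const: "walk_sum (\<lambda>j k. h j k - a) x ys = walk_sum h x ys - a * real (length ys)"
  by (induction ys arbitrary: x) (auto simp: algebra_simps)

text \<open>The exponential of an additive functional is multiplicative along the walk, so it can be
  absorbed into the kernel; \<open>walk_prod_iexp\<close> is the complex counterpart.\<close>

lemma walk_prod_exp: "walk_prod (\<lambda>j k. A j k * exp (c * h j k)) x ys = walk_prod A x ys * exp (c * walk_sum h x ys)"
  for A :: "'s \<Rightarrow> 's \<Rightarrow> real"
  by (induction ys arbitrary: x) (auto simp: distrib_left exp_add)

lemma walk_prod_iexp:
  "walk_prod (\<lambda>j k. complex_of_real (A j k) * iexp (t * h j k)) x ys
     = complex_of_real (walk_prod A x ys) * iexp (t * walk_sum h x ys)"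
  by (induction ys arbitrary: x) (auto simp: distrib_left exp_add)

text \<open>The quotients \<open>r k / r j\<close> telescope along the walk, so the Doob transform
  leaves only the two end points and one factor \<open>l\<close> per step.\<close>

lemma walk_prod_tilt:
  fixes A :: "'s \<Rightarrow> 's \<Rightarrow> real"
  assumes "\<And>j. r j > 0" "l > 0"
  shows "walk_prod (\<lambda>j k. A j k * r k / (l * r j)) x ys
     = walk_prod A x ys * r (walk_end x ys) / (l ^ length ys * r x)"
proof (induction ys arbitrary: x)
  case Nil
  then show ?case using assms(1)[of x] by simp
next
  case (Cons y ys)
  then show ?case using assms(1)[of x] assms(1)[of y] assms(2) by (simp add: field_simps)
qed

lemma walk_prod_nth: "walk_prod A x ys = (\<Prod>i<length ys. A ((x # ys) ! i) ((x # ys) ! (i + 1)))"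
  by (induction ys arbitrary: x) (simp_all add: prod.lessThan_Suc_shift del: prod.lessThan_Suc)

lemma walk_sum_nth: "walk_sum h x ys = (\<Sum>i<length ys. h ((x # ys) ! i) ((x # ys) ! (i + 1)))"
  by (induction ys arbitrary: x) (simp_all add: sum.lessThan_Suc_shift del: sum.lessThan_Suc)

text \<open>The step from \<open>x0\<close> to \<open>x\<close> is not counted: the sum begins at
  index 1, so it is a walk sum of \<open>N\<close> steps started at the second state.\<close>

lemma SN_Cons: "length ys = N \<Longrightarrow> SN h N (x0 # x # ys) = walk_sum h x ys"
  unfolding SN_def walk_sum_nth
  by (intro sum.reindex_bij_witness[of _ "\<lambda>i. i + 1" "\<lambda>i. i - 1"])
     (auto simp: nth_Cons split: nat.splits)

lemma path_prob_Cons: "path_prob mu P (x0 # x # ys) = mu x0 * P x0 x * walk_prod P x ys"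
  unfolding path_prob_def walk_prod_nth
  by (simp add: prod.lessThan_Suc_shift mult.assoc del: prod.lessThan_Suc)

text \<open>The state \<open>x0\<close> enters only through the weight it gives to the next state,
  so it can be summed out. What remains is a walk started from the law of x_1.\<close>

lemma expect_eq_walks:
  "expect mu P N (\<lambda>xs. F (SN h N xs)) = (\<Sum>x\<in>UNIV. (\<Sum>x0\<in>UNIV. mu x0 * P x0 x) *
     (\<Sum>ys\<in>paths N. walk_prod P x ys * F (walk_sum h x ys)))"
proof -
  have "expect mu P N (\<lambda>xs. F (SN h N xs)) = (\<Sum>x0\<in>UNIV. \<Sum>x\<in>UNIV. \<Sum>ys\<in>paths N.
      mu x0 * P x0 x * walk_prod P x ys * F (walk_sum h x ys))"
    unfolding expect_def by (simp add: sum_paths_Suc path_prob_Cons)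
      (intro sum.cong refl, auto simp: SN_Cons paths_def)
  also have "\<dots> = (\<Sum>x\<in>UNIV. \<Sum>x0\<in>UNIV. \<Sum>ys\<in>paths N.
      mu x0 * P x0 x * walk_prod P x ys * F (walk_sum h x ys))" by (rule sum.swap)
  finally show ?thesis by (simp add: sum_distrib_left sum_distrib_right mult.assoc sum.swap[of _ _ "paths N"])
qed

lemma Bn_eq_walks: "Bn h n = Max ((\<lambda>(x, ys). walk_sum h x ys) ` (UNIV \<times> paths n))"
proof -
  have "(\<Sum>j = 1..n. h (xs ! (j - 1)) (xs ! j)) = walk_sum h x ys" if "xs = x # ys" "length ys = n" for xs x ys
    unfolding walk_sum_nth that
    by (intro sum.reindex_bij_witness[of _ "\<lambda>i. i + 1" "\<lambda>i. i - 1"]) (use that in auto)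
  then show ?thesis unfolding Bn_def
    by (simp add: paths_Suc image_image case_prod_beta) (intro arg_cong[of _ _ Max] image_cong, auto simp: paths_def)
qed

section \<open>Positive stochastic matrices\<close>

locale pos_chain =
  fixes Q :: "'s::finite \<Rightarrow> 's \<Rightarrow> real" and p :: "'s \<Rightarrow> real"
  assumes Q_pos: "Q j k > 0" and Q_rows: "(\<Sum>k\<in>UNIV. Q j k) = 1"
    and p_pos: "p j > 0" and p_sum: "(\<Sum>j\<in>UNIV. p j) = 1"
    and p_stat: "(\<Sum>j\<in>UNIV. p j * Q j k) = p k"

text \<open>Perron's theorem for the transpose yields a positive left eigenvector; summing its
  equation over all coordinates forces the eigenvalue 1, because the rows of \<open>Q\<close> sum to
  1.\<close>

lemma pos_chain_exists:
  fixes Q :: "'s::finite \<Rightarrow> 's \<Rightarrow> real"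
  assumes pos: "\<And>j k. Q j k > 0" and rows: "\<And>j. (\<Sum>k\<in>UNIV. Q j k) = 1"
  obtains p where "pos_chain Q p"
proof -
  obtain l r where l: "l > 0" and r: "\<And>j. r j > 0"
    and eig: "\<And>j. mapp (\<lambda>j k. Q k j) r j = l * r j"
    using perron_eigenvector[of "\<lambda>j k. Q k j"] pos by metis
  define R where "R = (\<Sum>j\<in>UNIV. r j)"
  have R: "R > 0" unfolding R_def by (intro sum_pos r) auto
  have "l * R = (\<Sum>k\<in>UNIV. \<Sum>j\<in>UNIV. Q j k * r j)"
    unfolding R_def sum_distrib_left eig[symmetric] mapp_def ..
  also have "\<dots> = (\<Sum>j\<in>UNIV. (\<Sum>k\<in>UNIV. Q j k) * r j)"
    by (subst sum.swap) (simp add: sum_distrib_right)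
  also have "\<dots> = R" by (simp add: rows R_def)
  finally have "l = 1" using R by simp
  have "pos_chain Q (\<lambda>j. r j / R)"
  proof
    show "(\<Sum>j\<in>UNIV. r j / R * Q j k) = r k / R" for k
      using eig[of k] \<open>l = 1\<close> by (simp add: mapp_def sum_divide_distrib[symmetric] mult.commute)
    show "(\<Sum>j\<in>UNIV. r j / R) = 1" using R by (simp add: sum_divide_distrib[symmetric] R_def)
  qed (use pos rows r R in auto)
  then show thesis by (rule that)
qed

context pos_chain
begin

definition avg :: "('s \<Rightarrow> real) \<Rightarrow> real" where
  "avg g = (\<Sum>j\<in>UNIV. p j * g j)"

lemma avg_const: "avg (\<lambda>_. c) = c"
  by (simp add: avg_def sum_distrib_right[symmetric] p_sum)

lemma avg_diff: "avg (\<lambda>j. f j - g j) = avg f - avg g"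
  by (simp add: avg_def right_diff_distrib sum_subtractf)

lemma avg_mapp: "avg (mapp Q g) = avg g"
proof -
  have "avg (mapp Q g) = (\<Sum>k\<in>UNIV. \<Sum>j\<in>UNIV. p j * Q j k * g k)"
    unfolding avg_def mapp_def sum_distrib_left by (subst sum.swap) (simp add: mult.assoc)
  then show ?thesis by (simp add: sum_distrib_right[symmetric] p_stat avg_def)
qed

lemma avg_mapp_funpow: "avg ((mapp Q ^^ n) g) = avg g"
  by (induction n) (simp_all add: avg_mapp)

lemma mapp_const: "mapp Q (\<lambda>_. c) = (\<lambda>_. c)"
  by (rule ext) (simp add: mapp_def sum_distrib_right[symmetric] Q_rows)

lemma mapp_funpow_const: "(mapp Q ^^ n) (\<lambda>_. c) = (\<lambda>_. c)"
  by (induction n) (simp_all add: mapp_const)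

text \<open>Doeblin's argument: on functions of mean zero, \<open>Q\<close> acts as \<open>Q - \<delta> p\<close>, which is
  nonnegative with row sums \<open>1 - \<delta>\<close>.\<close>

lemma contraction:
  "\<exists>\<rho>\<ge>0. \<rho> < 1 \<and> (\<forall>g B n j. avg g = 0 \<longrightarrow> (\<forall>k. \<bar>g k\<bar> \<le> B) \<longrightarrow> \<bar>(mapp Q ^^ n) g j\<bar> \<le> \<rho> ^ n * B)"
proof -
  obtain d where d: "d > 0" "\<And>j k. d \<le> Q j k" using finite_pos_lower_bound2[of Q] Q_pos by blast
  have p1: "p k \<le> 1" for k
    using member_le_sum[of k UNIV p] p_pos by (simp add: p_sum less_imp_le)
  \<comment> \<open>Doeblin minorisation: since \<open>p k\<close> is at most 1,
    \<open>d * p k\<close> stays below the common lower bound \<open>d\<close> of all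
    entries.\<close>
  have dQ: "d * p k \<le> Q j k" for j k
    using mult_mono[of d "Q j k" "p k" 1] d p1 p_pos[of k] Q_pos[of j k] by (simp add: less_imp_le)
  have rows: "(\<Sum>k\<in>UNIV. Q j k - d * p k) = 1 - d" for j
    by (simp add: sum_subtractf Q_rows sum_distrib_left[symmetric] p_sum)
  have d1: "d \<le> 1"
    using sum_nonneg[of UNIV "\<lambda>k. Q undefined k - d * p k"] dQ rows[of undefined] by simp
  have step: "\<bar>mapp Q g j\<bar> \<le> (1 - d) * B" if g: "avg g = 0" "\<And>k. \<bar>g k\<bar> \<le> B" for g B j
  proof -
    have "mapp Q g j = (\<Sum>k\<in>UNIV. (Q j k - d * p k) * g k)"
      using g(1) by (simp add: mapp_def left_diff_distrib sum_subtractf avg_def mult.assoc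
          sum_distrib_left[symmetric])
    also have "\<bar>\<dots>\<bar> \<le> (\<Sum>k\<in>UNIV. (Q j k - d * p k) * B)"
      using dQ g(2) by (intro order_trans[OF sum_abs] sum_mono) (auto simp: abs_mult intro!: mult_left_mono)
    finally show ?thesis by (simp add: sum_distrib_right[symmetric] rows)
  qed
  show ?thesis
  proof (intro exI[of _ "1 - d"] conjI allI impI)
    fix g B n j assume g: "avg g = 0" "\<forall>k. \<bar>g k\<bar> \<le> B"
    show "\<bar>(mapp Q ^^ n) g j\<bar> \<le> (1 - d) ^ n * B"
    proof (induction n arbitrary: j)
      case (Suc n)
      then show ?case using step[of "(mapp Q ^^ n) g" "(1 - d) ^ n * B" j] g
        by (simp add: avg_mapp_funpow mult.assoc)
    qed (use g in auto)
  qed (use d d1 in auto)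
qed

text \<open>The Neumann series of the powers of \<open>Q\<close> applied to \<open>b\<close>
  converges geometrically because \<open>b\<close> has mean zero, and applying \<open>Q\<close>
  drops its first term.\<close>

lemma poisson_equation:
  assumes "avg b = 0"
  obtains u where "\<And>j. u j - mapp Q u j = b j"
proof -
  obtain \<rho> where \<rho>: "0 \<le> \<rho>" "\<rho> < 1"
    "\<And>g B n j. avg g = 0 \<Longrightarrow> (\<And>k. \<bar>g k\<bar> \<le> B) \<Longrightarrow> \<bar>(mapp Q ^^ n) g j\<bar> \<le> \<rho> ^ n * B"
    using contraction by blast
  obtain B where B: "\<And>k. \<bar>b k\<bar> \<le> B" using finite_upper_bound[of "\<lambda>k. \<bar>b k\<bar>"] by blast
  have sm: "summable (\<lambda>n. (mapp Q ^^ n) b j)" for j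
  proof (rule summable_comparison_test'[of "\<lambda>n. \<rho> ^ n * B" 0])
    show "summable (\<lambda>n. \<rho> ^ n * B)" using \<rho>(1,2) by (intro summable_mult2 summable_geometric) simp
    show "norm ((mapp Q ^^ n) b j) \<le> \<rho> ^ n * B" for n
      unfolding real_norm_def by (rule \<rho>(3)[OF assms B])
  qed
  define u where "u j = (\<Sum>n. (mapp Q ^^ n) b j)" for j
  have "u j - mapp Q u j = b j" for j
  proof -
    have "mapp Q u j = (\<Sum>n. mapp Q ((mapp Q ^^ n) b) j)"
      unfolding mapp_def[of Q u] u_def mapp_def[of Q "(mapp Q ^^ _) b"]
      by (subst suminf_sum) (auto intro: summable_mult sm simp: suminf_mult sm)
    also have "\<dots> = (\<Sum>n. (mapp Q ^^ Suc n) b j)" by simp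
    also have "\<dots> = u j - b j" using suminf_split_head[OF sm[of j]] by (simp add: u_def)
    finally show ?thesis by simp
  qed
  then show thesis by (rule that)
qed

lemma mapp_funpow_tendsto_avg: "(\<lambda>n. (mapp Q ^^ n) g j) \<longlonglongrightarrow> avg g"
proof -
  obtain \<rho> where \<rho>: "0 \<le> \<rho>" "\<rho> < 1"
    "\<And>g B n j. avg g = 0 \<Longrightarrow> (\<And>k. \<bar>g k\<bar> \<le> B) \<Longrightarrow> \<bar>(mapp Q ^^ n) g j\<bar> \<le> \<rho> ^ n * B"
    using contraction by blast
  define g0 where "g0 = (\<lambda>k. g k - avg g)"
  obtain B where B: "\<And>k. \<bar>g0 k\<bar> \<le> B" using finite_upper_bound[of "\<lambda>k. \<bar>g0 k\<bar>"] by blast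
  have "avg g0 = 0" by (simp add: g0_def avg_diff avg_const)
  then have *: "norm ((mapp Q ^^ n) g0 j) \<le> \<rho> ^ n * B" for n
    unfolding real_norm_def by (rule \<rho>(3)) (rule B)
  have "(\<lambda>n. \<rho> ^ n * B) \<longlonglongrightarrow> 0 * B"
    using \<rho> by (intro tendsto_mult tendsto_const LIMSEQ_power_zero) auto
  then have "(\<lambda>n. (mapp Q ^^ n) g0 j) \<longlonglongrightarrow> 0"
    unfolding mult_zero_left by (rule Lim_null_comparison[rotated]) (rule always_eventually, rule allI, rule * )
  moreover have "(mapp Q ^^ n) g0 j = (mapp Q ^^ n) g j - avg g" for n
    by (simp add: g0_def mapp_funpow_diff mapp_funpow_const)
  ultimately show ?thesis by (simp add: LIM_zero_iff)
qed

section \<open>Stationary mean increment and the growth of expected walk sums\<close>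

definition drift :: "('s \<Rightarrow> 's \<Rightarrow> real) \<Rightarrow> real" where
  "drift h = avg (\<lambda>j. \<Sum>k\<in>UNIV. Q j k * h j k)"

lemma drift_centre: "drift (\<lambda>j k. h j k - drift h) = 0"
  unfolding drift_def[of "\<lambda>j k. h j k - drift h"]
  by (simp add: right_diff_distrib sum_subtractf sum_distrib_right[symmetric] Q_rows avg_diff avg_const
      drift_def[symmetric])

lemma poisson_centred:
  obtains u where "\<And>j. u j - mapp Q u j = (\<Sum>k\<in>UNIV. Q j k * (h j k - drift h))"
  using poisson_equation[of "\<lambda>j. \<Sum>k\<in>UNIV. Q j k * (h j k - drift h)"] drift_centre[of h]
  unfolding drift_def[of "\<lambda>j k. h j k - drift h"] by blast

lemma sum_walk_prod: "(\<Sum>ys\<in>paths n. walk_prod Q x ys) = 1"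
  using sum_walks_eq_funpow[of Q x "\<lambda>_. 1" n] mapp_funpow_const[of n 1] by simp

text \<open>Martingale decomposition: given the current state, \<open>f\<close> has the same
  conditional mean as the decrease of \<open>u\<close>, so the expectation telescopes to boundary
  terms.\<close>

lemma sum_walk_prod_walk_sum:
  assumes u: "\<And>j. u j - mapp Q u j = (\<Sum>k\<in>UNIV. Q j k * f j k)"
  shows "(\<Sum>ys\<in>paths n. walk_prod Q x ys * walk_sum f x ys) = u x - (mapp Q ^^ n) u x"
proof (induction n arbitrary: x)
  case (Suc n)
  have "(\<Sum>ys\<in>paths (Suc n). walk_prod Q x ys * walk_sum f x ys)
    = (\<Sum>y\<in>UNIV. Q x y * (f x y * (\<Sum>ys\<in>paths n. walk_prod Q y ys)
        + (\<Sum>ys\<in>paths n. walk_prod Q y ys * walk_sum f y ys)))"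
    by (simp add: sum_paths_Suc sum_distrib_left sum.distrib algebra_simps)
  also have "\<dots> = (\<Sum>y\<in>UNIV. Q x y * f x y) + mapp Q u x - (mapp Q ^^ Suc n) u x"
    by (simp add: Suc sum_walk_prod mapp_def[of Q u] mapp_def[of Q "(mapp Q ^^ n) u"]
        sum.distrib sum_subtractf algebra_simps)
  finally show ?case by (simp add: u[symmetric])
qed simp

text \<open>Expected centred sums stay bounded, so they vanish after division by \<open>N\<close>.
  This translates the assumption on the limiting mean into a statement about the stationary
  drift.\<close>

lemma mean_walk_sum_tendsto_drift:
  assumes "(\<Sum>x\<in>UNIV. \<nu> x) = 1"
  shows "(\<lambda>N. (\<Sum>x\<in>UNIV. \<nu> x * (\<Sum>ys\<in>paths N. walk_prod Q x ys * walk_sum h x ys)) / real N)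
           \<longlonglongrightarrow> drift h"
proof -
  obtain u where u: "\<And>j. u j - mapp Q u j = (\<Sum>k\<in>UNIV. Q j k * (h j k - drift h))"
    using poisson_centred[of h] by blast
  have eq: "(\<Sum>ys\<in>paths N. walk_prod Q x ys * walk_sum h x ys)
      = u x - (mapp Q ^^ N) u x + drift h * real N" for x N
  proof -
    have "walk_sum h x ys = walk_sum (\<lambda>j k. h j k - drift h) x ys + drift h * real N" if "ys \<in> paths N" for ys
      using that by (simp add: walk_sum_diff_const paths_def)
    then have "(\<Sum>ys\<in>paths N. walk_prod Q x ys * walk_sum h x ys)
      = (\<Sum>ys\<in>paths N. walk_prod Q x ys * walk_sum (\<lambda>j k. h j k - drift h) x ys)
        + (\<Sum>ys\<in>paths N. walk_prod Q x ys) * (drift h * real N)"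
      by (simp add: distrib_left sum.distrib sum_distrib_right)
    then show ?thesis by (simp only: sum_walk_prod_walk_sum[OF u] sum_walk_prod mult_1)
  qed
  have "(\<lambda>N. (\<Sum>x\<in>UNIV. \<nu> x * (u x - (mapp Q ^^ N) u x)) * (1 / real N) + drift h)
      \<longlonglongrightarrow> (\<Sum>x\<in>UNIV. \<nu> x * (u x - avg u)) * 0 + drift h"
    by (intro tendsto_intros mapp_funpow_tendsto_avg lim_1_over_n)
  moreover have "eventually (\<lambda>N. (\<Sum>x\<in>UNIV. \<nu> x * (u x - (mapp Q ^^ N) u x)) * (1 / real N) + drift h
     = (\<Sum>x\<in>UNIV. \<nu> x * (\<Sum>ys\<in>paths N. walk_prod Q x ys * walk_sum h x ys)) / real N) sequentially"
    using eventually_gt_at_top[of 0]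
  proof eventually_elim
    case (elim N)
    have "(\<Sum>x\<in>UNIV. \<nu> x * (u x - (mapp Q ^^ N) u x + drift h * real N))
       = (\<Sum>x\<in>UNIV. \<nu> x * (u x - (mapp Q ^^ N) u x)) + drift h * real N"
      by (simp only: distrib_left sum.distrib sum_distrib_right[symmetric] assms mult_1)
    then show ?case using elim by (simp add: eq add_divide_distrib)
  qed
  ultimately show ?thesis unfolding mult_zero_right add_0 by (rule Lim_transform_eventually)
qed

end

section \<open>Twisted kernels\<close>

lemma iexp_quadratic_remainder:
  "((\<lambda>s::real. (iexp (s * x) - (1 + \<i> * (s * x) - (s * x)\<^sup>2 / 2)) / of_real (s\<^sup>2)) \<longlongrightarrow> 0) (at 0)"
proof (rule Lim_null_comparison)
  have "norm ((iexp (s * x) - (1 + \<i> * (s * x) - (s * x)\<^sup>2 / 2)) / of_real (s\<^sup>2)) \<le> \<bar>s\<bar> * \<bar>x\<bar>^3 / 6"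
    if "s \<noteq> 0" for s
  proof -
    have "(\<Sum>k\<le>2. (\<i> * complex_of_real (s * x)) ^ k / fact k) = 1 + \<i> * (s * x) - (s * x)\<^sup>2 / 2"
      by (simp add: numeral_2_eq_2 power2_eq_square field_simps)
    then have "norm (iexp (s * x) - (1 + \<i> * (s * x) - (s * x)\<^sup>2 / 2)) \<le> \<bar>s * x\<bar>^3 / 6"
      using iexp_approx1[of "s * x" 2] by (simp add: eval_nat_numeral fact_numeral)
    then have "norm ((iexp (s * x) - (1 + \<i> * (s * x) - (s * x)\<^sup>2 / 2)) / of_real (s\<^sup>2)) \<le> \<bar>s * x\<bar>^3 / 6 / s\<^sup>2"
      unfolding norm_divide by (intro divide_mono) (use that in \<open>auto simp: norm_power\<close>)
    also have "\<dots> = \<bar>s\<bar> * \<bar>x\<bar>^3 / 6"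
    proof -
      have "\<bar>s\<bar> ^ 3 = \<bar>s\<bar> * s\<^sup>2" by (simp add: power3_eq_cube power2_eq_square)
      then show ?thesis using that by (simp add: abs_mult power_mult_distrib)
    qed
    finally show ?thesis .
  qed
  then show "\<forall>\<^sub>F s in at 0. norm ((iexp (s * x) - (1 + \<i> * (s * x) - (s * x)\<^sup>2 / 2)) / of_real (s\<^sup>2))
      \<le> \<bar>s\<bar> * \<bar>x\<bar>^3 / 6"
    by (auto simp: eventually_at_filter)
  have "((\<lambda>s. \<bar>s\<bar> * \<bar>x\<bar> ^ 3 / 6) \<longlongrightarrow> \<bar>0\<bar> * \<bar>x\<bar>^3 / 6) (at 0)" by (intro tendsto_intros) simp
  then show "((\<lambda>s. \<bar>s\<bar> * \<bar>x\<bar> ^ 3 / 6) \<longlongrightarrow> 0) (at 0)" by simp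
qed

lemma exp_square_remainder:
  "((\<lambda>s::real. (exp (- c * s\<^sup>2) - (1 - c * s\<^sup>2)) / s\<^sup>2) \<longlongrightarrow> 0) (at 0)" for c :: real
proof -
  have "((\<lambda>y. exp (- c * y)) has_field_derivative - c) (at 0)"
    by (auto intro!: derivative_eq_intros)
  then have "((\<lambda>y. (exp (- c * y) - 1) / y) \<longlongrightarrow> - c) (at 0)"
    by (simp add: has_field_derivative_iff)
  moreover have "filterlim (\<lambda>s::real. s\<^sup>2) (at 0) (at 0)"
    by (rule filterlim_atI) (auto intro!: tendsto_eq_intros simp: eventually_at_filter)
  ultimately have "((\<lambda>s. (exp (- c * s\<^sup>2) - 1) / s\<^sup>2) \<longlongrightarrow> - c) (at 0)"
    by (rule filterlim_compose)
  then have "((\<lambda>s. (exp (- c * s\<^sup>2) - 1) / s\<^sup>2 + c) \<longlongrightarrow> - c + c) (at 0)"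
    by (intro tendsto_intros)
  moreover have "\<forall>\<^sub>F s in at 0. (exp (- c * s\<^sup>2) - 1) / s\<^sup>2 + c = (exp (- c * s\<^sup>2) - (1 - c * s\<^sup>2)) / s\<^sup>2"
    by (auto simp: eventually_at_filter field_simps)
  ultimately show ?thesis unfolding add.left_inverse by (rule Lim_transform_eventually)
qed

text \<open>Row sums at most 1 mean that \<open>A\<close> does not increase the supremum norm, so
  the errors of the \<open>n\<close> steps merely add up. The bound \<open>K\<close> on the powers
  of \<open>m\<close> allows the modulus of \<open>m\<close> to exceed 1.\<close>

lemma approx_eigen_funpow:
  fixes A :: "'s::finite \<Rightarrow> 's \<Rightarrow> complex"
  assumes rows: "\<And>j. (\<Sum>k\<in>UNIV. norm (A j k)) \<le> 1"
    and err: "\<And>j. norm (mapp A v j - m * v j) \<le> e"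
    and K: "\<And>i. i < n \<Longrightarrow> norm m ^ i \<le> K" and e: "0 \<le> e" and K0: "0 \<le> K"
  shows "norm ((mapp A ^^ n) v j - m ^ n * v j) \<le> real n * (K * e)"
  using K
proof (induction n arbitrary: j)
  case (Suc n)
  have "(mapp A ^^ Suc n) v j - m ^ Suc n * v j
     = mapp A (\<lambda>k. (mapp A ^^ n) v k - m ^ n * v k) j + m ^ n * (mapp A v j - m * v j)"
    by (simp add: mapp_diff mapp_cmult right_diff_distrib mult.assoc mult.left_commute)
  also have "norm \<dots> \<le> 1 * (real n * (K * e)) + K * e"
  proof (rule norm_triangle_mono)
    show "norm (mapp A (\<lambda>k. (mapp A ^^ n) v k - m ^ n * v k) j) \<le> 1 * (real n * (K * e))"
      using Suc e K0 by (intro mapp_norm_le rows) auto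
    show "norm (m ^ n * (mapp A v j - m * v j)) \<le> K * e"
      unfolding norm_mult norm_power using Suc.prems err K0 by (intro mult_mono) auto
  qed
  finally show ?case by (simp add: algebra_simps)
qed simp

context pos_chain
begin

definition twist :: "('s \<Rightarrow> 's \<Rightarrow> real) \<Rightarrow> real \<Rightarrow> 's \<Rightarrow> 's \<Rightarrow> complex" where
  "twist f t j k = complex_of_real (Q j k) * iexp (t * f j k)"

lemma norm_twist: "norm (twist f t j k) = Q j k"
  using Q_pos[of j k] by (simp add: twist_def norm_mult)

lemma twist_rows: "(\<Sum>k\<in>UNIV. norm (twist f t j k)) \<le> 1"
  by (simp add: norm_twist Q_rows)

lemma twist_funpow_norm_le:
  assumes "\<And>k. norm (g k) \<le> B"
  shows "norm ((mapp (twist f t) ^^ n) g j) \<le> B"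
proof -
  have "0 \<le> B" using assms norm_ge_zero order_trans by blast
  then show ?thesis
  proof (induction n arbitrary: j)
    case (Suc n)
    then show ?case using mapp_norm_le[of "(mapp (twist f t) ^^ n) g" B "twist f t" j 1] twist_rows by auto
  qed (use assms in auto)
qed

lemma twist_funpow_norm_le_sum: "norm ((mapp (twist f t) ^^ n) g j) \<le> (\<Sum>k\<in>UNIV. norm (g k))"
  by (rule twist_funpow_norm_le) (auto intro: member_le_sum)

lemma isCont_twist_funpow: "isCont (\<lambda>t. (mapp (twist f t) ^^ n) g j) t0"
  by (induction n arbitrary: j) (auto simp: mapp_def[of "twist _ _"] twist_def intro!: continuous_intros)

lemma twist_0_funpow: "(mapp (twist f 0) ^^ n) (\<lambda>k. complex_of_real (g k)) j = complex_of_real ((mapp Q ^^ n) g j)"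
  by (induction n arbitrary: j) (simp_all add: mapp_def[of "twist _ _"] mapp_def[of Q] twist_def)

text \<open>The vector \<open>1 + i s u + s\<^sup>2 w\<close> is an eigenvector of the twisted kernel up to \<open>o(s\<^sup>2)\<close>, where \<open>u\<close> and
  \<open>w\<close> solve the Poisson equations obtained by comparing coefficients.\<close>

lemma twist_approx_eigenvector:
  assumes "drift f = 0"
  shows "\<exists>(\<kappa> :: real) (v :: real \<Rightarrow> 's \<Rightarrow> complex). v 0 = (\<lambda>_. 1) \<and> (\<forall>j. isCont (\<lambda>s. v s j) 0) \<and>
    (\<forall>j. ((\<lambda>s. (mapp (twist f s) (v s) j - of_real (exp (- \<kappa> * s\<^sup>2)) * v s j) / of_real (s\<^sup>2)) \<longlongrightarrow> 0) (at 0))"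
proof -
  obtain u where u: "\<And>j. u j - mapp Q u j = (\<Sum>k\<in>UNIV. Q j k * (f j k - drift f))"
    using poisson_centred[of f] by blast
  \<comment> \<open>Order \<open>s\<^sup>2\<close> of the eigenvector equation reads
    \<open>w - mapp Q w = \<kappa> - c\<close>. Taking \<open>\<kappa> = avg c\<close> gives the
    right side mean zero and makes it solvable; this \<open>\<kappa>\<close> is half the asymptotic
    variance.\<close>
  define c where "c j = (\<Sum>k\<in>UNIV. Q j k * ((f j k)\<^sup>2 / 2 + f j k * u k))" for j
  define \<kappa> where "\<kappa> = avg c"
  have "avg (\<lambda>j. \<kappa> - c j) = 0" by (simp add: avg_diff avg_const \<kappa>_def)
  then obtain w where w: "\<And>j. w j - mapp Q w j = \<kappa> - c j" using poisson_equation by blast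
  define v where "v s j = 1 + \<i> * s * u j + s\<^sup>2 * w j" for s :: real and j
  define R where "R s x = iexp (s * x) - (1 + \<i> * (s * x) - (s * x)\<^sup>2 / 2)" for s x :: real
  define R2 where "R2 s = exp (- \<kappa> * s\<^sup>2) - (1 - \<kappa> * s\<^sup>2)" for s :: real
  \<comment> \<open>The coefficients \<open>\<alpha>\<close> and \<open>\<beta>\<close> of orders 3
    and 4 come from multiplying the quadratic Taylor polynomial of the phase by the quadratic vector
    \<open>v\<close>.\<close>
  define \<alpha> where "\<alpha> j = (\<Sum>k\<in>UNIV. complex_of_real (Q j k) * (\<i> * f j k * w k - \<i> * (f j k)\<^sup>2 * u k / 2))" for j
  define \<beta> where "\<beta> j = (\<Sum>k\<in>UNIV. complex_of_real (Q j k) * ((f j k)\<^sup>2 * w k / 2))" for j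
  have u': "u j = (\<Sum>k\<in>UNIV. Q j k * (f j k + u k))" for j
    using u[of j] assms by (simp add: mapp_def distrib_left sum.distrib)
  have w': "w j - \<kappa> = (\<Sum>k\<in>UNIV. Q j k * (w k - ((f j k)\<^sup>2 / 2 + f j k * u k)))" for j
    using w[of j] by (simp add: mapp_def c_def right_diff_distrib sum_subtractf)
  have expand: "mapp (twist f s) (v s) j = 1 + \<i> * s * u j + s\<^sup>2 * (w j - \<kappa>) + s^3 * \<alpha> j - s^4 * \<beta> j
      + (\<Sum>k\<in>UNIV. complex_of_real (Q j k) * (R s (f j k) * v s k))" for s j
  proof -
    have trm: "twist f s j k * v s k = complex_of_real (Q j k) * 1 + \<i> * s * complex_of_real (Q j k * (f j k + u k))
        + s\<^sup>2 * complex_of_real (Q j k * (w k - ((f j k)\<^sup>2 / 2 + f j k * u k)))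
        + s^3 * (complex_of_real (Q j k) * (\<i> * f j k * w k - \<i> * (f j k)\<^sup>2 * u k / 2))
        - s^4 * (complex_of_real (Q j k) * ((f j k)\<^sup>2 * w k / 2))
        + complex_of_real (Q j k) * (R s (f j k) * v s k)" for k
    proof -
      have ie: "iexp (s * f j k) = R s (f j k) + (1 + \<i> * (s * f j k) - (s * f j k)\<^sup>2 / 2)"
        by (simp add: R_def)
      have "twist f s j k * v s k = complex_of_real (Q j k) * ((1 + \<i> * (s * f j k) - (s * f j k)\<^sup>2 / 2) * v s k)
         + complex_of_real (Q j k) * (R s (f j k) * v s k)"
        unfolding twist_def ie by (simp add: algebra_simps)
      also have "(1 + \<i> * (s * f j k) - (s * f j k)\<^sup>2 / 2) * v s k = 1 + \<i> * s * (f j k + u k)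
         + s\<^sup>2 * (w k - ((f j k)\<^sup>2 / 2 + f j k * u k))
         + s^3 * (\<i> * f j k * w k - \<i> * (f j k)\<^sup>2 * u k / 2) - s^4 * ((f j k)\<^sup>2 * w k / 2)"
        unfolding v_def by (simp add: field_simps eval_nat_numeral)
      finally show ?thesis by (simp add: algebra_simps)
    qed
    have "mapp (twist f s) (v s) j = (\<Sum>k\<in>UNIV. complex_of_real (Q j k)) + \<i> * s * complex_of_real (u j)
        + s\<^sup>2 * complex_of_real (w j - \<kappa>) + s^3 * \<alpha> j - s^4 * \<beta> j
        + (\<Sum>k\<in>UNIV. complex_of_real (Q j k) * (R s (f j k) * v s k))"
      unfolding mapp_def trm u'[of j] w'[of j] \<alpha>_def \<beta>_def of_real_sum
      by (simp add: sum.distrib sum_subtractf sum_distrib_left)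
    then show ?thesis using Q_rows[of j] by (simp flip: of_real_sum)
  qed
  have vcont: "isCont (\<lambda>s. v s j) s0" for j s0
    unfolding v_def by (intro continuous_intros)
  have v0: "((\<lambda>s. v s j) \<longlongrightarrow> 1) (at 0)" for j
    using vcont[of 0 j] by (simp add: isCont_def v_def)
  have "((\<lambda>s. (mapp (twist f s) (v s) j - of_real (exp (- \<kappa> * s\<^sup>2)) * v s j) / of_real (s\<^sup>2)) \<longlongrightarrow> 0) (at 0)" for j
  proof -
    \<comment> \<open>The quotient in question, rewritten for nonzero \<open>s\<close> so that each
      summand visibly tends to zero.\<close>
    define G :: "real \<Rightarrow> complex" where "G s = of_real s * \<alpha> j - (of_real s)\<^sup>2 * \<beta> j
       + (\<Sum>k\<in>UNIV. complex_of_real (Q j k) * (R s (f j k) / of_real (s\<^sup>2) * v s k))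
       + of_real \<kappa> * (\<i> * of_real s * of_real (u j) + (of_real s)\<^sup>2 * of_real (w j))
       - of_real (R2 s / s\<^sup>2) * v s j" for s
    have "(G \<longlongrightarrow> of_real 0 * \<alpha> j - (of_real 0)\<^sup>2 * \<beta> j + (\<Sum>k\<in>UNIV. complex_of_real (Q j k) * (0 * 1))
       + of_real \<kappa> * (\<i> * of_real 0 * of_real (u j) + (of_real 0)\<^sup>2 * of_real (w j)) - of_real 0 * 1) (at 0)"
      unfolding R_def R2_def G_def
      by (intro tendsto_intros iexp_quadratic_remainder exp_square_remainder v0)
    moreover have "G s = (mapp (twist f s) (v s) j - of_real (exp (- \<kappa> * s\<^sup>2)) * v s j) / of_real (s\<^sup>2)"
      if s: "s \<noteq> 0" for s
    proof -
      have e: "exp (- \<kappa> * s\<^sup>2) = R2 s + 1 - \<kappa> * s\<^sup>2" by (simp add: R2_def)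
      define \<Sigma> where "\<Sigma> = (\<Sum>k\<in>UNIV. complex_of_real (Q j k) * (R s (f j k) * v s k))"
      have S: "(\<Sum>k\<in>UNIV. complex_of_real (Q j k) * (R s (f j k) / of_real (s\<^sup>2) * v s k)) = \<Sigma> / of_real (s\<^sup>2)"
        by (simp add: \<Sigma>_def sum_divide_distrib)
      have "of_real s * \<alpha> j - (of_real s)\<^sup>2 * \<beta> j + \<Sigma> / of_real (s\<^sup>2)
         + of_real \<kappa> * (\<i> * of_real s * of_real (u j) + (of_real s)\<^sup>2 * of_real (w j))
         - of_real (R2 s / s\<^sup>2) * v s j
         = (1 + \<i> * s * u j + s\<^sup>2 * (w j - \<kappa>) + s^3 * \<alpha> j - s^4 * \<beta> j + \<Sigma>
            - of_real (R2 s + 1 - \<kappa> * s\<^sup>2) * v s j) / of_real (s\<^sup>2)"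
        using s unfolding v_def by (simp add: field_simps eval_nat_numeral)
      then show ?thesis unfolding G_def S expand e \<Sigma>_def[symmetric] by simp
    qed
    then have "\<forall>\<^sub>F s in at 0. G s = (mapp (twist f s) (v s) j - of_real (exp (- \<kappa> * s\<^sup>2)) * v s j) / of_real (s\<^sup>2)"
      by (simp add: eventually_at_filter)
    ultimately have "((\<lambda>s. (mapp (twist f s) (v s) j - of_real (exp (- \<kappa> * s\<^sup>2)) * v s j) / of_real (s\<^sup>2))
      \<longlongrightarrow> of_real 0 * \<alpha> j - (of_real 0)\<^sup>2 * \<beta> j + (\<Sum>k\<in>UNIV. complex_of_real (Q j k) * (0 * 1))
       + of_real \<kappa> * (\<i> * of_real 0 * of_real (u j) + (of_real 0)\<^sup>2 * of_real (w j)) - of_real 0 * 1) (at 0)"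
      by (rule Lim_transform_eventually)
    then show ?thesis by simp
  qed
  moreover have "v 0 = (\<lambda>_. 1)" by (simp add: v_def fun_eq_iff)
  ultimately show ?thesis using vcont by blast
qed

end

section \<open>Central limit theorem for powers of the twisted kernel\<close>

context pos_chain
begin

text \<open>At \<open>s = t / sqrt N\<close> the approximate eigenvector makes an error o(1/N) in
  each of the \<open>N\<close> steps, so the errors vanish in total, while the eigenvalue raised to
  the power \<open>N\<close> is exactly \<open>exp (- \<kappa> * t\<^sup>2)\<close>. A general end
  function \<open>g\<close> is reduced to the constant \<open>avg g\<close> by mixing.\<close>

lemma twist_funpow_tendsto:
  assumes "drift f = 0"
  obtains \<kappa> :: real where "\<And>g t j. (\<lambda>N. (mapp (twist f (t / sqrt (real N))) ^^ N) (\<lambda>k. complex_of_real (g k)) j)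
      \<longlonglongrightarrow> complex_of_real (avg g * exp (- \<kappa> * t\<^sup>2))"
proof -
  obtain \<kappa> v where v0: "v 0 = (\<lambda>_. 1)" and vcont: "\<And>j. isCont (\<lambda>s. v s j) 0"
    and err: "\<And>j. ((\<lambda>s. (mapp (twist f s) (v s) j - of_real (exp (- \<kappa> * s\<^sup>2)) * v s j) / of_real (s\<^sup>2)) \<longlongrightarrow> 0) (at 0)"
    using twist_approx_eigenvector[OF assms] by blast
  define E where "E s j = mapp (twist f s) (v s) j - of_real (exp (- \<kappa> * s\<^sup>2)) * v s j" for s j
  have "(\<lambda>N. (mapp (twist f (t / sqrt (real N))) ^^ N) (\<lambda>k. complex_of_real (g k)) j)
      \<longlonglongrightarrow> complex_of_real (avg g * exp (- \<kappa> * t\<^sup>2))" for g t j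
  proof -
    define s where "s N = t / sqrt (real N)" for N :: nat
    define M where "M N = mapp (twist f (s N))" for N
    have s0: "s \<longlonglongrightarrow> 0" unfolding s_def
      by (intro tendsto_divide_0[OF tendsto_const] filterlim_at_top_imp_at_infinity
          filterlim_real_sequentially filterlim_compose[OF sqrt_at_top])
    have E_lim: "(\<lambda>N. real N * norm (E (s N) k)) \<longlonglongrightarrow> 0" for k
    proof (cases "t = 0")
      case True
      \<comment> \<open>The error estimate is a limit in a punctured neighbourhood, so
        \<open>s = 0\<close> is settled separately: there the constant vector is an exact
        eigenvector.\<close>
      have "E 0 k = 0" using Q_rows[of k]
        by (simp add: E_def v0 mapp_def twist_def flip: of_real_sum)
      then show ?thesis using True by (simp add: s_def)
    next
      case False
      have "\<forall>\<^sub>F N in sequentially. s N \<noteq> 0"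
        using eventually_gt_at_top[of 0] by eventually_elim (simp add: s_def False)
      then have "filterlim s (at 0) sequentially" using s0 by (simp add: filterlim_at)
      then have "(\<lambda>N. E (s N) k / of_real ((s N)\<^sup>2)) \<longlonglongrightarrow> 0"
        using err[of k, folded E_def] filterlim_compose by fast
      then have "(\<lambda>N. t\<^sup>2 * norm (E (s N) k / of_real ((s N)\<^sup>2))) \<longlonglongrightarrow> t\<^sup>2 * norm (0::complex)"
        by (intro tendsto_intros)
      moreover have "\<forall>\<^sub>F N in sequentially. t\<^sup>2 * norm (E (s N) k / of_real ((s N)\<^sup>2)) = real N * norm (E (s N) k)"
        using eventually_gt_at_top[of 0]
        by eventually_elim (simp add: False norm_divide norm_mult norm_power s_def power_divide field_simps)
      ultimately show ?thesis using tendsto_cong by force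
    qed
    define e where "e N = (\<Sum>k\<in>UNIV. norm (E (s N) k))" for N
    \<comment> \<open>The absolute value covers either sign of \<open>\<kappa>\<close>; the powers
      up to \<open>N\<close> stay bounded because \<open>N * (s N)\<^sup>2\<close> equals
      \<open>t\<^sup>2\<close>.\<close>
    define K where "K = exp (\<bar>\<kappa>\<bar> * t\<^sup>2)"
    have pow: "norm (complex_of_real (exp (- \<kappa> * (s N)\<^sup>2))) ^ i \<le> K" if "i < N" for i N
    proof -
      have "norm (complex_of_real (exp (- \<kappa> * (s N)\<^sup>2))) ^ i = exp (real i * (- \<kappa> * (s N)\<^sup>2))"
        by (simp only: norm_of_real abs_exp_cancel exp_of_nat_mult)
      also have "\<dots> \<le> exp (real N * (\<bar>\<kappa>\<bar> * (s N)\<^sup>2))"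
      proof (subst exp_le_cancel_iff)
        have "real i * (- \<kappa> * (s N)\<^sup>2) \<le> real i * (\<bar>\<kappa>\<bar> * (s N)\<^sup>2)"
          by (intro mult_left_mono mult_right_mono) auto
        also have "\<dots> \<le> real N * (\<bar>\<kappa>\<bar> * (s N)\<^sup>2)" using that by (intro mult_right_mono) auto
        finally show "real i * (- \<kappa> * (s N)\<^sup>2) \<le> real N * (\<bar>\<kappa>\<bar> * (s N)\<^sup>2)" .
      qed
      also have "\<dots> = K" using that by (simp add: K_def s_def power_divide)
      finally show ?thesis .
    qed
    have powN: "complex_of_real (exp (- \<kappa> * (s N)\<^sup>2)) ^ N = of_real (exp (- \<kappa> * t\<^sup>2))" if "N > 0" for N
    proof -
      have "exp (- \<kappa> * (s N)\<^sup>2) ^ N = exp (real N * (- \<kappa> * (s N)\<^sup>2))" by (rule exp_of_nat_mult[symmetric])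
      also have "real N * (- \<kappa> * (s N)\<^sup>2) = - \<kappa> * t\<^sup>2" using that by (simp add: s_def power_divide)
      finally show ?thesis by (simp only: of_real_power[symmetric])
    qed
    have bound: "norm ((M N ^^ N) (v (s N)) k - complex_of_real (exp (- \<kappa> * (s N)\<^sup>2)) ^ N * v (s N) k)
        \<le> real N * (K * e N)" for N k
      unfolding M_def
    proof (rule approx_eigen_funpow[OF twist_rows])
      show "norm (mapp (twist f (s N)) (v (s N)) j - complex_of_real (exp (- \<kappa> * (s N)\<^sup>2)) * v (s N) j) \<le> e N" for j
        unfolding E_def[symmetric] e_def by (rule member_le_sum) auto
      show "norm (complex_of_real (exp (- \<kappa> * (s N)\<^sup>2))) ^ i \<le> K" if "i < N" for i by (rule pow[OF that])
    qed (auto simp: e_def K_def intro!: sum_nonneg)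
    have Ke: "(\<lambda>N. real N * (K * e N)) \<longlonglongrightarrow> 0"
    proof -
      have "(\<lambda>N. K * (\<Sum>k\<in>UNIV. real N * norm (E (s N) k))) \<longlonglongrightarrow> K * (\<Sum>k\<in>(UNIV::'s set). 0)"
        by (intro tendsto_intros E_lim)
      then show ?thesis by (simp add: e_def sum_distrib_left mult.left_commute)
    qed
    have v_lim: "(\<lambda>N. v (s N) k) \<longlonglongrightarrow> 1" for k
      using isCont_tendsto_compose[OF vcont[of k] s0] by (simp add: v0)
    have Mv: "(\<lambda>N. (M N ^^ N) (v (s N)) k) \<longlonglongrightarrow> of_real (exp (- \<kappa> * t\<^sup>2))" for k
    proof -
      have "(\<lambda>N. (M N ^^ N) (v (s N)) k - complex_of_real (exp (- \<kappa> * (s N)\<^sup>2)) ^ N * v (s N) k) \<longlonglongrightarrow> 0"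
        by (rule Lim_null_comparison[OF _ Ke]) (auto intro!: always_eventually bound[simplified])
      moreover have "(\<lambda>N. complex_of_real (exp (- \<kappa> * t\<^sup>2)) * v (s N) k) \<longlonglongrightarrow> of_real (exp (- \<kappa> * t\<^sup>2)) * 1"
        by (intro tendsto_intros v_lim)
      then have "(\<lambda>N. complex_of_real (exp (- \<kappa> * (s N)\<^sup>2)) ^ N * v (s N) k) \<longlonglongrightarrow> of_real (exp (- \<kappa> * t\<^sup>2)) * 1"
        by (rule Lim_transform_eventually)
          (use eventually_gt_at_top[of 0] in \<open>eventually_elim, simp only: powN\<close>)
      ultimately show ?thesis using tendsto_add by fastforce
    qed
    have M1: "(\<lambda>N. (M N ^^ N) (\<lambda>_. 1) k) \<longlonglongrightarrow> of_real (exp (- \<kappa> * t\<^sup>2))" for k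
    proof -
      have "(\<lambda>N. (M N ^^ N) (\<lambda>k. v (s N) k - 1) k) \<longlonglongrightarrow> 0"
      proof (rule Lim_null_comparison)
        show "\<forall>\<^sub>F N in sequentially. norm ((M N ^^ N) (\<lambda>k. v (s N) k - 1) k) \<le> (\<Sum>k\<in>UNIV. norm (v (s N) k - 1))"
          unfolding M_def by (intro always_eventually allI twist_funpow_norm_le_sum)
        have "(\<lambda>N. \<Sum>k\<in>UNIV. norm (v (s N) k - 1)) \<longlonglongrightarrow> (\<Sum>k\<in>(UNIV::'s set). norm (1 - 1 :: complex))"
          by (intro tendsto_intros v_lim)
        then show "(\<lambda>N. \<Sum>k\<in>UNIV. norm (v (s N) k - 1)) \<longlonglongrightarrow> 0" by simp
      qed
      then show ?thesis using tendsto_diff[OF Mv[of k]] unfolding M_def mapp_funpow_diff by fastforce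
    qed
    define g' where "g' = (\<lambda>k. complex_of_real (g k))"
    \<comment> \<open>A fixed number \<open>m\<close> of applications of \<open>Q\<close> brings
      \<open>g\<close> close to \<open>avg g\<close>. For large \<open>N\<close> the same holds for
      \<open>m\<close> twisted steps, whose parameter tends to 0, and the other \<open>N - m\<close>
      steps do not increase the supremum norm.\<close>
    have diff0: "(\<lambda>N. (M N ^^ N) g' j - of_real (avg g) * (M N ^^ N) (\<lambda>_. 1) j) \<longlonglongrightarrow> 0"
      unfolding tendsto_iff dist_norm
    proof (intro allI impI)
      fix \<epsilon> :: real assume "\<epsilon> > 0"
      have "(\<lambda>m. \<Sum>k\<in>UNIV. norm ((mapp Q ^^ m) g k - avg g)) \<longlonglongrightarrow> (\<Sum>k\<in>(UNIV::'s set). norm (avg g - avg g))"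
        by (intro tendsto_intros mapp_funpow_tendsto_avg)
      then have "\<forall>\<^sub>F m in sequentially. (\<Sum>k\<in>UNIV. norm ((mapp Q ^^ m) g k - avg g)) < \<epsilon>"
        using \<open>\<epsilon> > 0\<close> by (intro order_tendstoD(2)[of _ 0]) auto
      then obtain m where m: "(\<Sum>k\<in>UNIV. norm ((mapp Q ^^ m) g k - avg g)) < \<epsilon>"
        by (auto simp: eventually_sequentially)
      have lim: "(\<lambda>N. (M N ^^ m) (\<lambda>k. complex_of_real (q k)) k) \<longlonglongrightarrow> of_real ((mapp Q ^^ m) q k)" for q k
        unfolding M_def twist_0_funpow[where f = f, symmetric]
        by (rule isCont_tendsto_compose[OF isCont_twist_funpow s0])
      have lim1: "(\<lambda>N. (M N ^^ m) (\<lambda>_. 1) k) \<longlonglongrightarrow> 1" for k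
        using lim[of "\<lambda>_. 1"] by (simp add: mapp_funpow_const)
      have "(\<lambda>N. (\<Sum>k\<in>UNIV. norm ((M N ^^ m) g' k - of_real (avg g)))
          + \<bar>avg g\<bar> * (\<Sum>k\<in>UNIV. norm ((M N ^^ m) (\<lambda>_. 1) k - 1)))
        \<longlonglongrightarrow> (\<Sum>k\<in>UNIV. norm (complex_of_real ((mapp Q ^^ m) g k) - of_real (avg g)))
          + \<bar>avg g\<bar> * (\<Sum>k\<in>(UNIV::'s set). norm (1 - 1 :: complex))"
        unfolding g'_def by (intro tendsto_intros lim lim1)
      then have "\<forall>\<^sub>F N in sequentially. (\<Sum>k\<in>UNIV. norm ((M N ^^ m) g' k - of_real (avg g)))
          + \<bar>avg g\<bar> * (\<Sum>k\<in>UNIV. norm ((M N ^^ m) (\<lambda>_. 1) k - 1)) < \<epsilon>"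
        using m by (intro order_tendstoD(2)) (simp_all flip: of_real_diff)
      then show "\<forall>\<^sub>F N in sequentially. norm ((M N ^^ N) g' j - of_real (avg g) * (M N ^^ N) (\<lambda>_. 1) j - 0) < \<epsilon>"
        using eventually_ge_at_top[of m]
      proof eventually_elim
        case (elim N)
        define n where "n = N - m"
        have Nn: "M N ^^ N = (M N ^^ n) \<circ> (M N ^^ m)" using elim by (simp add: n_def funpow_add[symmetric])
        have eq: "(M N ^^ N) g' j - of_real (avg g) * (M N ^^ N) (\<lambda>_. 1) j
           = (M N ^^ n) (\<lambda>k. (M N ^^ m) g' k - of_real (avg g) * 1) j
             - of_real (avg g) * (M N ^^ n) (\<lambda>k. (M N ^^ m) (\<lambda>_. 1) k - 1) j"
          unfolding Nn comp_apply unfolding M_def mapp_funpow_diff mapp_funpow_cmult by (simp add: algebra_simps)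
        have "norm ((M N ^^ n) (\<lambda>k. (M N ^^ m) g' k - of_real (avg g) * 1) j
             - of_real (avg g) * (M N ^^ n) (\<lambda>k. (M N ^^ m) (\<lambda>_. 1) k - 1) j)
          \<le> (\<Sum>k\<in>UNIV. norm ((M N ^^ m) g' k - of_real (avg g) * 1))
            + norm (complex_of_real (avg g)) * (\<Sum>k\<in>UNIV. norm ((M N ^^ m) (\<lambda>_. 1) k - 1))"
          unfolding M_def
        proof (rule order_trans[OF norm_triangle_ineq4 add_mono])
          show "norm ((mapp (twist f (s N)) ^^ n) (\<lambda>k. (mapp (twist f (s N)) ^^ m) g' k - of_real (avg g) * 1) j)
            \<le> (\<Sum>k\<in>UNIV. norm ((mapp (twist f (s N)) ^^ m) g' k - of_real (avg g) * 1))"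
            by (rule twist_funpow_norm_le_sum)
          show "norm (complex_of_real (avg g) * (mapp (twist f (s N)) ^^ n) (\<lambda>k. (mapp (twist f (s N)) ^^ m) (\<lambda>_. 1) k - 1) j)
            \<le> norm (complex_of_real (avg g)) * (\<Sum>k\<in>UNIV. norm ((mapp (twist f (s N)) ^^ m) (\<lambda>_. 1) k - 1))"
            unfolding norm_mult by (rule mult_left_mono[OF twist_funpow_norm_le_sum norm_ge_zero])
        qed
        then show ?case using elim(1) unfolding eq mult_1_right norm_of_real diff_0_right by (rule le_less_trans)
      qed
    qed
    have "(\<lambda>N. (M N ^^ N) g' j - of_real (avg g) * (M N ^^ N) (\<lambda>_. 1) j + of_real (avg g) * (M N ^^ N) (\<lambda>_. 1) j)
       \<longlonglongrightarrow> 0 + of_real (avg g) * of_real (exp (- \<kappa> * t\<^sup>2))"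
      by (intro tendsto_add diff0 tendsto_mult tendsto_const M1)
    then show ?thesis by (simp add: M_def s_def g'_def)
  qed
  then show thesis by (rule that)
qed

end

section \<open>Contraction and Gaussian domination from phase interference\<close>

lemma norm_sum_iexp_le:
  fixes a \<beta> :: "'s::finite \<Rightarrow> real"
  assumes q: "0 \<le> q" "\<And>k. q \<le> a k" and A: "(\<Sum>k\<in>UNIV. a k) \<le> 1"
  shows "norm (\<Sum>k\<in>UNIV. complex_of_real (a k) * iexp (\<beta> k))
    \<le> (\<Sum>k\<in>UNIV. a k) - q\<^sup>2 / 2 * (\<Sum>k\<in>UNIV. \<Sum>k'\<in>UNIV. 1 - cos (\<beta> k - \<beta> k'))"
proof -
  define S where "S = (\<Sum>k\<in>UNIV. a k)"
  define x where "x = q\<^sup>2 * (\<Sum>k\<in>UNIV. \<Sum>k'\<in>UNIV. 1 - cos (\<beta> k - \<beta> k'))"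
  define z where "z = (\<Sum>k\<in>UNIV. complex_of_real (a k) * iexp (\<beta> k))"
  have a0: "0 \<le> a k" for k using q order_trans by blast
  have S: "0 \<le> S" "S \<le> 1" using A a0 by (auto simp: S_def intro: sum_nonneg)
  have x0: "0 \<le> x" unfolding x_def by (intro mult_nonneg_nonneg sum_nonneg) auto
  have Re: "Re z = (\<Sum>k\<in>UNIV. a k * cos (\<beta> k))" and Im: "Im z = (\<Sum>k\<in>UNIV. a k * sin (\<beta> k))"
    by (simp_all add: z_def Re_exp Im_exp)
  \<comment> \<open>The squared modulus is the square of the total weight minus the weighted sum of
    \<open>1 - cos\<close> over all pairs of phases.\<close>
  have "(norm z)\<^sup>2 = (\<Sum>k\<in>UNIV. \<Sum>k'\<in>UNIV. a k * a k' * cos (\<beta> k - \<beta> k'))"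
    unfolding cmod_power2 Re Im power2_eq_square[of "sum _ _"] sum_product
    by (simp add: sum.distrib[symmetric] cos_diff algebra_simps)
  also have "\<dots> = S\<^sup>2 - (\<Sum>k\<in>UNIV. \<Sum>k'\<in>UNIV. a k * a k' * (1 - cos (\<beta> k - \<beta> k')))"
    unfolding S_def power2_eq_square sum_product by (simp add: right_diff_distrib sum_subtractf)
  also have "\<dots> \<le> S\<^sup>2 - x"
    unfolding x_def sum_distrib_left power2_eq_square[of q]
    by (intro diff_left_mono sum_mono mult_right_mono mult_mono) (auto simp: q a0)
  finally have le: "(norm z)\<^sup>2 \<le> S\<^sup>2 - x" .
  then have "x \<le> S\<^sup>2" using zero_le_power2[of "norm z"] by linarith
  also have "S\<^sup>2 \<le> S" using S mult_left_le[of S S] by (simp add: power2_eq_square)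
  finally have "0 \<le> S - x / 2" using x0 by simp
  \<comment> \<open>Since \<open>S \<le> 1\<close>, the square of \<open>S - x / 2\<close> dominates
    \<open>S\<^sup>2 - x\<close>, which removes the square root.\<close>
  moreover have "(norm z)\<^sup>2 \<le> (S - x / 2)\<^sup>2"
  proof -
    have "x * S \<le> x" "0 \<le> x * x" using S x0 by (simp_all add: mult_left_le)
    moreover have "(S - x / 2)\<^sup>2 = S\<^sup>2 - x * S + x * x / 4" by (simp add: power2_eq_square algebra_simps)
    ultimately have "S\<^sup>2 - x \<le> (S - x / 2)\<^sup>2" by linarith
    with le show ?thesis by simp
  qed
  ultimately have "norm z \<le> S - x / 2" by (rule power2_le_imp_le[rotated])
  then show ?thesis by (simp add: z_def S_def x_def)
qed

text \<open>Writing the quotient by \<open>t\<^sup>2\<close> with \<open>sinc\<close> makes it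
  continuous at \<open>t = 0\<close>, so that it can be minimised over a compact interval.\<close>

lemma one_minus_cos_eq_sinc: "1 - cos (t * b) = t\<^sup>2 * (b\<^sup>2 / 2 * (sinc (t * b / 2))\<^sup>2)"
proof -
  have "cos (t * b) = 1 - 2 * (sin (t * b / 2))\<^sup>2" using cos_double_sin[of "t * b / 2"] by simp
  then show ?thesis by (auto simp: power_divide power_mult_distrib)
qed

text \<open>The sum divided by \<open>t\<^sup>2\<close> extends continuously to \<open>t = 0\<close>
  and is positive everywhere, so its minimum over the interval serves as \<open>c\<close>.\<close>

lemma sum_one_minus_cos_ge:
  fixes b :: "'i \<Rightarrow> real"
  assumes fin: "finite I" and nz: "\<And>t. t \<noteq> 0 \<Longrightarrow> \<exists>i\<in>I. cos (t * b i) \<noteq> 1"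
  obtains c where "c > 0" "\<And>t. \<bar>t\<bar> \<le> T \<Longrightarrow> c * t\<^sup>2 \<le> (\<Sum>i\<in>I. 1 - cos (t * b i))"
proof (cases "T \<ge> 0")
  case True
  define W where "W t = (\<Sum>i\<in>I. (b i)\<^sup>2 / 2 * (sinc (t * b i / 2))\<^sup>2)" for t
  have W: "(\<Sum>i\<in>I. 1 - cos (t * b i)) = t\<^sup>2 * W t" for t
    unfolding W_def sum_distrib_left by (intro sum.cong refl one_minus_cos_eq_sinc)
  have Wpos: "W t > 0" for t
  proof (cases "t = 0")
    case True
    \<comment> \<open>The hypothesis at \<open>t = 1\<close> already provides a nonzero
      \<open>b i\<close>, which is what positivity at the origin requires.\<close>
    obtain i where "i \<in> I" "cos (1 * b i) \<noteq> 1" using nz[of 1] by auto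
    then have "i \<in> I" "b i \<noteq> 0" by auto
    then show ?thesis unfolding W_def True using fin by (intro sum_pos2[of _ i]) auto
  next
    case False
    obtain i where i: "i \<in> I" "cos (t * b i) \<noteq> 1" using nz[OF False] by auto
    then have "0 < 1 - cos (t * b i)" using cos_le_one[of "t * b i"] by linarith
    then have "0 < (\<Sum>i\<in>I. 1 - cos (t * b i))" using fin i by (intro sum_pos2[of _ i]) auto
    then show ?thesis unfolding W using False by (simp add: zero_less_mult_iff)
  qed
  have cont: "continuous_on {-T..T} W"
    unfolding W_def
    by (intro continuous_intros continuous_on_compose2[OF continuous_on_sinc[of UNIV]]) auto
  have "{-T..T} \<noteq> {}" using True by simp
  then obtain t0 where t0: "\<And>t. t \<in> {-T..T} \<Longrightarrow> W t0 \<le> W t"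
    using continuous_attains_inf[OF compact_Icc _ cont] by blast
  show thesis
  proof (rule that[of "W t0"])
    show "W t0 * t\<^sup>2 \<le> (\<Sum>i\<in>I. 1 - cos (t * b i))" if "\<bar>t\<bar> \<le> T" for t
      unfolding W using t0[of t] that by (auto simp: mult.commute[of _ "t\<^sup>2"] simp: abs_le_iff intro!: mult_left_mono)
  qed (rule Wpos)
qed (use that[of 1] in auto)

context pos_chain
begin

text \<open>Two-step paths from \<open>j\<close> to \<open>l\<close> through different midpoints
  interfere, and the loss of modulus is of order \<open>D t j l\<close>. Some rows \<open>j\<close>
  may lose nothing, so one more step is put in front: it reaches every \<open>j\<close> with
  probability at least \<open>q\<close>, and therefore every row of the cube collects a share of the
  total loss.\<close>

lemma twist_cube_contraction:
  assumes nonlat: "\<And>t. t \<noteq> 0 \<Longrightarrow> \<exists>j l k k'. cos (t * ((f j k + f k l) - (f j k' + f k' l))) \<noteq> 1"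
  obtains c where "c > 0" "\<And>t g B j. \<bar>t\<bar> \<le> T \<Longrightarrow> (\<And>k. norm (g k) \<le> B) \<Longrightarrow>
     norm ((mapp (twist f t) ^^ 3) g j) \<le> exp (- c * t\<^sup>2) * B"
proof -
  obtain q where q: "q > 0" "\<And>j k. q \<le> Q j k" using finite_pos_lower_bound2[of Q] Q_pos by blast
  define b where "b = (\<lambda>(j, l, k, k'). (f j k + f k l) - (f j k' + f k' l))"
  obtain c where c: "c > 0" "\<And>t. \<bar>t\<bar> \<le> T \<Longrightarrow> c * t\<^sup>2 \<le> (\<Sum>i\<in>UNIV. 1 - cos (t * b i))"
  proof (rule sum_one_minus_cos_ge[of UNIV b])
    fix t :: real assume "t \<noteq> 0"
    then obtain j l k k' where "cos (t * b (j, l, k, k')) \<noteq> 1" using nonlat unfolding b_def by fastforce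
    then show "\<exists>i\<in>UNIV. cos (t * b i) \<noteq> 1" by blast
  qed auto
  define D where "D t j l = (\<Sum>k\<in>UNIV. \<Sum>k'\<in>UNIV. 1 - cos (t * b (j, l, k, k')))" for t j l
  have D0: "0 \<le> D t j l" for t j l unfolding D_def by (intro sum_nonneg) auto
  have Dsum: "(\<Sum>i\<in>UNIV. 1 - cos (t * b i)) = (\<Sum>j\<in>UNIV. \<Sum>l\<in>UNIV. D t j l)" for t
    unfolding D_def UNIV_Times_UNIV[symmetric] by (simp add: sum.cartesian_product case_prod_beta del: UNIV_Times_UNIV)
  have Q2: "(\<Sum>l\<in>UNIV. \<Sum>k\<in>UNIV. Q j k * Q k l) = 1" for j
    by (subst sum.swap) (simp add: sum_distrib_left[symmetric] Q_rows)
  have two: "norm (\<Sum>k\<in>UNIV. twist f t j k * twist f t k l)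
      \<le> (\<Sum>k\<in>UNIV. Q j k * Q k l) - (q\<^sup>2)\<^sup>2 / 2 * D t j l" for t j l
  proof -
    have "(\<Sum>k\<in>UNIV. twist f t j k * twist f t k l)
       = (\<Sum>k\<in>UNIV. complex_of_real (Q j k * Q k l) * iexp (t * (f j k + f k l)))"
      by (simp add: twist_def distrib_left exp_add mult_ac)
    also have "norm \<dots> \<le> (\<Sum>k\<in>UNIV. Q j k * Q k l)
        - (q\<^sup>2)\<^sup>2 / 2 * (\<Sum>k\<in>UNIV. \<Sum>k'\<in>UNIV. 1 - cos (t * (f j k + f k l) - t * (f j k' + f k' l)))"
    proof (rule norm_sum_iexp_le)
      show "q\<^sup>2 \<le> Q j k * Q k l" for k unfolding power2_eq_square
        using q Q_pos[of j k] by (intro mult_mono) (auto simp: less_imp_le)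
      have "(\<Sum>k\<in>UNIV. Q j k * Q k l) \<le> (\<Sum>l\<in>UNIV. \<Sum>k\<in>UNIV. Q j k * Q k l)"
        by (rule member_le_sum) (auto intro!: sum_nonneg mult_nonneg_nonneg simp: Q_pos less_imp_le)
      then show "(\<Sum>k\<in>UNIV. Q j k * Q k l) \<le> 1" by (simp add: Q2)
    qed auto
    finally show ?thesis by (simp add: D_def b_def right_diff_distrib)
  qed
  define \<eta> where "\<eta> = (q\<^sup>2)\<^sup>2 / 2"
  have \<eta>: "\<eta> > 0" using q by (simp add: \<eta>_def)
  show thesis
  proof (rule that[of "q * \<eta> * c"])
    show "q * \<eta> * c > 0" using q \<eta> c by simp
    fix t :: real and g :: "'s \<Rightarrow> complex" and B x assume t: "\<bar>t\<bar> \<le> T" and g: "\<And>k. norm (g k) \<le> B"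
    have B: "0 \<le> B" using g norm_ge_zero order_trans by blast
    have sq: "norm (mapp (twist f t) (mapp (twist f t) g) j) \<le> (1 - \<eta> * (\<Sum>l\<in>UNIV. D t j l)) * B" for j
    proof -
      have "mapp (twist f t) (mapp (twist f t) g) j = mapp (\<lambda>j l. \<Sum>k\<in>UNIV. twist f t j k * twist f t k l) g j"
        unfolding mapp_def sum_distrib_left sum_distrib_right by (subst sum.swap) (simp add: mult.assoc)
      also have "norm \<dots> \<le> (1 - \<eta> * (\<Sum>l\<in>UNIV. D t j l)) * B"
      proof (rule mapp_norm_le[OF g _ B])
        have "(\<Sum>l\<in>UNIV. norm (\<Sum>k\<in>UNIV. twist f t j k * twist f t k l))
          \<le> (\<Sum>l\<in>UNIV. (\<Sum>k\<in>UNIV. Q j k * Q k l) - \<eta> * D t j l)"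
          unfolding \<eta>_def by (intro sum_mono two)
        then show "(\<Sum>l\<in>UNIV. norm (\<Sum>k\<in>UNIV. twist f t j k * twist f t k l)) \<le> 1 - \<eta> * (\<Sum>l\<in>UNIV. D t j l)"
          by (simp add: sum_subtractf Q2 sum_distrib_left)
      qed
      finally show ?thesis .
    qed
    have "norm ((mapp (twist f t) ^^ 3) g x) = norm (mapp (twist f t) (mapp (twist f t) (mapp (twist f t) g)) x)"
      by (simp add: eval_nat_numeral)
    also have "\<dots> \<le> (\<Sum>j\<in>UNIV. Q x j * ((1 - \<eta> * (\<Sum>l\<in>UNIV. D t j l)) * B))"
      unfolding mapp_def[of _ "mapp _ (mapp _ g)"]
      using Q_pos[of x] by (intro order_trans[OF norm_sum] sum_mono)
        (auto simp: norm_mult norm_twist intro!: mult_left_mono sq less_imp_le)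
    also have "\<dots> = (1 - \<eta> * (\<Sum>j\<in>UNIV. Q x j * (\<Sum>l\<in>UNIV. D t j l))) * B"
      unfolding mult.assoc[symmetric] sum_distrib_right[symmetric]
      by (simp add: right_diff_distrib sum_subtractf Q_rows mult.left_commute[of "Q _ _" \<eta>]
          flip: sum_distrib_left)
    also have "\<dots> \<le> (1 - \<eta> * (\<Sum>j\<in>UNIV. q * (\<Sum>l\<in>UNIV. D t j l))) * B"
      using \<eta> q B by (intro mult_right_mono diff_left_mono mult_left_mono sum_mono sum_nonneg D0) auto
    also have "\<dots> = (1 - q * \<eta> * (\<Sum>i\<in>UNIV. 1 - cos (t * b i))) * B"
      unfolding Dsum sum_distrib_left[symmetric] by (simp add: mult_ac)
    also have "\<dots> \<le> (1 - q * \<eta> * (c * t\<^sup>2)) * B"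
      using \<eta> q B t by (intro mult_right_mono diff_left_mono mult_left_mono c(2)) auto
    also have "\<dots> \<le> exp (- (q * \<eta> * c) * t\<^sup>2) * B"
      using exp_ge_add_one_self[of "- (q * \<eta> * c) * t\<^sup>2"] B by (intro mult_right_mono) (auto simp: mult.assoc)
    finally show "norm ((mapp (twist f t) ^^ 3) g x) \<le> exp (- (q * \<eta> * c) * t\<^sup>2) * B" .
  qed
qed

text \<open>Iterating the cube bound \<open>N div 3\<close> times at
  \<open>t = \<tau> / sqrt N\<close> yields a Gaussian in \<open>\<tau>\<close>; the remaining
  \<open>N mod 3\<close> steps do not increase the supremum norm.\<close>

lemma twist_funpow_dominated:
  assumes nonlat: "\<And>t. t \<noteq> 0 \<Longrightarrow> \<exists>j l k k'. cos (t * ((f j k + f k l) - (f j k' + f k' l))) \<noteq> 1"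
  obtains c where "c > 0" "\<And>N \<tau> g B j. 3 \<le> N \<Longrightarrow> \<bar>\<tau>\<bar> \<le> T * sqrt (real N) \<Longrightarrow> (\<And>k. norm (g k) \<le> B) \<Longrightarrow>
     norm ((mapp (twist f (\<tau> / sqrt (real N))) ^^ N) g j) \<le> exp (- c * \<tau>\<^sup>2) * B"
proof -
  obtain c where c: "c > 0" "\<And>t g B j. \<bar>t\<bar> \<le> T \<Longrightarrow> (\<And>k. norm (g k) \<le> B) \<Longrightarrow>
     norm ((mapp (twist f t) ^^ 3) g j) \<le> exp (- c * t\<^sup>2) * B"
    using twist_cube_contraction[OF nonlat, of T] by metis
  show thesis
  proof (rule that[of "c / 5"])
    fix N :: nat and \<tau> and g :: "'s \<Rightarrow> complex" and B j
    assume N: "3 \<le> N" and \<tau>: "\<bar>\<tau>\<bar> \<le> T * sqrt (real N)" and g: "\<And>k. norm (g k) \<le> B"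
    define t where "t = \<tau> / sqrt (real N)"
    have t: "\<bar>t\<bar> \<le> T" using \<tau> N by (simp add: t_def field_simps)
    have B: "0 \<le> B" using g norm_ge_zero order_trans by blast
    have iter: "norm (((mapp (twist f t) ^^ 3) ^^ n) g' j) \<le> exp (- c * t\<^sup>2) ^ n * B"
      if "\<And>k. norm (g' k) \<le> B" for n g' j
      using that
    proof (induction n arbitrary: j)
      case (Suc n)
      show ?case using c(2)[OF t Suc.IH[OF Suc.prems]] by (simp add: mult.assoc)
    qed simp
    have "N = 3 * (N div 3) + N mod 3" by simp
    then have "(mapp (twist f t) ^^ N) g = ((mapp (twist f t) ^^ 3) ^^ (N div 3)) ((mapp (twist f t) ^^ (N mod 3)) g)"
      by (metis funpow_add funpow_mult comp_apply)
    then have "norm ((mapp (twist f t) ^^ N) g j) \<le> exp (- c * t\<^sup>2) ^ (N div 3) * B"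
      by (simp only:) (intro iter twist_funpow_norm_le g)
    also have "exp (- c * t\<^sup>2) ^ (N div 3) = exp (real (N div 3) * (- c * t\<^sup>2))" by (rule exp_of_nat_mult[symmetric])
    also have "\<dots> \<le> exp (- (c / 5) * \<tau>\<^sup>2)"
    proof (subst exp_le_cancel_iff)
      \<comment> \<open>Origin of the constant \<open>c / 5\<close>: for \<open>N \<ge> 3\<close>
        the worst case is \<open>N = 5\<close>, where only one block of three steps fits.\<close>
      have "N \<le> 5 * (N div 3)" using N by presburger
      then have "real N / 5 \<le> real (N div 3)" by linarith
      then have "real N / 5 * (c * t\<^sup>2) \<le> real (N div 3) * (c * t\<^sup>2)" using c by (intro mult_right_mono) auto
      moreover have "real N * t\<^sup>2 = \<tau>\<^sup>2" using N by (simp add: t_def power_divide)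
      ultimately show "real (N div 3) * (- c * t\<^sup>2) \<le> - (c / 5) * \<tau>\<^sup>2" by (simp add: algebra_simps)
    qed
    finally show "norm ((mapp (twist f (\<tau> / sqrt (real N))) ^^ N) g j) \<le> exp (- (c / 5) * \<tau>\<^sup>2) * B"
      using B by (simp add: t_def mult_right_mono)
  qed (use c in auto)
qed

end

text \<open>If all these phases agreed, comparing the paths from a base state \<open>o'\<close> to
  \<open>l\<close> through \<open>k\<close> and through \<open>o'\<close> would express
  \<open>t * f k l\<close> modulo 2 pi as a constant plus a coboundary, with potential
  \<open>t * f o' k\<close> and constant \<open>t * f o' o'\<close>. That is the excluded
  representation with \<open>r = t\<close>.\<close>

lemma nonlattice_two_step:
  fixes f :: "'s \<Rightarrow> 's \<Rightarrow> real"
  assumes "\<not> (\<exists>c r (H :: 's \<Rightarrow> real). r \<noteq> 0 \<and>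
        (\<forall>j k. \<exists>m::int. r * f j k = c + H k - H j + 2 * pi * real_of_int m))" and t: "t \<noteq> 0"
  shows "\<exists>j l k k'. cos (t * ((f j k + f k l) - (f j k' + f k' l))) \<noteq> 1"
proof (rule ccontr)
  assume "\<not> ?thesis"
  then have cos1: "cos (t * ((f j k + f k l) - (f j k' + f k' l))) = 1" for j l k k' by blast
  define o' :: 's where "o' = undefined"
  have "\<exists>m::int. t * f k l = t * f o' o' + t * f o' l - t * f o' k + 2 * pi * real_of_int m" for k l
  proof -
    obtain m :: int where "t * ((f o' k + f k l) - (f o' o' + f o' l)) = real_of_int m * 2 * pi"
      using cos1[of o' k l o'] by (auto simp: cos_one_2pi_int)
    then show ?thesis by (intro exI[of _ m]) (simp add: algebra_simps)
  qed
  then have "\<exists>c r (H :: 's \<Rightarrow> real). r \<noteq> 0 \<and>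
      (\<forall>j k. \<exists>m::int. r * f j k = c + H k - H j + 2 * pi * real_of_int m)"
    using t by (intro exI[of _ "t * f o' o'"] exI[of _ t] exI[of _ "\<lambda>k. t * f o' k"]) blast
  then show False using assms(1) by blast
qed

section \<open>A positive band-limited kernel\<close>

text \<open>This is the square of sin(y/2)/(y/2), extended continuously by 1 at the origin; it is
  the Fourier integral of \<open>tent\<close> without a factor 2 pi.\<close>

definition fejer :: "real \<Rightarrow> real" where
  "fejer y = (if y = 0 then 1 else 2 * (1 - cos y) / y\<^sup>2)"

definition tent :: "real \<Rightarrow> real" where
  "tent t = max 0 (1 - \<bar>t\<bar>)"

text \<open>The Fejer kernel vanishes at the nonzero multiples of \<open>2 pi\<close>; the shifted copy makes the sum positive.\<close>

definition kern :: "real \<Rightarrow> real" where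
  "kern y = fejer y + fejer (y + pi)"

text \<open>The shift of the argument by \<open>pi\<close> in \<open>kern\<close> becomes the factor
  \<open>iexp (pi * t)\<close> on the frequency side.\<close>

definition kern_hat :: "real \<Rightarrow> complex" where
  "kern_hat t = of_real (tent t) * (1 + iexp (pi * t))"

lemma fejer_nonneg: "0 \<le> fejer y"
  by (simp add: fejer_def)

lemma one_minus_cos_le: "1 - cos y \<le> y\<^sup>2 / 2" for y :: real
proof -
  have "(sin (y / 2))\<^sup>2 \<le> (y / 2)\<^sup>2" using abs_sin_x_le_abs_x[of "y / 2"] by (rule abs_le_square_iff[THEN iffD1])
  then show ?thesis using cos_double_sin[of "y / 2"] by (simp add: power_divide)
qed

text \<open>The constant is 1 + 4: the numerator \<open>2 * (1 - cos y)\<close> is at most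
  \<open>y\<^sup>2\<close> and at most 4, and the two bounds are used for the two summands of
  \<open>1 + y\<^sup>2\<close>.\<close>

lemma fejer_le: "fejer y \<le> 5 * inverse (1 + y\<^sup>2)"
proof (cases "y = 0")
  case False
  have "(1 - cos y) * 2 \<le> y\<^sup>2" using one_minus_cos_le[of y] by simp
  moreover have "(1 - cos y) * 2 \<le> 4" using cos_ge_minus_one[of y] by argo
  then have "(1 - cos y) * 2 * y\<^sup>2 \<le> 4 * y\<^sup>2" by (rule mult_right_mono) simp
  moreover have "0 < 1 + y\<^sup>2" by (simp add: add_pos_nonneg)
  ultimately have "2 * (1 - cos y) * (1 + y\<^sup>2) \<le> 5 * y\<^sup>2" by (simp add: algebra_simps)
  then show ?thesis using False \<open>0 < 1 + y\<^sup>2\<close> by (simp add: fejer_def field_simps)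
qed (simp add: fejer_def)

lemma measurable_fejer [measurable]: "fejer \<in> borel_measurable borel"
  unfolding fejer_def[abs_def] by measurable

lemma measurable_kern [measurable]: "kern \<in> borel_measurable borel"
  unfolding kern_def[abs_def] by measurable

lemma integrable_fejer: "integrable lborel fejer"
proof (rule Bochner_Integration.integrable_bound)
  have "integrable lborel (\<lambda>x::real. inverse (1 + x\<^sup>2))"
    using integrable_inverse_1_plus_square by (simp add: set_integrable_def einterval_def)
  then show "integrable lborel (\<lambda>x::real. 5 * inverse (1 + x\<^sup>2))" by simp
  show "AE x in lborel. norm (fejer x) \<le> norm (5 * inverse (1 + x\<^sup>2))"
  proof (rule AE_I2)
    show "norm (fejer x) \<le> norm (5 * inverse (1 + x\<^sup>2))" for x
      using fejer_nonneg[of x] fejer_le[of x] by simp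
  qed
qed simp

lemma integrable_kern: "integrable lborel kern"
proof -
  have "integrable lborel (\<lambda>y. fejer (pi + 1 * y))"
    using lborel_integrable_real_affine[OF integrable_fejer, of 1 pi] by simp
  then show ?thesis unfolding kern_def[abs_def]
    by (intro Bochner_Integration.integrable_add integrable_fejer) (simp add: add.commute)
qed

lemma kern_pos: "0 < kern y"
proof -
  consider "y = 0" | "y = - pi" | "y \<noteq> 0" "y \<noteq> - pi" by blast
  then show ?thesis
  proof cases
    case 3
    have e: "kern y = 2 * (1 - cos y) / y\<^sup>2 + 2 * (1 + cos y) / (y + pi)\<^sup>2"
      using 3 by (auto simp: kern_def fejer_def)
    show ?thesis
    proof (cases "cos y = 1")
      case True
      then show ?thesis unfolding e using 3 by (simp add: add_eq_0_iff)
    next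
      case False
      then have "0 < 2 * (1 - cos y)" using cos_le_one[of y] by argo
      then have "0 < 2 * (1 - cos y) / y\<^sup>2" using 3 by (intro divide_pos_pos) auto
      moreover have "0 \<le> 2 * (1 + cos y) / (y + pi)\<^sup>2"
        using cos_ge_minus_one[of y] by (intro divide_nonneg_nonneg) (argo, simp)
      ultimately show ?thesis unfolding e by linarith
    qed
  qed (auto simp: kern_def fejer_def intro!: add_pos_nonneg)
qed

text \<open>For \<open>y > 0\<close> the denominator of the first copy may be enlarged to that of
  the second; then the oscillations cancel, since \<open>1 - cos y\<close> and
  \<open>1 + cos y\<close> add up to 2.\<close>

lemma kern_ge:
  assumes "0 \<le> y"
  shows "4 / (y + pi)\<^sup>2 \<le> kern y"
proof (cases "y = 0")
  case True
  then show ?thesis by (simp add: kern_def fejer_def)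
next
  case False
  with assms have y: "0 < y" by simp
  then have "y\<^sup>2 \<le> (y + pi)\<^sup>2" by (intro power_mono) auto
  then have "2 * (1 - cos y) / (y + pi)\<^sup>2 \<le> 2 * (1 - cos y) / y\<^sup>2"
    using y by (intro divide_left_mono mult_pos_pos zero_less_power) (auto intro: add_pos_pos)
  moreover have "y + pi \<noteq> 0" using y pi_gt_zero by linarith
  then have "kern y = 2 * (1 - cos y) / y\<^sup>2 + 2 * (1 + cos y) / (y + pi)\<^sup>2"
    using y by (simp add: kern_def fejer_def)
  moreover have "2 * (1 - cos y) / (y + pi)\<^sup>2 + 2 * (1 + cos y) / (y + pi)\<^sup>2 = 4 / (y + pi)\<^sup>2"
    by (simp add: add_divide_distrib[symmetric])
  ultimately show ?thesis by linarith
qed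

lemma continuous_on_tent: "continuous_on A tent"
  unfolding tent_def[abs_def] by (intro continuous_intros)

lemma continuous_on_kern_hat: "continuous_on A kern_hat"
  unfolding kern_hat_def[abs_def]
  by (intro continuous_intros continuous_on_tent)

lemma measurable_tent [measurable]: "tent \<in> borel_measurable borel"
  by (intro borel_measurable_continuous_onI continuous_on_tent)

lemma measurable_kern_hat [measurable]: "kern_hat \<in> borel_measurable borel"
  by (intro borel_measurable_continuous_onI continuous_on_kern_hat)

lemma kern_hat_0 [simp]: "kern_hat 0 = 2"
  by (simp add: kern_hat_def tent_def)

lemma kern_hat_eq_0: "1 < \<bar>t\<bar> \<Longrightarrow> kern_hat t = 0"
  by (simp add: kern_hat_def tent_def)

lemma norm_kern_hat_le: "norm (kern_hat t) \<le> 2"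
proof -
  have "norm (kern_hat t) \<le> 1 * (1 + 1)"
    unfolding kern_hat_def norm_mult
    by (intro mult_mono order_trans[OF norm_triangle_ineq]) (auto simp: tent_def)
  then show ?thesis by simp
qed

lemma tent_iexp_integral:
  "has_bochner_integral lborel (\<lambda>t. of_real (tent t) * iexp (t * y)) (complex_of_real (fejer y))"
proof -
  define f where "f = (\<lambda>t. of_real (1 - \<bar>t\<bar>) * iexp (t * y))"
  have cont: "continuous_on {-1..1} f" unfolding f_def by (intro continuous_intros)
  have int: "set_integrable lborel {-1..1} f" by (rule borel_integrable_atLeastAtMost'[OF cont])
  have HK: "(f has_integral complex_of_real (fejer y)) {-1..1}"
  proof (cases "y = 0")
    case True
    have "(f has_integral complex_of_real (0 + 0\<^sup>2/2) - of_real ((-1) + (-1)\<^sup>2/2)) {-1..0}"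
    proof (rule has_integral_eq)
      show "((\<lambda>t. complex_of_real (1 + t)) has_integral complex_of_real (0 + 0\<^sup>2/2) - of_real ((-1) + (-1)\<^sup>2/2)) {-1..0}"
      proof (rule fundamental_theorem_of_calculus[where f = "\<lambda>t. complex_of_real (t + t\<^sup>2 / 2)"])
        fix x :: real
        have "((\<lambda>t. t + t\<^sup>2 / 2) has_field_derivative (1 + complex_of_real x)) (at (of_real x))"
          by (auto intro!: derivative_eq_intros)
        then show "((\<lambda>t. complex_of_real (t + t\<^sup>2 / 2)) has_vector_derivative complex_of_real (1 + x)) (at x within {-1..0})"
          using has_vector_derivative_real_field by fastforce
      qed simp
    qed (auto simp: f_def True)
    moreover have "(f has_integral complex_of_real (1 - 1\<^sup>2/2) - of_real (0 - 0\<^sup>2/2)) {0..1}"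
    proof (rule has_integral_eq)
      show "((\<lambda>t. complex_of_real (1 - t)) has_integral complex_of_real (1 - 1\<^sup>2/2) - of_real (0 - 0\<^sup>2/2)) {0..1}"
      proof (rule fundamental_theorem_of_calculus[where f = "\<lambda>t. complex_of_real (t - t\<^sup>2 / 2)"])
        fix x :: real
        have "((\<lambda>t. t - t\<^sup>2 / 2) has_field_derivative (1 - complex_of_real x)) (at (of_real x))"
          by (auto intro!: derivative_eq_intros)
        then show "((\<lambda>t. complex_of_real (t - t\<^sup>2 / 2)) has_vector_derivative complex_of_real (1 - x)) (at x within {0..1})"
          using has_vector_derivative_real_field by fastforce
      qed simp
    qed (auto simp: f_def True)
    ultimately have "(f has_integral (complex_of_real (0 + 0\<^sup>2/2) - of_real ((-1) + (-1)\<^sup>2/2))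
        + (complex_of_real (1 - 1\<^sup>2/2) - of_real (0 - 0\<^sup>2/2))) {-1..1}"
      by (intro has_integral_combine[of "-1" 0 1]) auto
    then show ?thesis by (simp add: True fejer_def)
  next
    case False
    define z where "z = \<i> * complex_of_real y"
    have z: "z \<noteq> 0" using False by (simp add: z_def)
    have e: "exp (\<i> * (of_real t * of_real y)) = exp (z * of_real t)" for t :: real by (simp add: z_def mult_ac)
    \<comment> \<open>Antiderivatives of the two linear pieces of the tent times the exponential,
      obtained by integration by parts.\<close>
    define F1 where "F1 t = (1 + of_real t) * exp (z * of_real t) / z - exp (z * of_real t) / z\<^sup>2" for t :: real
    define F2 where "F2 t = (1 - of_real t) * exp (z * of_real t) / z + exp (z * of_real t) / z\<^sup>2" for t :: real
    have "(f has_integral F1 0 - F1 (-1)) {-1..0}"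
    proof (rule has_integral_eq)
      show "((\<lambda>t. (1 + of_real t) * exp (z * of_real t)) has_integral F1 0 - F1 (-1)) {-1..0}"
      proof (rule fundamental_theorem_of_calculus)
        fix x :: real
        have "((\<lambda>t. (1 + t) * exp (z * t) / z - exp (z * t) / z\<^sup>2) has_field_derivative
            (1 + of_real x) * exp (z * of_real x)) (at (of_real x))"
          using z by (auto intro!: derivative_eq_intros simp: field_simps power2_eq_square)
        then show "(F1 has_vector_derivative (1 + of_real x) * exp (z * of_real x)) (at x within {-1..0})"
          unfolding F1_def[abs_def] by (rule has_vector_derivative_real_field)
      qed simp
    qed (auto simp: f_def e)
    moreover have "(f has_integral F2 1 - F2 0) {0..1}"
    proof (rule has_integral_eq)
      show "((\<lambda>t. (1 - of_real t) * exp (z * of_real t)) has_integral F2 1 - F2 0) {0..1}"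
      proof (rule fundamental_theorem_of_calculus)
        fix x :: real
        have "((\<lambda>t. (1 - t) * exp (z * t) / z + exp (z * t) / z\<^sup>2) has_field_derivative
            (1 - of_real x) * exp (z * of_real x)) (at (of_real x))"
          using z by (auto intro!: derivative_eq_intros simp: field_simps power2_eq_square)
        then show "(F2 has_vector_derivative (1 - of_real x) * exp (z * of_real x)) (at x within {0..1})"
          unfolding F2_def[abs_def] by (rule has_vector_derivative_real_field)
      qed simp
    qed (auto simp: f_def e)
    ultimately have "(f has_integral (F1 0 - F1 (-1)) + (F2 1 - F2 0)) {-1..1}"
      by (intro has_integral_combine[of "-1" 0 1]) auto
    also have "(F1 0 - F1 (-1)) + (F2 1 - F2 0) = (exp z + exp (- z) - 2) / z\<^sup>2"
      by (simp add: F1_def F2_def diff_divide_distrib add_divide_distrib)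
    also have "exp z + exp (- z) = 2 * complex_of_real (cos y)"
      using cos_exp_eq[of "complex_of_real y"] by (simp add: z_def cos_of_real mult.commute)
    also have "(2 * complex_of_real (cos y) - 2) / z\<^sup>2 = of_real (fejer y)"
      using False by (simp add: z_def fejer_def power_mult_distrib field_simps)
    finally show ?thesis .
  qed
  have ind: "(\<lambda>t. of_real (tent t) * iexp (t * y)) = (\<lambda>t. indicator {-1..1} t *\<^sub>R f t)"
    by (auto simp: f_def tent_def indicator_def fun_eq_iff)
  show ?thesis
    using set_borel_integral_eq_integral(2)[OF int] int integral_unique[OF HK]
    unfolding ind by (simp add: has_bochner_integral_iff set_integrable_def set_lebesgue_integral_def)
qed

lemma kern_hat_integral:
  "has_bochner_integral lborel (\<lambda>t. kern_hat t * iexp (t * y)) (complex_of_real (kern y))"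
proof -
  have "has_bochner_integral lborel (\<lambda>t. of_real (tent t) * iexp (t * y) + of_real (tent t) * iexp (t * (y + pi)))
      (complex_of_real (fejer y) + complex_of_real (fejer (y + pi)))"
    by (intro has_bochner_integral_add tent_iexp_integral)
  moreover have "of_real (tent t) * iexp (t * y) + of_real (tent t) * iexp (t * (y + pi))
     = kern_hat t * iexp (t * y)" for t
    by (simp add: kern_hat_def algebra_simps exp_add)
  ultimately show ?thesis by (simp add: kern_def)
qed

lemma integrable_kern_hat: "integrable lborel kern_hat"
  using kern_hat_integral[of 0] by (simp add: has_bochner_integral_iff)

lemma integrable_gauss: "c > 0 \<Longrightarrow> integrable lborel (\<lambda>x::real. exp (- c * x\<^sup>2))"
proof -
  assume c: "c > 0"
  define \<sigma> where "\<sigma> = 1 / sqrt (2 * c)"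
  have \<sigma>: "\<sigma> > 0" "\<sigma>\<^sup>2 = 1 / (2 * c)" using c by (simp_all add: \<sigma>_def power_divide)
  have "integrable lborel (\<lambda>x. sqrt (2 * pi * \<sigma>\<^sup>2) * normal_density 0 \<sigma> x)"
    using \<sigma> by (intro integrable_mult_right integrable_normal_density)
  moreover have "sqrt (2 * pi * \<sigma>\<^sup>2) * normal_density 0 \<sigma> x = exp (- c * x\<^sup>2)" for x
    using \<sigma> c by (simp add: normal_density_def field_simps)
  ultimately show ?thesis by simp
qed

section \<open>Local limit theorem\<close>

text \<open>The substitution \<open>t = \<tau> / sqrt n - s\<close> brings the mass of
  \<open>\<phi> n\<close> near the origin to a fixed scale and freezes \<open>kern_hat\<close> at
  \<open>- s\<close>. Beyond \<open>(1 + \<bar>s\<bar>) * sqrt n\<close> the integrand vanishes by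
  compact support, so the Gaussian bound on bounded frequency ranges gives a dominating
  function.\<close>

lemma fourier_scaling_limit:
  fixes \<phi> :: "nat \<Rightarrow> real \<Rightarrow> complex"
  assumes [measurable]: "\<And>n. \<phi> n \<in> borel_measurable borel" "\<psi> \<in> borel_measurable borel"
    and lim: "\<And>\<tau>. (\<lambda>n. \<phi> n (\<tau> / sqrt (real n))) \<longlonglongrightarrow> \<psi> \<tau>"
    and dom: "\<And>T. \<exists>c>0. \<exists>B. \<forall>\<^sub>F n in sequentially. \<forall>\<tau>. \<bar>\<tau>\<bar> \<le> T * sqrt (real n) \<longrightarrow>
        norm (\<phi> n (\<tau> / sqrt (real n))) \<le> B * exp (- c * \<tau>\<^sup>2)"
  shows "(\<lambda>n. of_real (sqrt (real n)) * (CLINT t|lborel. kern_hat t * \<phi> n (t + s)))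
    \<longlonglongrightarrow> kern_hat (- s) * (CLINT \<tau>|lborel. \<psi> \<tau>)"
proof -
  obtain c B where c: "c > 0" and ev: "\<forall>\<^sub>F n in sequentially. \<forall>\<tau>. \<bar>\<tau>\<bar> \<le> (1 + \<bar>s\<bar>) * sqrt (real n) \<longrightarrow>
        norm (\<phi> n (\<tau> / sqrt (real n))) \<le> B * exp (- c * \<tau>\<^sup>2)"
    using dom by blast
  obtain n0 where n0: "\<And>n \<tau>. n \<ge> n0 \<Longrightarrow> \<bar>\<tau>\<bar> \<le> (1 + \<bar>s\<bar>) * sqrt (real n) \<Longrightarrow>
        norm (\<phi> n (\<tau> / sqrt (real n))) \<le> B * exp (- c * \<tau>\<^sup>2)"
    using ev by (auto simp: eventually_sequentially)
  define G where "G n \<tau> = kern_hat (- s + \<tau> / sqrt (real n)) * \<phi> n (\<tau> / sqrt (real n))" for n \<tau>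
  have scale: "of_real (sqrt (real n)) * (CLINT t|lborel. kern_hat t * \<phi> n (t + s)) = (CLINT \<tau>|lborel. G n \<tau>)"
    if "n > 0" for n
  proof -
    have "(CLINT t|lborel. kern_hat t * \<phi> n (t + s)) = \<bar>1 / sqrt (real n)\<bar> *\<^sub>R (CLINT \<tau>|lborel. G n \<tau>)"
      using that by (subst lborel_integral_real_affine[of "1 / sqrt (real n)" _ "- s"]) (auto simp: G_def[abs_def])
    then show ?thesis using that by (simp add: scaleR_conv_of_real)
  qed
  have s0: "(\<lambda>n. \<tau> / sqrt (real n)) \<longlonglongrightarrow> 0" for \<tau>
    by (intro tendsto_divide_0[OF tendsto_const] filterlim_at_top_imp_at_infinity
        filterlim_real_sequentially filterlim_compose[OF sqrt_at_top])
  \<comment> \<open>The index is shifted so that the domination and positivity of the index hold for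
    every term.\<close>
  have "(\<lambda>n. CLINT \<tau>|lborel. G (n + max 1 n0) \<tau>) \<longlonglongrightarrow> (CLINT \<tau>|lborel. kern_hat (- s) * \<psi> \<tau>)"
  proof (rule integral_dominated_convergence[where w = "\<lambda>\<tau>. 2 * \<bar>B\<bar> * exp (- c * \<tau>\<^sup>2)"])
    show "integrable lborel (\<lambda>\<tau>. 2 * \<bar>B\<bar> * exp (- c * \<tau>\<^sup>2))"
      by (intro integrable_mult_right integrable_gauss c)
    show "AE \<tau> in lborel. (\<lambda>n. G (n + max 1 n0) \<tau>) \<longlonglongrightarrow> kern_hat (- s) * \<psi> \<tau>"
    proof (rule AE_I2)
      fix \<tau>
      have "(\<lambda>n. - s + \<tau> / sqrt (real n)) \<longlonglongrightarrow> - s + 0" by (intro tendsto_intros s0)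
      moreover have "isCont kern_hat (- s)"
        using continuous_on_kern_hat[of UNIV] by (simp add: continuous_on_eq_continuous_at)
      ultimately have "(\<lambda>n. kern_hat (- s + \<tau> / sqrt (real n))) \<longlonglongrightarrow> kern_hat (- s)"
        using isCont_tendsto_compose by force
      then have "(\<lambda>n. G n \<tau>) \<longlonglongrightarrow> kern_hat (- s) * \<psi> \<tau>"
        unfolding G_def by (intro tendsto_mult lim)
      then show "(\<lambda>n. G (n + max 1 n0) \<tau>) \<longlonglongrightarrow> kern_hat (- s) * \<psi> \<tau>" by (rule LIMSEQ_ignore_initial_segment)
    qed
    show "AE \<tau> in lborel. norm (G (n + max 1 n0) \<tau>) \<le> 2 * \<bar>B\<bar> * exp (- c * \<tau>\<^sup>2)" for n
    proof (rule AE_I2)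
      fix \<tau>
      define m where "m = n + max 1 n0"
      have m: "m \<ge> n0" "m > 0" by (auto simp: m_def)
      show "norm (G (n + max 1 n0) \<tau>) \<le> 2 * \<bar>B\<bar> * exp (- c * \<tau>\<^sup>2)"
        unfolding m_def[symmetric]
      proof (cases "\<bar>\<tau>\<bar> \<le> (1 + \<bar>s\<bar>) * sqrt (real m)")
        case True
        have "norm (\<phi> m (\<tau> / sqrt (real m))) \<le> \<bar>B\<bar> * exp (- c * \<tau>\<^sup>2)"
          by (rule order_trans[OF n0[OF m(1) True]]) (simp add: mult_right_mono)
        then have "norm (kern_hat (- s + \<tau> / sqrt (real m))) * norm (\<phi> m (\<tau> / sqrt (real m)))
          \<le> 2 * (\<bar>B\<bar> * exp (- c * \<tau>\<^sup>2))"
          by (intro mult_mono norm_kern_hat_le) auto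
        then show "norm (G m \<tau>) \<le> 2 * \<bar>B\<bar> * exp (- c * \<tau>\<^sup>2)" by (simp add: G_def norm_mult)
      next
        case False
        then have "1 + \<bar>s\<bar> < \<bar>\<tau> / sqrt (real m)\<bar>" using m by (simp add: field_simps)
        then have "1 < \<bar>- s + \<tau> / sqrt (real m)\<bar>" by linarith
        then show "norm (G m \<tau>) \<le> 2 * \<bar>B\<bar> * exp (- c * \<tau>\<^sup>2)" by (simp add: G_def kern_hat_eq_0)
      qed
    qed
  qed (auto simp: G_def[abs_def])
  then have "(\<lambda>n. CLINT \<tau>|lborel. G n \<tau>) \<longlonglongrightarrow> (CLINT \<tau>|lborel. kern_hat (- s) * \<psi> \<tau>)"
    by (rule LIMSEQ_offset)
  then have "(\<lambda>n. of_real (sqrt (real n)) * (CLINT t|lborel. kern_hat t * \<phi> n (t + s)))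
      \<longlonglongrightarrow> (CLINT \<tau>|lborel. kern_hat (- s) * \<psi> \<tau>)"
    by (rule Lim_transform_eventually)
       (use eventually_gt_at_top[of 0] in \<open>eventually_elim, simp add: scale\<close>)
  then show ?thesis by simp
qed

text \<open>The integrand is regularised by Gaussians of growing variance.\<close>

lemma kern_fourier: "(CLINT y|lborel. of_real (kern y) * iexp (s * y)) = 2 * of_real pi * kern_hat (- s)"
proof -
  \<comment> \<open>Characteristic function of a centred Gaussian of variance \<open>n\<close>: at
    \<open>\<tau> / sqrt n\<close> it does not depend on \<open>n > 0\<close>, so the scaling limit
    applies at once.\<close>
  define \<phi> where "\<phi> n t = char std_normal_distribution (t * sqrt (real n))" for n t
  have \<phi>: "\<phi> n t = complex_of_real (exp (- (t\<^sup>2 * real n) / 2))" for n t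
    by (simp add: \<phi>_def char_std_normal_distribution power_mult_distrib)
  define \<psi> where "\<psi> \<tau> = complex_of_real (exp (- \<tau>\<^sup>2 / 2))" for \<tau> :: real
  have \<phi>\<psi>: "\<phi> n (\<tau> / sqrt (real n)) = \<psi> \<tau>" if "n > 0" for n \<tau>
    using that by (simp add: \<phi> \<psi>_def power_divide)
  have "(\<lambda>n. of_real (sqrt (real n)) * (CLINT t|lborel. kern_hat t * \<phi> n (t + s)))
    \<longlonglongrightarrow> kern_hat (- s) * (CLINT \<tau>|lborel. \<psi> \<tau>)"
  proof (rule fourier_scaling_limit)
    show "\<phi> n \<in> borel_measurable borel" for n unfolding \<phi>[abs_def] by measurable
    show "\<psi> \<in> borel_measurable borel" unfolding \<psi>_def[abs_def] by measurable
    show "(\<lambda>n. \<phi> n (\<tau> / sqrt (real n))) \<longlonglongrightarrow> \<psi> \<tau>" for \<tau>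
      by (rule tendsto_eventually) (use eventually_gt_at_top[of 0] in \<open>eventually_elim, simp add: \<phi>\<psi>\<close>)
    have "\<forall>\<^sub>F n in sequentially. \<forall>\<tau>. \<bar>\<tau>\<bar> \<le> T * sqrt (real n) \<longrightarrow>
        norm (\<phi> n (\<tau> / sqrt (real n))) \<le> 1 * exp (- (1/2) * \<tau>\<^sup>2)" for T
      using eventually_gt_at_top[of 0] by eventually_elim (auto simp: \<phi>\<psi> \<psi>_def)
    then show "\<exists>c>0. \<exists>B. \<forall>\<^sub>F n in sequentially. \<forall>\<tau>. \<bar>\<tau>\<bar> \<le> T * sqrt (real n) \<longrightarrow>
        norm (\<phi> n (\<tau> / sqrt (real n))) \<le> B * exp (- c * \<tau>\<^sup>2)" for T
      by (intro exI[of _ "1/2"] conjI exI[of _ 1]) auto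
  qed
  moreover have "(CLINT \<tau>|lborel. \<psi> \<tau>) = of_real (sqrt (2 * pi))"
  proof -
    have "\<psi> \<tau> = complex_of_real (sqrt (2 * pi) * std_normal_density \<tau>)" for \<tau>
      by (simp add: \<psi>_def std_normal_density_def)
    then show ?thesis by (simp add: integral_std_normal_moment_even[of 0, simplified])
  qed
  ultimately have lim1: "(\<lambda>n. of_real (sqrt (real n)) * (CLINT t|lborel. kern_hat t * \<phi> n (t + s)))
    \<longlonglongrightarrow> kern_hat (- s) * of_real (sqrt (2 * pi))" by simp
  \<comment> \<open>Fubini converts the frequency integral into an integral of \<open>kern\<close>
    against a Gaussian profile of width \<open>sqrt n\<close>. The profile flattens to the constant
    \<open>1 / sqrt (2 * pi)\<close>, and comparing this limit with \<open>lim1\<close> gives the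
    inversion.\<close>
  have swap: "of_real (sqrt (real n)) * (CLINT t|lborel. kern_hat t * \<phi> n (t + s))
    = (CLINT y|lborel. of_real (std_normal_density (y / sqrt (real n)) * kern y) * iexp (s * y))" if n: "n > 0" for n
  proof -
    define r where "r = sqrt (real n)"
    have r: "r > 0" using n by (simp add: r_def)
    define f where "f t x = kern_hat t * (of_real (std_normal_density x) * iexp ((t + s) * r * x))" for t x
    have f_meas [measurable]: "case_prod f \<in> borel_measurable (lborel \<Otimes>\<^sub>M lborel)"
      unfolding f_def[abs_def] by measurable
    have norm_f: "norm (f t x) = norm (kern_hat t) * std_normal_density x" for t x
      by (simp add: f_def norm_mult)
    have int_f: "integrable (lborel \<Otimes>\<^sub>M lborel) (case_prod f)"
    proof (rule lborel_pair.Fubini_integrable)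
      have "integrable lborel (\<lambda>t. norm (kern_hat t) * (LINT x|lborel. std_normal_density x))"
        by (intro integrable_mult_left integrable_norm integrable_kern_hat)
      then show "integrable lborel (\<lambda>t. LINT x|lborel. norm (case_prod f (t, x)))"
        by (simp add: norm_f)
      show "AE t in lborel. integrable lborel (\<lambda>x. case_prod f (t, x))"
      proof (rule AE_I2)
        fix t
        show "integrable lborel (\<lambda>x. case_prod f (t, x))"
        proof (rule Bochner_Integration.integrable_bound)
          show "integrable lborel (\<lambda>x. norm (kern_hat t) * std_normal_density x)"
            using integrable_std_normal_moment[of 0] by simp
        qed (auto simp: norm_f)
      qed
    qed simp
    have char: "\<phi> n (t + s) = (CLINT x|lborel. of_real (std_normal_density x) * iexp ((t + s) * r * x))" for t
      unfolding \<phi>_def char_def r_def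
      by (subst integral_density) (auto simp: scaleR_conv_of_real)
    have "(CLINT t|lborel. kern_hat t * \<phi> n (t + s)) = (CLINT t|lborel. CLINT x|lborel. f t x)"
      by (simp add: char f_def)
    also have "\<dots> = (CLINT x|lborel. CLINT t|lborel. f t x)"
      by (rule lborel_pair.Fubini_integral[OF int_f, symmetric])
    also have "\<dots> = (CLINT x|lborel. of_real (std_normal_density x) * iexp (s * (r * x)) * of_real (kern (r * x)))"
    proof (intro Bochner_Integration.integral_cong refl)
      fix x
      have "f t x = of_real (std_normal_density x) * iexp (s * (r * x)) * (kern_hat t * iexp (t * (r * x)))" for t
        by (simp add: f_def algebra_simps exp_add)
      then show "(CLINT t|lborel. f t x) = of_real (std_normal_density x) * iexp (s * (r * x)) * of_real (kern (r * x))"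
        using kern_hat_integral[of "r * x"] by (simp add: has_bochner_integral_iff)
    qed
    finally have 1: "(CLINT t|lborel. kern_hat t * \<phi> n (t + s))
      = (CLINT x|lborel. of_real (std_normal_density x) * iexp (s * (r * x)) * of_real (kern (r * x)))" .
    have "(CLINT y|lborel. of_real (std_normal_density (y / r) * kern y) * iexp (s * y))
       = \<bar>r\<bar> *\<^sub>R (CLINT x|lborel. of_real (std_normal_density ((0 + r * x) / r) * kern (0 + r * x)) * iexp (s * (0 + r * x)))"
      using r by (intro lborel_integral_real_affine) simp
    also have "\<dots> = of_real r * (CLINT x|lborel. of_real (std_normal_density x) * iexp (s * (r * x)) * of_real (kern (r * x)))"
      using r by (simp add: scaleR_conv_of_real mult_ac)
    finally show ?thesis using 1 by (simp add: r_def)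
  qed
  have "(\<lambda>n. CLINT y|lborel. of_real (std_normal_density (y / sqrt (real n)) * kern y) * iexp (s * y))
    \<longlonglongrightarrow> (CLINT y|lborel. of_real (1 / sqrt (2 * pi) * kern y) * iexp (s * y))"
  proof (rule integral_dominated_convergence[where w = kern])
    show "integrable lborel kern" by (rule integrable_kern)
    show "AE y in lborel. (\<lambda>n. of_real (std_normal_density (y / sqrt (real n)) * kern y) * iexp (s * y))
      \<longlonglongrightarrow> of_real (1 / sqrt (2 * pi) * kern y) * iexp (s * y)"
    proof (rule AE_I2)
      fix y
      have "(\<lambda>n. y / sqrt (real n)) \<longlonglongrightarrow> 0"
        by (intro tendsto_divide_0[OF tendsto_const] filterlim_at_top_imp_at_infinity
            filterlim_real_sequentially filterlim_compose[OF sqrt_at_top])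
      then have "(\<lambda>n. of_real (1 / sqrt (2 * pi) * exp (- (y / sqrt (real n))\<^sup>2 / 2) * kern y) * iexp (s * y))
        \<longlonglongrightarrow> of_real (1 / sqrt (2 * pi) * exp (- 0\<^sup>2 / 2) * kern y) * iexp (s * y)"
        by (intro tendsto_intros) auto
      then show "(\<lambda>n. of_real (std_normal_density (y / sqrt (real n)) * kern y) * iexp (s * y))
        \<longlonglongrightarrow> of_real (1 / sqrt (2 * pi) * kern y) * iexp (s * y)"
        by (simp add: std_normal_density_def)
    qed
    show "AE y in lborel. norm (of_real (std_normal_density (y / sqrt (real n)) * kern y) * iexp (s * y)) \<le> kern y" for n
    proof (rule AE_I2)
      fix y
      have "std_normal_density x \<le> 1" for x
      proof -
        have "1 \<le> sqrt (2 * pi)" using pi_gt3 by simp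
        then have "1 / sqrt (2 * pi) * exp (- x\<^sup>2 / 2) \<le> 1 * 1" by (intro mult_mono) auto
        then show ?thesis by (simp add: std_normal_density_def)
      qed
      then show "norm (of_real (std_normal_density (y / sqrt (real n)) * kern y) * iexp (s * y)) \<le> kern y"
        using kern_pos[of y] by (simp add: norm_mult abs_mult mult_left_le_one_le)
    qed
  qed auto
  then have "(\<lambda>n. of_real (sqrt (real n)) * (CLINT t|lborel. kern_hat t * \<phi> n (t + s)))
    \<longlonglongrightarrow> (CLINT y|lborel. of_real (1 / sqrt (2 * pi) * kern y) * iexp (s * y))"
    by (rule Lim_transform_eventually)
       (use eventually_gt_at_top[of 0] in \<open>eventually_elim, simp add: swap\<close>)
  then have "(CLINT y|lborel. of_real (1 / sqrt (2 * pi) * kern y) * iexp (s * y)) = kern_hat (- s) * of_real (sqrt (2 * pi))"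
    using lim1 LIMSEQ_unique by blast
  moreover have "(CLINT y|lborel. of_real (1 / sqrt (2 * pi) * kern y) * iexp (s * y))
     = of_real (1 / sqrt (2 * pi)) * (CLINT y|lborel. of_real (kern y) * iexp (s * y))"
    by (simp flip: integral_mult_right_zero add: mult.assoc)
  ultimately have "(CLINT y|lborel. of_real (kern y) * iexp (s * y))
     = kern_hat (- s) * of_real (sqrt (2 * pi)) * of_real (sqrt (2 * pi))"
    by (simp add: field_simps)
  also have "\<dots> = kern_hat (- s) * of_real (sqrt (2 * pi) * sqrt (2 * pi))"
    by (simp only: of_real_mult mult.assoc)
  also have "sqrt (2 * pi) * sqrt (2 * pi) = 2 * pi" by simp
  finally show ?thesis by (simp add: mult_ac)
qed

text \<open>On the half line \<open>kern\<close> decays no faster than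
  \<open>4 / (y + pi)\<^sup>2\<close>, while the exponential times \<open>(y + pi)\<^sup>2\<close>
  is bounded.\<close>

lemma exp_over_kern_bounded:
  assumes "\<theta> > 0"
  obtains C where "C > 0" "\<And>y. 0 \<le> y \<Longrightarrow> exp (- \<theta> * y) \<le> C * kern y"
proof -
  have lim: "((\<lambda>y. exp (- \<theta> * y) * (y + pi)\<^sup>2) \<longlongrightarrow> 0) at_top"
  proof -
    have "filterlim (\<lambda>y. \<theta> * y) at_top at_top"
      by (rule filterlim_tendsto_pos_mult_at_top[OF tendsto_const assms filterlim_ident])
    then have p: "((\<lambda>y. (\<theta> * y) ^ k / exp (\<theta> * y)) \<longlongrightarrow> 0) at_top" for k
      using filterlim_compose[OF tendsto_power_div_exp_0] by blast
    \<comment> \<open>\<open>(y + pi)\<^sup>2\<close> is expanded in powers of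
      \<open>\<theta> * y\<close>, so that each term is a power over an exponential.\<close>
    have "((\<lambda>y. (\<theta> * y) ^ 2 / exp (\<theta> * y) / \<theta>\<^sup>2 + (\<theta> * y) ^ 1 / exp (\<theta> * y) * (2 * pi / \<theta>)
        + (\<theta> * y) ^ 0 / exp (\<theta> * y) * pi\<^sup>2) \<longlongrightarrow> 0 / \<theta>\<^sup>2 + 0 * (2 * pi / \<theta>) + 0 * pi\<^sup>2) at_top"
      using assms by (intro tendsto_intros p) auto
    moreover have "(\<theta> * y) ^ 2 / exp (\<theta> * y) / \<theta>\<^sup>2 + (\<theta> * y) ^ 1 / exp (\<theta> * y) * (2 * pi / \<theta>)
        + (\<theta> * y) ^ 0 / exp (\<theta> * y) * pi\<^sup>2 = exp (- \<theta> * y) * (y + pi)\<^sup>2" for y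
      using assms by (simp add: exp_minus field_simps power2_eq_square)
    ultimately show ?thesis by simp
  qed
  then have "\<forall>\<^sub>F y in at_top. exp (- \<theta> * y) * (y + pi)\<^sup>2 < 1" by (rule order_tendstoD) simp
  then obtain A where A: "\<And>y. y \<ge> A \<Longrightarrow> exp (- \<theta> * y) * (y + pi)\<^sup>2 < 1"
    by (auto simp: eventually_at_top_linorder)
  define C where "C = 1 + (\<bar>A\<bar> + pi)\<^sup>2"
  have C: "C > 0" by (simp add: C_def add_pos_nonneg)
  show thesis
  proof (rule that[of C])
    fix y :: real assume y: "0 \<le> y"
    have "exp (- \<theta> * y) * (y + pi)\<^sup>2 \<le> C"
    proof (cases "y \<ge> A")
      case True
      then show ?thesis using A[of y] by (simp add: C_def add_increasing2 less_imp_le)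
    next
      case False
      have "exp (- \<theta> * y) * (y + pi)\<^sup>2 \<le> 1 * (\<bar>A\<bar> + pi)\<^sup>2"
        using y False assms by (intro mult_mono power_mono) auto
      then show ?thesis by (simp add: C_def)
    qed
    moreover have "0 < (y + pi)\<^sup>2" using y pi_gt_zero by (intro zero_less_power add_nonneg_pos) auto
    ultimately have "exp (- \<theta> * y) \<le> C / (y + pi)\<^sup>2" by (simp add: field_simps)
    also have "\<dots> \<le> C * (4 / (y + pi)\<^sup>2)" using C by (simp add: divide_right_mono)
    also have "\<dots> \<le> C * kern y" using C y by (intro mult_left_mono kern_ge) auto
    finally show "exp (- \<theta> * y) \<le> C * kern y" .
  qed (rule C)
qed

text \<open>\<open>4 * pi\<close> is the total mass of \<open>kern\<close>: its Fourier transform at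
  0 is \<open>2 * pi * kern_hat 0\<close>.\<close>

definition kern_measure :: "real measure" where
  "kern_measure = density lborel (\<lambda>y. ennreal (kern y / (4 * pi)))"

lemma integral_kern: "(LINT y|lborel. kern y) = 4 * pi"
proof -
  have "complex_of_real (LINT y|lborel. kern y) = of_real (4 * pi)"
    using kern_fourier[of 0] by simp
  then show ?thesis by (simp only: of_real_eq_iff)
qed

lemma real_distribution_kern_measure: "real_distribution kern_measure"
proof -
  have "(\<integral>\<^sup>+y. ennreal (kern y / (4 * pi)) \<partial>lborel) = ennreal (LINT y|lborel. kern y / (4 * pi))"
    using kern_pos by (intro nn_integral_eq_integral) (auto simp: integrable_kern less_imp_le)
  also have "\<dots> = 1" by (simp add: integral_kern)
  finally have "prob_space kern_measure"
    by (intro prob_spaceI) (simp add: kern_measure_def emeasure_density)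
  then show ?thesis by (simp add: real_distribution_def real_distribution_axioms_def kern_measure_def)
qed

lemma char_kern_measure: "char kern_measure s = kern_hat (- s) / 2"
proof -
  have "char kern_measure s = (CLINT y|lborel. of_real (kern y) * iexp (s * y) / of_real (4 * pi))"
    unfolding char_def kern_measure_def using kern_pos
    by (subst integral_density) (auto simp: scaleR_conv_of_real less_imp_le)
  also have "\<dots> = (CLINT y|lborel. of_real (kern y) * iexp (s * y)) / of_real (4 * pi)" by simp
  finally show ?thesis unfolding kern_fourier by simp
qed

text \<open>The absence of atoms lets a test function with a jump at \<open>0\<close> be integrated
  along the weak convergence.\<close>

lemma emeasure_kern_measure_singleton: "emeasure kern_measure {x} = 0"
proof -
  have "{x} \<in> null_sets lborel" by (auto simp: null_sets_def)
  then have "{x} \<in> null_sets kern_measure" unfolding kern_measure_def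
    by (intro absolutely_continuousI_density[unfolded absolutely_continuous_def, THEN subsetD]) auto
  then show ?thesis by (auto simp: null_sets_def)
qed

text \<open>The measures \<open>\<Sum>i. w i * kern (Y i) * \<delta>(Y i)\<close> have characteristic functions depending only on the values of
  \<open>\<Sum>i. w i * iexp (t * Y i)\<close> on a compact interval, so after normalisation they converge weakly; the function
  \<open>y \<mapsto> exp (- \<theta> y)\<close> on the half line is then integrated against them after dividing by \<open>kern\<close>.\<close>

lemma local_limit_exponential:
  fixes I :: "nat \<Rightarrow> 'i set" and w Y :: "nat \<Rightarrow> 'i \<Rightarrow> real"
  assumes fin: "\<And>n. finite (I n)" and ne: "\<And>n. I n \<noteq> {}" and wpos: "\<And>n i. i \<in> I n \<Longrightarrow> w n i > 0"
    and \<theta>: "\<theta> > 0" and [measurable]: "\<psi> \<in> borel_measurable borel"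
    and lim: "\<And>\<tau>. (\<lambda>n. \<Sum>i\<in>I n. complex_of_real (w n i) * iexp (\<tau> / sqrt (real n) * Y n i)) \<longlonglongrightarrow> \<psi> \<tau>"
    and dom: "\<And>T. \<exists>c>0. \<exists>B. \<forall>\<^sub>F n in sequentially. \<forall>\<tau>. \<bar>\<tau>\<bar> \<le> T * sqrt (real n) \<longrightarrow>
        norm (\<Sum>i\<in>I n. complex_of_real (w n i) * iexp (\<tau> / sqrt (real n) * Y n i)) \<le> B * exp (- c * \<tau>\<^sup>2)"
  shows "\<exists>D. (\<lambda>n. sqrt (real n) * (\<Sum>i\<in>I n. w n i * (if Y n i \<ge> 0 then exp (- \<theta> * Y n i) else 0))) \<longlonglongrightarrow> D"
proof -
  define \<phi> where "\<phi> n t = (\<Sum>i\<in>I n. complex_of_real (w n i) * iexp (t * Y n i))" for n t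
  define L where "L = (CLINT \<tau>|lborel. \<psi> \<tau>)"
  define Z where "Z n = (\<Sum>i\<in>I n. w n i * kern (Y n i))" for n
  define F where "F y = (if y \<ge> 0 then exp (- \<theta> * y) else 0)" for y :: real
  have [measurable]: "F \<in> borel_measurable borel" unfolding F_def[abs_def] by measurable
  have Z: "Z n > 0" for n
    unfolding Z_def using fin ne wpos kern_pos by (intro sum_pos) auto
  \<comment> \<open>Representing \<open>kern (Y n i)\<close> by its transform shifts the frequency:
    the weighted sum at \<open>s\<close> only sees \<open>\<phi> n\<close> on the interval of radius
    1 around \<open>s\<close>.\<close>
  have transform: "(\<Sum>i\<in>I n. complex_of_real (w n i * kern (Y n i)) * iexp (s * Y n i))
      = (CLINT t|lborel. kern_hat t * \<phi> n (t + s))" for n s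
  proof -
    have "has_bochner_integral lborel (\<lambda>t. \<Sum>i\<in>I n. complex_of_real (w n i) * iexp (s * Y n i) * (kern_hat t * iexp (t * Y n i)))
       (\<Sum>i\<in>I n. complex_of_real (w n i) * iexp (s * Y n i) * of_real (kern (Y n i)))"
      by (intro has_bochner_integral_sum has_bochner_integral_mult_right kern_hat_integral)
    moreover have "(\<Sum>i\<in>I n. complex_of_real (w n i) * iexp (s * Y n i) * (kern_hat t * iexp (t * Y n i)))
        = kern_hat t * \<phi> n (t + s)" for t
      unfolding \<phi>_def sum_distrib_left
      by (intro sum.cong refl) (simp add: distrib_left distrib_right exp_add mult_ac)
    ultimately show ?thesis by (simp add: has_bochner_integral_iff mult_ac)
  qed
  have conv: "(\<lambda>n. of_real (sqrt (real n)) * (\<Sum>i\<in>I n. complex_of_real (w n i * kern (Y n i)) * iexp (s * Y n i)))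
     \<longlonglongrightarrow> kern_hat (- s) * L" for s
    unfolding transform L_def
  proof (rule fourier_scaling_limit)
    show "\<phi> n \<in> borel_measurable borel" for n
      unfolding \<phi>_def[abs_def] by measurable
  qed (use lim dom in \<open>auto simp: \<phi>_def\<close>)
  have Zconv: "(\<lambda>n. complex_of_real (sqrt (real n) * Z n)) \<longlonglongrightarrow> 2 * L"
    using conv[of 0] by (simp add: Z_def)
  define l where "l = Re (2 * L)"
  have Zl: "(\<lambda>n. sqrt (real n) * Z n) \<longlonglongrightarrow> l"
    using tendsto_Re[OF Zconv] by (simp add: l_def)
  have Ll: "2 * L = of_real l"
    using tendsto_of_real[OF Zl, where 'a = complex] Zconv LIMSEQ_unique by blast
  obtain C where C: "C > 0" "\<And>y. 0 \<le> y \<Longrightarrow> exp (- \<theta> * y) \<le> C * kern y"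
    using exp_over_kern_bounded[OF \<theta>] by metis
  have F0: "0 \<le> F y" for y by (simp add: F_def)
  have FC: "F y \<le> C * kern y" for y
    using C kern_pos[of y] by (auto simp: F_def less_imp_le)
  show ?thesis
  proof (cases "l = 0")
    case True
    \<comment> \<open>In this case dividing by the limiting mass is impossible, but \<open>F\<close>
      is at most a multiple of \<open>kern\<close>, so the sum is squeezed to zero.\<close>
    have "(\<lambda>n. sqrt (real n) * (\<Sum>i\<in>I n. w n i * F (Y n i))) \<longlonglongrightarrow> 0"
    proof (rule tendsto_sandwich)
      show "\<forall>\<^sub>F n in sequentially. 0 \<le> sqrt (real n) * (\<Sum>i\<in>I n. w n i * F (Y n i))"
        using wpos F0 by (intro always_eventually allI mult_nonneg_nonneg sum_nonneg) (auto simp: less_imp_le)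
      have "(\<Sum>i\<in>I n. w n i * F (Y n i)) \<le> C * Z n" for n
      proof -
        have "(\<Sum>i\<in>I n. w n i * F (Y n i)) \<le> (\<Sum>i\<in>I n. w n i * (C * kern (Y n i)))"
          using wpos by (intro sum_mono mult_left_mono FC) (auto simp: less_imp_le)
        then show ?thesis by (simp add: Z_def sum_distrib_left mult_ac)
      qed
      then have "sqrt (real n) * (\<Sum>i\<in>I n. w n i * F (Y n i)) \<le> sqrt (real n) * (C * Z n)" for n
        by (intro mult_left_mono) auto
      then show "\<forall>\<^sub>F n in sequentially. sqrt (real n) * (\<Sum>i\<in>I n. w n i * F (Y n i)) \<le> C * (sqrt (real n) * Z n)"
        by (intro always_eventually allI) (simp add: mult_ac)
      show "(\<lambda>n. C * (sqrt (real n) * Z n)) \<longlonglongrightarrow> 0"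
        using tendsto_mult_left[OF Zl, of C] True by simp
    qed simp
    then show ?thesis unfolding F_def by blast
  next
    case False
    \<comment> \<open>The kernel-weighted law of \<open>Y n\<close>, normalised to a probability; in
      the quotient of characteristic functions the factors \<open>sqrt n\<close> cancel.\<close>
    define M where "M n = distr (point_measure (I n) (\<lambda>i. ennreal (w n i * kern (Y n i) / Z n))) borel (Y n)" for n
    have wk: "0 \<le> w n i * kern (Y n i) / Z n" if "i \<in> I n" for n i
      using wpos[OF that] kern_pos[of "Y n i"] Z[of n] by simp
    have Ymeas: "Y n \<in> measurable (point_measure (I n) q) borel" for n q
      by (simp add: measurable_point_measure_eq1)
    have M_int: "integral\<^sup>L (M n) g = (\<Sum>i\<in>I n. (w n i * kern (Y n i) / Z n) *\<^sub>R g (Y n i))"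
      if "g \<in> borel_measurable borel" for n and g :: "real \<Rightarrow> 'b::{banach, second_countable_topology}"
      unfolding M_def using that Ymeas fin wk
      by (subst integral_distr) (auto intro!: lebesgue_integral_point_measure_finite)
    have M_dist: "real_distribution (M n)" for n
    proof -
      have "(\<Sum>i\<in>I n. w n i * kern (Y n i) / Z n) = 1"
        using Z[of n] by (simp add: sum_divide_distrib[symmetric] Z_def)
      then have "emeasure (point_measure (I n) (\<lambda>i. ennreal (w n i * kern (Y n i) / Z n))) (I n) = 1"
        using fin wk by (subst emeasure_point_measure_finite) auto
      then have "prob_space (point_measure (I n) (\<lambda>i. ennreal (w n i * kern (Y n i) / Z n)))"
        by (intro prob_spaceI) (simp add: space_point_measure)
      then have "prob_space (M n)" unfolding M_def by (rule prob_space.prob_space_distr) (rule Ymeas)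
      then show ?thesis by (simp add: real_distribution_def real_distribution_axioms_def M_def)
    qed
    have "weak_conv_m M kern_measure"
    proof (rule levy_continuity[OF M_dist real_distribution_kern_measure])
      fix s
      have ch: "char (M n) s = (\<Sum>i\<in>I n. complex_of_real (w n i * kern (Y n i)) * iexp (s * Y n i)) / of_real (Z n)" for n
        unfolding char_def by (subst M_int) (auto simp: scaleR_conv_of_real sum_divide_distrib)
      have "(\<lambda>n. (of_real (sqrt (real n)) * (\<Sum>i\<in>I n. complex_of_real (w n i * kern (Y n i)) * iexp (s * Y n i)))
          / complex_of_real (sqrt (real n) * Z n)) \<longlonglongrightarrow> kern_hat (- s) * L / (2 * L)"
        using False Ll by (intro tendsto_divide conv Zconv) auto
      then have "(\<lambda>n. char (M n) s) \<longlonglongrightarrow> kern_hat (- s) * L / (2 * L)"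
        by (rule Lim_transform_eventually)
           (use eventually_gt_at_top[of 0] in \<open>eventually_elim, simp add: ch\<close>)
      moreover have "L \<noteq> 0" using False Ll by auto
      ultimately show "(\<lambda>n. char (M n) s) \<longlonglongrightarrow> char kern_measure s" by (simp add: char_kern_measure)
    qed
    have bdd: "norm (F y / kern y) \<le> C" for y
      using FC[of y] F0[of y] kern_pos[of y] by (simp add: field_simps)
    \<comment> \<open>Away from the jump the quotient agrees locally either with an explicit
      continuous formula or with zero.\<close>
    have cont: "isCont (\<lambda>y. F y / kern y) y" if "y \<noteq> 0" for y
    proof (cases "y > 0")
      case True
      have ev: "\<forall>\<^sub>F x in nhds y. x > 0" using True order_tendstoD(1)[OF filterlim_ident] by blast
      have "isCont (\<lambda>y. exp (- \<theta> * y) / (2 * (1 - cos y) / y\<^sup>2 + 2 * (1 - cos (y + pi)) / (y + pi)\<^sup>2)) y"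
      proof -
        have "y + pi \<noteq> 0" using True pi_gt_zero by linarith
        moreover have "2 * (1 - cos y) / y\<^sup>2 + 2 * (1 - cos (y + pi)) / (y + pi)\<^sup>2 \<noteq> 0"
          using kern_pos[of y] True \<open>y + pi \<noteq> 0\<close> by (simp add: kern_def fejer_def)
        ultimately show ?thesis using True by (intro continuous_intros) auto
      qed
      moreover have "\<forall>\<^sub>F x in nhds y. F x / kern x
         = exp (- \<theta> * x) / (2 * (1 - cos x) / x\<^sup>2 + 2 * (1 - cos (x + pi)) / (x + pi)\<^sup>2)"
        using ev
      proof eventually_elim
        case (elim x)
        then have "x + pi \<noteq> 0" using pi_gt_zero by linarith
        with elim show ?case by (simp add: F_def kern_def fejer_def)
      qed
      ultimately show ?thesis by (simp add: isCont_cong)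
    next
      case False
      then have "y < 0" using that by simp
      then have "\<forall>\<^sub>F x in nhds y. x < 0" using order_tendstoD(2)[OF filterlim_ident] by blast
      then have "\<forall>\<^sub>F x in nhds y. F x / kern x = 0" by eventually_elim (simp add: F_def)
      then show ?thesis using isCont_cong[of "\<lambda>x. F x / kern x" "\<lambda>_. 0" y] continuous_const by fast
    qed
    have "(\<lambda>n. integral\<^sup>L (M n) (\<lambda>y. F y / kern y)) \<longlonglongrightarrow> integral\<^sup>L kern_measure (\<lambda>y. F y / kern y)"
    proof (rule weak_conv_imp_bdd_ae_continuous_conv[OF M_dist real_distribution_kern_measure \<open>weak_conv_m M kern_measure\<close> _ bdd])
      have "{y. \<not> isCont (\<lambda>y. F y / kern y) y} \<subseteq> {0}" using cont by auto
      then have "emeasure kern_measure {y. \<not> isCont (\<lambda>y. F y / kern y) y} \<le> emeasure kern_measure {0}"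
        by (intro emeasure_mono) (auto simp: kern_measure_def)
      then show "emeasure kern_measure {y. \<not> isCont (\<lambda>y. F y / kern y) y} = 0"
        by (simp add: emeasure_kern_measure_singleton)
    qed measurable
    then have "(\<lambda>n. sqrt (real n) * Z n * integral\<^sup>L (M n) (\<lambda>y. F y / kern y))
      \<longlonglongrightarrow> l * integral\<^sup>L kern_measure (\<lambda>y. F y / kern y)"
      by (intro tendsto_mult Zl)
    moreover have "sqrt (real n) * Z n * integral\<^sup>L (M n) (\<lambda>y. F y / kern y)
      = sqrt (real n) * (\<Sum>i\<in>I n. w n i * F (Y n i))" for n
    proof -
      have "integral\<^sup>L (M n) (\<lambda>y. F y / kern y) = (\<Sum>i\<in>I n. w n i * F (Y n i) / Z n)"
        using kern_pos by (subst M_int) (auto intro!: sum.cong simp: less_le)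
      then show ?thesis using Z[of n] by (simp add: sum_divide_distrib[symmetric])
    qed
    ultimately show ?thesis unfolding F_def by auto
  qed
qed

section \<open>Large deviations\<close>

lemma sum_Times: "(\<Sum>i\<in>A \<times> B. F i) = (\<Sum>x\<in>A. \<Sum>y\<in>B. F (x, y))"
  by (simp add: sum.cartesian_product)

text \<open>The index set consists of all starting states with all walks, weighted by path
  probability and end-point weights. Its exponential sums are powers of the twisted kernel, so the
  limit and the domination hypotheses hold by the two preceding theorems on those powers.\<close>

lemma (in pos_chain) walk_exponential_limit:
  assumes "drift f = 0" and nonlat: "\<And>t. t \<noteq> 0 \<Longrightarrow> \<exists>j l k k'. cos (t * ((f j k + f k l) - (f j k' + f k' l))) \<noteq> 1"
    and \<alpha>: "\<And>x. \<alpha> x > 0" and g: "\<And>x. g x > 0" and \<theta>: "\<theta> > 0"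
  shows "\<exists>D. (\<lambda>N. sqrt (real N) * (\<Sum>x\<in>UNIV. \<Sum>ys\<in>paths N. \<alpha> x * walk_prod Q x ys * g (walk_end x ys) *
     (if walk_sum f x ys \<ge> 0 then exp (- \<theta> * walk_sum f x ys) else 0))) \<longlonglongrightarrow> D"
proof -
  obtain \<kappa> where \<kappa>: "\<And>g t j. (\<lambda>N. (mapp (twist f (t / sqrt (real N))) ^^ N) (\<lambda>k. complex_of_real (g k)) j)
      \<longlonglongrightarrow> complex_of_real (avg g * exp (- \<kappa> * t\<^sup>2))"
    using twist_funpow_tendsto[OF assms(1)] by blast
  define I where "I N = (UNIV :: 's set) \<times> (paths N :: 's list set)" for N
  define w where "w = (\<lambda>(x, ys). \<alpha> x * walk_prod Q x ys * g (walk_end x ys))"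
  define Y where "Y = (\<lambda>(x, ys). walk_sum f x ys)"
  have char: "(\<Sum>i\<in>I N. complex_of_real (w i) * iexp (t * Y i))
     = (\<Sum>x\<in>UNIV. of_real (\<alpha> x) * (mapp (twist f t) ^^ N) (\<lambda>k. complex_of_real (g k)) x)" for N t
    unfolding I_def sum_walks_eq_funpow[symmetric] twist_def[abs_def] walk_prod_iexp
    by (simp add: sum_Times w_def Y_def sum_distrib_left mult_ac)
  obtain G where G: "\<And>k. g k \<le> G" using finite_upper_bound[of g] by blast
  have Gn: "norm (complex_of_real (g k)) \<le> G" for k using G[of k] g[of k] by simp
  have "\<exists>D. (\<lambda>N. sqrt (real N) * (\<Sum>i\<in>I N. w i * (if Y i \<ge> 0 then exp (- \<theta> * Y i) else 0))) \<longlonglongrightarrow> D"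
  proof (rule local_limit_exponential[OF _ _ _ \<theta>])
    show "finite (I N)" for N by (simp add: I_def)
    have "replicate N undefined \<in> (paths N :: 's list set)" for N by (simp add: paths_def)
    then show "I N \<noteq> {}" for N by (auto simp: I_def)
    show "w i > 0" for i
      using \<alpha> g walk_prod_pos[of Q] Q_pos by (auto simp: w_def split: prod.splits)
    show "(\<lambda>\<tau>. \<Sum>x\<in>UNIV. complex_of_real (\<alpha> x) * complex_of_real (avg g * exp (- \<kappa> * \<tau>\<^sup>2))) \<in> borel_measurable borel"
      by measurable
    show "(\<lambda>N. \<Sum>i\<in>I N. complex_of_real (w i) * iexp (\<tau> / sqrt (real N) * Y i))
      \<longlonglongrightarrow> (\<Sum>x\<in>UNIV. complex_of_real (\<alpha> x) * complex_of_real (avg g * exp (- \<kappa> * \<tau>\<^sup>2)))" for \<tau>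
      unfolding char by (intro tendsto_sum tendsto_mult tendsto_const \<kappa>)
    fix T :: real
    obtain c where c: "c > 0" "\<And>N \<tau> g B j. 3 \<le> N \<Longrightarrow> \<bar>\<tau>\<bar> \<le> T * sqrt (real N) \<Longrightarrow> (\<And>k. norm (g k) \<le> B) \<Longrightarrow>
     norm ((mapp (twist f (\<tau> / sqrt (real N))) ^^ N) g j) \<le> exp (- c * \<tau>\<^sup>2) * B"
      using twist_funpow_dominated[OF nonlat, of T] by blast
    have "norm (\<Sum>i\<in>I N. complex_of_real (w i) * iexp (\<tau> / sqrt (real N) * Y i)) \<le> ((\<Sum>x\<in>UNIV. \<alpha> x) * G) * exp (- c * \<tau>\<^sup>2)"
      if "3 \<le> N" "\<bar>\<tau>\<bar> \<le> T * sqrt (real N)" for N \<tau>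
    proof -
      have "norm (\<Sum>i\<in>I N. complex_of_real (w i) * iexp (\<tau> / sqrt (real N) * Y i))
        \<le> (\<Sum>x\<in>UNIV. \<alpha> x * (exp (- c * \<tau>\<^sup>2) * G))"
        unfolding char
      proof (rule order_trans[OF norm_sum sum_mono])
        fix x
        have "norm ((mapp (twist f (\<tau> / sqrt (real N))) ^^ N) (\<lambda>k. complex_of_real (g k)) x) \<le> exp (- c * \<tau>\<^sup>2) * G"
          by (rule c(2)[OF that Gn])
        then show "norm (complex_of_real (\<alpha> x) * (mapp (twist f (\<tau> / sqrt (real N))) ^^ N) (\<lambda>k. complex_of_real (g k)) x)
          \<le> \<alpha> x * (exp (- c * \<tau>\<^sup>2) * G)"
          using \<alpha>[of x] by (simp only: norm_mult norm_of_real) (simp add: mult_left_mono)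
      qed
      also have "\<dots> = ((\<Sum>x\<in>UNIV. \<alpha> x) * G) * exp (- c * \<tau>\<^sup>2)"
        unfolding sum_distrib_right[symmetric] by (simp add: mult_ac)
      finally show ?thesis .
    qed
    then have "\<forall>\<^sub>F N in sequentially. \<forall>\<tau>. \<bar>\<tau>\<bar> \<le> T * sqrt (real N) \<longrightarrow>
        norm (\<Sum>i\<in>I N. complex_of_real (w i) * iexp (\<tau> / sqrt (real N) * Y i)) \<le> ((\<Sum>x\<in>UNIV. \<alpha> x) * G) * exp (- c * \<tau>\<^sup>2)"
      by (intro eventually_mono[OF eventually_ge_at_top[of 3]]) blast
    then show "\<exists>c>0. \<exists>B. \<forall>\<^sub>F N in sequentially. \<forall>\<tau>. \<bar>\<tau>\<bar> \<le> T * sqrt (real N) \<longrightarrow>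
        norm (\<Sum>i\<in>I N. complex_of_real (w i) * iexp (\<tau> / sqrt (real N) * Y i)) \<le> B * exp (- c * \<tau>\<^sup>2)"
      using c(1) by blast
  qed
  then show ?thesis unfolding I_def sum_Times w_def Y_def prod.case .
qed

section \<open>Exponential growth rate of the moment generating function\<close>

locale ld_chain =
  fixes \<nu> :: "'s::finite \<Rightarrow> real" and P h :: "'s \<Rightarrow> 's \<Rightarrow> real"
  assumes \<nu>_pos: "\<nu> x > 0" and \<nu>_sum: "(\<Sum>x\<in>UNIV. \<nu> x) = 1"
    and P_pos: "P j k > 0" and P_rows: "(\<Sum>k\<in>UNIV. P j k) = 1"
begin

definition M :: "real \<Rightarrow> 's \<Rightarrow> 's \<Rightarrow> real" where
  "M \<theta> j k = P j k * exp (\<theta> * h j k)"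

definition mgf :: "nat \<Rightarrow> real \<Rightarrow> real" where
  "mgf N \<theta> = (\<Sum>x\<in>UNIV. \<nu> x * (\<Sum>ys\<in>paths N. walk_prod P x ys * exp (\<theta> * walk_sum h x ys)))"

definition logmgf :: "real \<Rightarrow> real" where
  "logmgf \<theta> = lim (\<lambda>N. ln (mgf N \<theta>) / real N)"

lemma M_pos: "M \<theta> j k > 0"
  by (simp add: M_def P_pos)

lemma mgf_eq: "mgf N \<theta> = (\<Sum>x\<in>UNIV. \<nu> x * (mapp (M \<theta>) ^^ N) (\<lambda>_. 1) x)"
  unfolding mgf_def M_def[abs_def] sum_walks_eq_funpow[symmetric] walk_prod_exp by simp

lemma walk_prob_pos: "\<nu> x * (walk_prod P x ys * exp (\<theta> * walk_sum h x ys)) > 0"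
  using \<nu>_pos[of x] walk_prod_pos[of P x ys] P_pos by simp

lemma mgf_pos: "mgf N \<theta> > 0"
proof -
  have "replicate N undefined \<in> (paths N :: 's list set)" by (simp add: paths_def)
  then show ?thesis unfolding mgf_def sum_distrib_left
    by (intro sum_pos walk_prob_pos) auto
qed

text \<open>The constant function 1 lies below \<open>V / c\<close>, with \<open>c\<close> a lower
  bound of \<open>V\<close>, and the supersolution property bounds the powers applied to
  \<open>V\<close>.\<close>

lemma mgf_le:
  assumes V: "\<And>j. V j > 0" and "\<And>j. mapp (M \<theta>) V j \<le> l * V j" and l: "l > 0"
  obtains C where "C > 0" "\<And>N. mgf N \<theta> \<le> C * l ^ N"
proof -
  obtain c where c: "c > 0" "\<And>j. c \<le> V j" using finite_pos_lower_bound[of V] V by blast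
  have "mgf N \<theta> \<le> (\<Sum>x\<in>UNIV. \<nu> x * (V x / c)) * l ^ N" for N
  proof -
    have "(mapp (M \<theta>) ^^ N) (\<lambda>_. 1) x \<le> V x / c * l ^ N" for x
    proof -
      have "(mapp (M \<theta>) ^^ N) (\<lambda>_. 1) x \<le> (mapp (M \<theta>) ^^ N) (\<lambda>k. (1 / c) * V k) x"
        using c M_pos by (intro mapp_funpow_mono) (auto simp: less_imp_le)
      also have "\<dots> = (1 / c) * (mapp (M \<theta>) ^^ N) V x" by (simp only: mapp_funpow_cmult)
      also have "\<dots> \<le> (1 / c) * (l ^ N * V x)"
        using c l assms(2) M_pos by (intro mult_left_mono mapp_funpow_upper) (auto simp: less_imp_le)
      finally show ?thesis by (simp add: mult_ac)
    qed
    then have "mgf N \<theta> \<le> (\<Sum>x\<in>UNIV. \<nu> x * (V x / c * l ^ N))"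
      unfolding mgf_eq using \<nu>_pos by (intro sum_mono mult_left_mono) (auto simp: less_imp_le)
    then show ?thesis by (simp add: sum_distrib_right mult.assoc)
  qed
  moreover have "(\<Sum>x\<in>UNIV. \<nu> x * (V x / c)) > 0" using \<nu>_pos V c by (intro sum_pos) auto
  ultimately show thesis using that by blast
qed

lemma ln_const_over_n: "(\<lambda>N. c / real N + d) \<longlonglongrightarrow> d"
  using tendsto_add[OF lim_const_over_n[of c] tendsto_const[of d]] by simp

text \<open>A positive eigenvector lies between positive constants, so \<open>mgf N \<theta>\<close>
  equals \<open>l ^ N\<close> up to bounded factors. This also shows that \<open>l\<close> is
  independent of the chosen positive eigenvector.\<close>

lemma logmgf_eigen:
  assumes l: "l > 0" and r: "\<And>j. r j > 0" and eig: "\<And>j. mapp (M \<theta>) r j = l * r j"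
  shows "(\<lambda>N. ln (mgf N \<theta>) / real N) \<longlonglongrightarrow> ln l"
proof -
  obtain C where C: "C > 0" "\<And>N. mgf N \<theta> \<le> C * l ^ N" using mgf_le[of r \<theta> l] r eig l by (metis order_refl)
  obtain c where c: "c > 0" "\<And>j. r j \<le> c" using finite_upper_bound[of r] by blast
  define d where "d = (\<Sum>x\<in>UNIV. \<nu> x * (r x / c))"
  have d: "d > 0" unfolding d_def using \<nu>_pos r c by (intro sum_pos) auto
  have low: "d * l ^ N \<le> mgf N \<theta>" for N
  proof -
    have "r x / c * l ^ N \<le> (mapp (M \<theta>) ^^ N) (\<lambda>_. 1) x" for x
    proof -
      have "r x / c * l ^ N = (mapp (M \<theta>) ^^ N) (\<lambda>k. (1 / c) * r k) x"
        by (simp only: mapp_funpow_cmult mapp_funpow_eigen[OF eig]) (simp add: mult_ac)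
      also have "\<dots> \<le> (mapp (M \<theta>) ^^ N) (\<lambda>_. 1) x"
        using c M_pos by (intro mapp_funpow_mono) (auto simp: less_imp_le)
      finally show ?thesis .
    qed
    then have "(\<Sum>x\<in>UNIV. \<nu> x * (r x / c * l ^ N)) \<le> mgf N \<theta>"
      unfolding mgf_eq using \<nu>_pos by (intro sum_mono mult_left_mono) (auto simp: less_imp_le)
    then show ?thesis by (simp add: sum_distrib_right mult.assoc d_def)
  qed
  show ?thesis
  proof (rule tendsto_sandwich)
    show "(\<lambda>N. ln d / real N + ln l) \<longlonglongrightarrow> ln l" "(\<lambda>N. ln C / real N + ln l) \<longlonglongrightarrow> ln l"
      by (rule ln_const_over_n)+
    show "\<forall>\<^sub>F N in sequentially. ln d / real N + ln l \<le> ln (mgf N \<theta>) / real N"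
      using eventually_gt_at_top[of 0]
    proof eventually_elim
      case (elim N)
      have "ln (d * l ^ N) \<le> ln (mgf N \<theta>)" using low[of N] d l by (intro ln_mono) auto
      then have "ln d + real N * ln l \<le> ln (mgf N \<theta>)" using d l by (simp add: ln_mult ln_realpow)
      then have "(ln d + real N * ln l) / real N \<le> ln (mgf N \<theta>) / real N" by (rule divide_right_mono) simp
      then show ?case using elim by (simp add: add_divide_distrib)
    qed
    show "\<forall>\<^sub>F N in sequentially. ln (mgf N \<theta>) / real N \<le> ln C / real N + ln l"
      using eventually_gt_at_top[of 0]
    proof eventually_elim
      case (elim N)
      have "ln (mgf N \<theta>) \<le> ln (C * l ^ N)" using C(2)[of N] mgf_pos by (intro ln_mono) auto
      then have "ln (mgf N \<theta>) \<le> ln C + real N * ln l" using C l by (simp add: ln_mult ln_realpow)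
      then have "ln (mgf N \<theta>) / real N \<le> (ln C + real N * ln l) / real N" by (rule divide_right_mono) simp
      then show ?case using elim by (simp add: add_divide_distrib)
    qed
  qed
qed

lemma logmgf_eq: "l > 0 \<Longrightarrow> (\<And>j. r j > 0) \<Longrightarrow> (\<And>j. mapp (M \<theta>) r j = l * r j) \<Longrightarrow> logmgf \<theta> = ln l"
  unfolding logmgf_def by (rule limI[OF logmgf_eigen])

lemma eigen_exists: obtains l r where "l > 0" "\<And>j. r j > 0" "\<And>j. mapp (M \<theta>) r j = l * r j"
  using perron_eigenvector[of "M \<theta>"] M_pos by blast

lemma logmgf_lim: "(\<lambda>N. ln (mgf N \<theta>) / real N) \<longlonglongrightarrow> logmgf \<theta>"
proof -
  obtain l r where "l > 0" "\<And>j. r j > 0" "\<And>j. mapp (M \<theta>) r j = l * r j" using eigen_exists by blast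
  then show ?thesis using logmgf_eigen logmgf_eq by metis
qed

text \<open>Collatz-Wielandt bound: every positive test vector yields an upper bound, so perturbed
  eigenvectors can be used without solving the perturbed eigenvalue problem.\<close>

lemma logmgf_le:
  assumes V: "\<And>j. V j > 0" and "\<And>j. mapp (M \<theta>) V j \<le> l * V j" and l: "l > 0"
  shows "logmgf \<theta> \<le> ln l"
proof -
  obtain C where C: "C > 0" "\<And>N. mgf N \<theta> \<le> C * l ^ N" using mgf_le[OF assms] by blast
  have "\<forall>\<^sub>F N in sequentially. ln (mgf N \<theta>) / real N \<le> ln C / real N + ln l"
    using eventually_gt_at_top[of 0]
  proof eventually_elim
    case (elim N)
    have "ln (mgf N \<theta>) \<le> ln (C * l ^ N)" using C(2)[of N] mgf_pos by (intro ln_mono) auto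
    then have "ln (mgf N \<theta>) \<le> ln C + real N * ln l" using C l by (simp add: ln_mult ln_realpow)
    then have "ln (mgf N \<theta>) / real N \<le> (ln C + real N * ln l) / real N" by (rule divide_right_mono) simp
    then show ?case using elim by (simp add: add_divide_distrib)
  qed
  then show ?thesis by (rule tendsto_le[OF sequentially_bot ln_const_over_n logmgf_lim])
qed

text \<open>Passing from \<open>t\<close> to \<open>s\<close> multiplies each matrix entry by at
  most \<open>exp (H * \<bar>s - t\<bar>)\<close>, so the eigenvector at \<open>t\<close> is a
  supersolution at \<open>s\<close>.\<close>

lemma logmgf_lipschitz:
  obtains H where "H > 0" "\<And>s t. \<bar>logmgf s - logmgf t\<bar> \<le> H * \<bar>s - t\<bar>"
proof -
  obtain H where H: "H > 0" "\<And>j k. \<bar>h j k\<bar> \<le> H" using finite_upper_bound2[of "\<lambda>j k. \<bar>h j k\<bar>"] by blast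
  have le: "logmgf s \<le> logmgf t + H * \<bar>s - t\<bar>" for s t
  proof -
    obtain l r where l: "l > 0" and r: "\<And>j. r j > 0" and eig: "\<And>j. mapp (M t) r j = l * r j"
      using eigen_exists by blast
    have "mapp (M s) r j \<le> (exp (H * \<bar>s - t\<bar>) * l) * r j" for j
    proof -
      have "M s j k \<le> exp (H * \<bar>s - t\<bar>) * M t j k" for k
      proof -
        have "(s - t) * h j k \<le> \<bar>s - t\<bar> * \<bar>h j k\<bar>" unfolding abs_mult[symmetric] by (rule abs_ge_self)
        also have "\<dots> \<le> \<bar>s - t\<bar> * H" by (intro mult_left_mono H) auto
        finally have "s * h j k \<le> H * \<bar>s - t\<bar> + t * h j k" by (simp add: algebra_simps)
        then have "exp (s * h j k) \<le> exp (H * \<bar>s - t\<bar>) * exp (t * h j k)" by (simp flip: exp_add)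
        then have "P j k * exp (s * h j k) \<le> P j k * (exp (H * \<bar>s - t\<bar>) * exp (t * h j k))"
          using P_pos[of j k] by (intro mult_left_mono) auto
        then show ?thesis by (simp add: M_def mult_ac)
      qed
      then have "mapp (M s) r j \<le> (\<Sum>k\<in>UNIV. (exp (H * \<bar>s - t\<bar>) * M t j k) * r k)"
        unfolding mapp_def using r by (intro sum_mono mult_right_mono) (auto simp: less_imp_le)
      also have "\<dots> = exp (H * \<bar>s - t\<bar>) * mapp (M t) r j" by (simp add: mapp_def sum_distrib_left mult_ac)
      finally show ?thesis by (simp add: eig mult_ac)
    qed
    then have "logmgf s \<le> ln (exp (H * \<bar>s - t\<bar>) * l)" using l r by (intro logmgf_le[of r]) auto
    also have "\<dots> = H * \<bar>s - t\<bar> + logmgf t" using l logmgf_eq[OF l r eig] by (simp add: ln_mult)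
    finally show ?thesis by simp
  qed
  show thesis
  proof (rule that[OF H(1)])
    show "\<bar>logmgf s - logmgf t\<bar> \<le> H * \<bar>s - t\<bar>" for s t
      using le[of s t] le[of t s] by (simp add: abs_minus_commute abs_le_iff)
  qed
qed

definition tilt :: "real \<Rightarrow> ('s \<Rightarrow> real) \<Rightarrow> real \<Rightarrow> 's \<Rightarrow> 's \<Rightarrow> real" where
  "tilt l r \<theta> j k = M \<theta> j k * r k / (l * r j)"

lemma tilt_chain:
  assumes l: "l > 0" and r: "\<And>j. r j > 0" and eig: "\<And>j. mapp (M \<theta>) r j = l * r j"
  obtains p where "pos_chain (tilt l r \<theta>) p"
proof (rule pos_chain_exists[of "tilt l r \<theta>"])
  show "tilt l r \<theta> j k > 0" for j k using l r[of j] r[of k] M_pos by (simp add: tilt_def)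
  show "(\<Sum>k\<in>UNIV. tilt l r \<theta> j k) = 1" for j
    using eig[of j] l r[of j] by (simp add: tilt_def sum_divide_distrib[symmetric] mapp_def)
qed (use that in blast)

text \<open>With \<open>u\<close> solving the Poisson equation of the tilted chain,
  \<open>r (1 + s u)\<close> is a supersolution for the eigenvalue problem at \<open>\<theta> + s\<close>.\<close>

lemma logmgf_local_upper:
  assumes l: "l > 0" and r: "\<And>j. r j > 0" and eig: "\<And>j. mapp (M \<theta>) r j = l * r j"
    and p: "pos_chain (tilt l r \<theta>) p" and \<epsilon>: "\<epsilon> > 0"
  shows "\<forall>\<^sub>F s in at 0. logmgf (\<theta> + s) \<le> logmgf \<theta> + s * pos_chain.drift (tilt l r \<theta>) p h + \<epsilon> * \<bar>s\<bar>"
proof -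
  interpret pc: pos_chain "tilt l r \<theta>" p by (rule p)
  define m where "m = pc.drift h"
  obtain u where u: "\<And>j. u j - mapp (tilt l r \<theta>) u j = (\<Sum>k\<in>UNIV. tilt l r \<theta> j k * (h j k - pc.drift h))"
    using pc.poisson_centred[of h] by blast
  \<comment> \<open>The defect of \<open>1 + s * u\<close> under the perturbed tilted kernel after
    factoring out \<open>exp (s * m)\<close>. It vanishes at \<open>s = 0\<close>, and the Poisson
    equation makes its derivative vanish there as well.\<close>
  define G where "G j s = (\<Sum>k\<in>UNIV. tilt l r \<theta> j k * (exp (s * (h j k - m)) * (1 + s * u k))) - (1 + s * u j)" for j s
  have "\<forall>\<^sub>F s in at 0. \<bar>G j s\<bar> \<le> \<epsilon> / 2 * \<bar>s\<bar>" for j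
  proof -
    have "(G j has_field_derivative ((\<Sum>k\<in>UNIV. tilt l r \<theta> j k * ((h j k - m) + u k)) - u j)) (at 0)"
      unfolding G_def[abs_def] by (auto intro!: derivative_eq_intros sum.cong)
    moreover have "(\<Sum>k\<in>UNIV. tilt l r \<theta> j k * ((h j k - m) + u k)) - u j = 0"
      using u[of j] by (simp add: mapp_def distrib_left sum.distrib m_def)
    moreover have "G j 0 = 0" by (simp add: G_def pc.Q_rows)
    ultimately have "((\<lambda>s. G j s / s) \<longlongrightarrow> 0) (at 0)" by (simp add: has_field_derivative_iff)
    then have "\<forall>\<^sub>F s in at 0. dist (G j s / s) 0 < \<epsilon> / 2" using \<epsilon> by (intro tendstoD) auto
    moreover have "\<forall>\<^sub>F s in at (0::real). s \<noteq> 0" by (simp add: eventually_at_filter)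
    ultimately show ?thesis
    proof eventually_elim
      case (elim s)
      then have "\<bar>G j s\<bar> / \<bar>s\<bar> < \<epsilon> / 2" by (simp add: dist_norm)
      then show ?case using elim(2) by (simp add: pos_divide_less_eq)
    qed
  qed
  then have evG: "\<forall>\<^sub>F s in at 0. \<forall>j. \<bar>G j s\<bar> \<le> \<epsilon> / 2 * \<bar>s\<bar>" by (simp add: eventually_all_finite)
  \<comment> \<open>The bound 1/2 keeps the test vector positive and lets a defect of
    \<open>\<epsilon> / 2 * \<bar>s\<bar>\<close> be absorbed into
    \<open>\<epsilon> * \<bar>s\<bar> * (1 + s * u j)\<close>.\<close>
  have "\<forall>\<^sub>F s in at 0. 1 / 2 < 1 + s * u j" for j
  proof -
    have "((\<lambda>s. 1 + s * u j) \<longlongrightarrow> 1 + 0 * u j) (at 0)" by (intro tendsto_intros)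
    then show ?thesis by (rule order_tendstoD) simp
  qed
  then have "\<forall>\<^sub>F s in at 0. \<forall>j. 1 / 2 < 1 + s * u j" by (simp add: eventually_all_finite)
  with evG show ?thesis
  proof eventually_elim
    case (elim s)
    define l' where "l' = l * exp (s * m) * (1 + \<epsilon> * \<bar>s\<bar>)"
    have e1: "1 + \<epsilon> * \<bar>s\<bar> > 0" using \<epsilon> by (simp add: add_pos_nonneg)
    have l': "l' > 0" unfolding l'_def using l e1 by simp
    have "logmgf (\<theta> + s) \<le> ln l'"
    proof (rule logmgf_le[OF _ _ l'])
      show "r j * (1 + s * u j) > 0" for j using r[of j] elim(2)[rule_format, of j] by simp
      fix j
      have step: "M (\<theta> + s) j k * (r k * (1 + s * u k))
         = l * r j * exp (s * m) * (tilt l r \<theta> j k * (exp (s * (h j k - m)) * (1 + s * u k)))" for k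
      proof -
        have "M (\<theta> + s) j k = M \<theta> j k * (exp (s * m) * exp (s * (h j k - m)))"
          by (simp add: M_def algebra_simps flip: exp_add)
        then show ?thesis using l r[of j] by (simp add: tilt_def)
      qed
      have "mapp (M (\<theta> + s)) (\<lambda>j. r j * (1 + s * u j)) j = l * r j * exp (s * m) * (G j s + (1 + s * u j))"
        by (simp only: mapp_def step G_def sum_distrib_left diff_add_cancel)
      also have "\<dots> \<le> l * r j * exp (s * m) * ((1 + \<epsilon> * \<bar>s\<bar>) * (1 + s * u j))"
      proof (rule mult_left_mono)
        have "G j s \<le> \<epsilon> * \<bar>s\<bar> * (1 / 2)" using elim(1)[rule_format, of j] by simp
        also have "\<dots> \<le> \<epsilon> * \<bar>s\<bar> * (1 + s * u j)"
          using elim(2)[rule_format, of j] \<epsilon> by (intro mult_left_mono) auto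
        finally show "G j s + (1 + s * u j) \<le> (1 + \<epsilon> * \<bar>s\<bar>) * (1 + s * u j)" by (simp add: algebra_simps)
        show "0 \<le> l * r j * exp (s * m)" using l r[of j] by simp
      qed
      finally show "mapp (M (\<theta> + s)) (\<lambda>j. r j * (1 + s * u j)) j \<le> l' * (r j * (1 + s * u j))"
        by (simp add: l'_def mult_ac)
    qed
    also have "ln l' = ln l + s * m + ln (1 + \<epsilon> * \<bar>s\<bar>)" unfolding l'_def using l e1 by (simp add: ln_mult)
    also have "\<dots> \<le> ln l + s * m + \<epsilon> * \<bar>s\<bar>" using \<epsilon> by (simp add: ln_add_one_self_le_self)
    also have "ln l = logmgf \<theta>" using logmgf_eq[OF l r eig] by simp
    finally show ?case by (simp add: m_def)
  qed
qed

end

section \<open>Maximal walk sums and the slope of \<open>logmgf\<close> at infinity\<close>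

lemma walk_sum_le_Bn: "ys \<in> paths N \<Longrightarrow> walk_sum h x ys \<le> Bn h N"
  unfolding Bn_eq_walks by (intro Max_ge) (auto intro!: image_eqI[of _ _ "(x, ys)"])

lemma Bn_attained: obtains x ys where "ys \<in> paths N" "Bn h N = walk_sum h x ys"
proof -
  have "replicate N undefined \<in> (paths N :: 's::finite list set)" by (simp add: paths_def)
  then have "Bn h N \<in> (\<lambda>(x, ys). walk_sum h x ys) ` (UNIV \<times> paths N)"
    unfolding Bn_eq_walks by (intro Max_in) auto
  then show thesis using that by auto
qed

context ld_chain
begin

lemma mgf_le_Bn:
  assumes "\<theta> \<ge> 0"
  shows "mgf N \<theta> \<le> exp (\<theta> * Bn h N)"
proof -
  obtain p where "pos_chain P p" using pos_chain_exists[of P] P_pos P_rows by blast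
  then interpret pc: pos_chain P p .
  have "mgf N \<theta> \<le> (\<Sum>x\<in>UNIV. \<nu> x * (\<Sum>ys\<in>paths N. walk_prod P x ys * exp (\<theta> * Bn h N)))"
    unfolding mgf_def using \<nu>_pos walk_prod_pos[of P] P_pos assms
    by (intro sum_mono mult_left_mono) (auto simp: less_imp_le intro!: mult_left_mono walk_sum_le_Bn)
  also have "\<dots> = exp (\<theta> * Bn h N)"
    by (simp add: sum_distrib_right[symmetric] pc.sum_walk_prod \<nu>_sum)
  finally show ?thesis .
qed

text \<open>Only one maximising walk is kept; its probability is at least
  \<open>c * q ^ N\<close>.\<close>

lemma mgf_ge_Bn:
  assumes "0 < c" "\<And>x. c \<le> \<nu> x" "0 < q" "\<And>j k. q \<le> P j k"
  shows "c * (q ^ N * exp (\<theta> * Bn h N)) \<le> mgf N \<theta>"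
proof -
  obtain x ys where ys: "ys \<in> paths N" "Bn h N = walk_sum h x ys" using Bn_attained by blast
  have "c * (q ^ N * exp (\<theta> * Bn h N)) \<le> \<nu> x * (walk_prod P x ys * exp (\<theta> * walk_sum h x ys))"
    using walk_prod_ge[of q P ys x] assms ys walk_prod_pos[of P x ys] P_pos \<nu>_pos[of x]
    by (intro mult_mono) (auto simp: paths_def less_imp_le)
  also have "\<dots> \<le> (\<Sum>ys\<in>paths N. \<nu> x * (walk_prod P x ys * exp (\<theta> * walk_sum h x ys)))"
    using ys walk_prob_pos by (intro member_le_sum) (auto simp: less_imp_le)
  also have "\<dots> \<le> (\<Sum>x\<in>UNIV. \<Sum>ys\<in>paths N. \<nu> x * (walk_prod P x ys * exp (\<theta> * walk_sum h x ys)))"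
    using walk_prob_pos by (intro member_le_sum[of x]) (auto intro!: sum_nonneg simp: less_imp_le)
  finally show ?thesis by (simp add: mgf_def sum_distrib_left)
qed

lemma ln_mgf_ge_Bn:
  assumes "0 < c" "\<And>x. c \<le> \<nu> x" "0 < q" "\<And>j k. q \<le> P j k" "N > 0"
  shows "\<theta> * (Bn h N / real N) + ln q + ln c / real N \<le> ln (mgf N \<theta>) / real N"
proof -
  have "ln (c * (q ^ N * exp (\<theta> * Bn h N))) \<le> ln (mgf N \<theta>)"
    using mgf_ge_Bn[OF assms(1-4)] assms(1,3) by (intro ln_mono) auto
  then have "ln c + (real N * ln q + \<theta> * Bn h N) \<le> ln (mgf N \<theta>)"
    using assms(1,3) by (simp add: ln_mult ln_realpow)
  then have "(ln c + (real N * ln q + \<theta> * Bn h N)) / real N \<le> ln (mgf N \<theta>) / real N"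
    by (rule divide_right_mono) simp
  then show ?thesis using assms(5) by (simp add: add_divide_distrib)
qed

text \<open>As \<open>\<theta>\<close> grows, the convergent sequence \<open>ln (mgf N \<theta>) / (\<theta> N)\<close> is uniformly close to \<open>Bn h N / N\<close>.\<close>

lemma Bn_lim: "(\<lambda>N. Bn h N / real N) \<longlonglongrightarrow> Bmax h"
proof -
  obtain c0 where c0: "c0 > 0" "\<And>x. c0 \<le> \<nu> x" using finite_pos_lower_bound[of \<nu>] \<nu>_pos by blast
  \<comment> \<open>Capping at 1 makes \<open>ln c\<close> nonpositive, so that
    \<open>ln c / N\<close> is bounded below by \<open>ln c\<close> for all
    \<open>N > 0\<close>.\<close>
  define c where "c = min c0 1"
  have c: "c > 0" "\<And>x. c \<le> \<nu> x" "ln c \<le> 0" using c0 by (auto simp: c_def min_le_iff_disj)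
  obtain q where q: "q > 0" "\<And>j k. q \<le> P j k" using finite_pos_lower_bound2[of P] P_pos by blast
  define K where "K = \<bar>ln q\<bar> + \<bar>ln c\<bar> + 1"
  have K: "K > 0" by (simp add: K_def add_nonneg_pos)
  define b where "b N = Bn h N / real N" for N
  have "Cauchy b"
  proof (rule CauchyI)
    fix e :: real assume e: "e > 0"
    \<comment> \<open>Chosen so that the error \<open>K / \<theta>\<close> between \<open>b\<close>
      and \<open>X\<close> is exactly one third of \<open>e\<close>.\<close>
    define \<theta> where "\<theta> = 3 * K / e"
    have \<theta>: "\<theta> > 0" using K e by (simp add: \<theta>_def)
    define X where "X N = ln (mgf N \<theta>) / real N / \<theta>" for N
    have bX: "0 \<le> b N - X N \<and> b N - X N \<le> e / 3" if "N > 0" for N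
    proof
      have "ln (mgf N \<theta>) \<le> ln (exp (\<theta> * Bn h N))" using mgf_le_Bn[of \<theta> N] mgf_pos \<theta> by (intro ln_mono) auto
      then have "ln (mgf N \<theta>) / real N \<le> \<theta> * b N" using that by (simp add: b_def divide_right_mono)
      then have "ln (mgf N \<theta>) / real N / \<theta> \<le> \<theta> * b N / \<theta>" using \<theta> by (intro divide_right_mono) auto
      then show "0 \<le> b N - X N" unfolding X_def using \<theta> by simp
      have "ln c \<le> ln c / real N"
        using c(3) that mult_right_mono_neg[of 1 "real N" "ln c"] by (simp add: field_simps)
      then have "\<theta> * b N - K \<le> ln (mgf N \<theta>) / real N"
        using ln_mgf_ge_Bn[OF c(1,2) q that, of \<theta>] by (simp add: b_def K_def)
      then have "(\<theta> * b N - K) / \<theta> \<le> X N" unfolding X_def using \<theta> by (intro divide_right_mono) auto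
      then have "b N - K / \<theta> \<le> X N" using \<theta> by (simp add: diff_divide_distrib)
      moreover have "K / \<theta> = e / 3" using K e by (simp add: \<theta>_def)
      ultimately show "b N - X N \<le> e / 3" by simp
    qed
    have "X \<longlonglongrightarrow> logmgf \<theta> / \<theta>" unfolding X_def using \<theta> by (intro tendsto_intros logmgf_lim) auto
    then have "Cauchy X" by (rule LIMSEQ_imp_Cauchy)
    then obtain N0 where N0: "\<And>m n. m \<ge> N0 \<Longrightarrow> n \<ge> N0 \<Longrightarrow> norm (X m - X n) < e / 3"
      using e CauchyD[of X "e / 3"] by (metis divide_pos_pos zero_less_numeral)
    show "\<exists>N0. \<forall>m\<ge>N0. \<forall>n\<ge>N0. norm (b m - b n) < e"
    proof (intro exI[of _ "max 1 N0"] allI impI)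
      fix m n assume "max 1 N0 \<le> m" "max 1 N0 \<le> n"
      then have "norm (X m - X n) < e / 3" "0 \<le> b m - X m \<and> b m - X m \<le> e / 3"
        "0 \<le> b n - X n \<and> b n - X n \<le> e / 3"
        using N0 bX by auto
      then show "norm (b m - b n) < e" using e unfolding real_norm_def by linarith
    qed
  qed
  then show ?thesis
    unfolding Bmax_def b_def[symmetric] using Cauchy_convergent convergent_LIMSEQ_iff by blast
qed

text \<open>Following a maximising walk costs a factor \<open>q\<close> per step, which produces the
  intercept \<open>ln q\<close>, the same for every \<open>\<theta>\<close>.\<close>

lemma logmgf_linear_growth: obtains d where "\<And>\<theta>. \<theta> * Bmax h + d \<le> logmgf \<theta>"
proof -
  obtain c where c: "c > 0" "\<And>x. c \<le> \<nu> x" using finite_pos_lower_bound[of \<nu>] \<nu>_pos by blast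
  obtain q where q: "q > 0" "\<And>j k. q \<le> P j k" using finite_pos_lower_bound2[of P] P_pos by blast
  have "\<theta> * Bmax h + ln q + 0 \<le> logmgf \<theta>" for \<theta>
  proof (rule tendsto_le[OF sequentially_bot logmgf_lim])
    show "(\<lambda>N. \<theta> * (Bn h N / real N) + ln q + ln c / real N) \<longlonglongrightarrow> \<theta> * Bmax h + ln q + 0"
      by (intro tendsto_intros Bn_lim lim_const_over_n)
    show "\<forall>\<^sub>F N in sequentially. \<theta> * (Bn h N / real N) + ln q + ln c / real N \<le> ln (mgf N \<theta>) / real N"
      using eventually_gt_at_top[of 0] by eventually_elim (rule ln_mgf_ge_Bn[OF c q])
  qed
  then show thesis using that[of "ln q"] by simp
qed

section \<open>The saddle point and the drift of the tilted chain\<close>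

lemma saddle_point_exists:
  assumes a: "0 < a" "a < Bmax h" and p: "pos_chain P p" and m0: "pos_chain.drift P p h = 0"
  obtains \<theta> where "\<theta> > 0" "\<And>t. t \<ge> 0 \<Longrightarrow> logmgf \<theta> - a * \<theta> \<le> logmgf t - a * t"
proof -
  define G where "G t = logmgf t - a * t" for t
  obtain H where H: "H > 0" "\<And>s t. \<bar>logmgf s - logmgf t\<bar> \<le> H * \<bar>s - t\<bar>" using logmgf_lipschitz by blast
  have cont: "continuous_on A G" for A
  proof -
    have "continuous_on A logmgf"
      unfolding continuous_on_iff
    proof (intro ballI allI impI)
      fix x e :: real assume "e > 0"
      then show "\<exists>d>0. \<forall>x'\<in>A. dist x' x < d \<longrightarrow> dist (logmgf x') (logmgf x) < e"
        using H by (intro exI[of _ "e / H"])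
          (auto simp: dist_real_def field_simps intro: order.strict_trans1[OF H(2)])
    qed
    then show ?thesis unfolding G_def[abs_def] by (intro continuous_intros)
  qed
  obtain d where d: "\<And>\<theta>. \<theta> * Bmax h + d \<le> logmgf \<theta>" using logmgf_linear_growth by blast
  \<comment> \<open>Beyond \<open>T\<close> the linear lower bound of slope
    \<open>Bmax h - a\<close> has climbed above \<open>G 0\<close>, so minimising over the compact
    interval is enough.\<close>
  define T where "T = \<bar>G 0 - d\<bar> / (Bmax h - a)"
  have T: "T \<ge> 0" using a by (simp add: T_def)
  have far: "G 0 \<le> G t" if "t \<ge> T" for t
  proof -
    have "G 0 - d \<le> T * (Bmax h - a)" using a by (simp add: T_def)
    also have "\<dots> \<le> t * (Bmax h - a)" using that a by (intro mult_right_mono) auto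
    finally show ?thesis using d[of t] by (simp add: G_def algebra_simps)
  qed
  have "{0..T} \<noteq> {}" using T by simp
  then obtain \<theta> where \<theta>: "\<theta> \<in> {0..T}" "\<And>t. t \<in> {0..T} \<Longrightarrow> G \<theta> \<le> G t"
    using continuous_attains_inf[OF compact_Icc _ cont] by blast
  have min: "G \<theta> \<le> G t" if "t \<ge> 0" for t
  proof (cases "t \<le> T")
    case False
    then have "G 0 \<le> G t" by (intro far) simp
    moreover have "G \<theta> \<le> G 0" using \<theta>(2)[of 0] T by simp
    ultimately show ?thesis by simp
  qed (use that \<theta> in auto)
  \<comment> \<open>With zero drift \<open>logmgf\<close> rises by at most \<open>a / 2\<close> per
    unit near the origin, whereas \<open>a * t\<close> rises by \<open>a\<close>, so
    \<open>G\<close> is strictly smaller just to the right of 0.\<close>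
  have "\<theta> \<noteq> 0"
  proof
    assume "\<theta> = 0"
    \<comment> \<open>At parameter 0 the eigenvalue and the eigenvector are 1, so the tilted chain
      is the original one.\<close>
    have tP: "tilt 1 (\<lambda>_. 1) 0 = P" by (simp add: tilt_def M_def fun_eq_iff)
    have "\<forall>\<^sub>F s in at 0. logmgf (0 + s) \<le> logmgf 0 + s * pos_chain.drift (tilt 1 (\<lambda>_. 1) 0) p h + a / 2 * \<bar>s\<bar>"
      using p a by (intro logmgf_local_upper) (simp_all add: tP mapp_def M_def P_rows)
    then have "\<forall>\<^sub>F s in at 0. logmgf s \<le> logmgf 0 + a / 2 * \<bar>s\<bar>" by (simp add: tP m0)
    then obtain \<delta> where \<delta>: "\<delta> > 0" "\<And>s. s \<noteq> 0 \<Longrightarrow> \<bar>s\<bar> < \<delta> \<Longrightarrow> logmgf s \<le> logmgf 0 + a / 2 * \<bar>s\<bar>"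
      by (auto simp: eventually_at dist_real_def)
    have "logmgf (\<delta> / 2) \<le> logmgf 0 + a / 2 * \<bar>\<delta> / 2\<bar>" using \<delta> by (intro \<delta>(2)) auto
    moreover have "G 0 \<le> G (\<delta> / 2)" using min[of "\<delta> / 2"] \<delta>(1) \<open>\<theta> = 0\<close> by simp
    moreover have "a * \<delta> > 0" using a \<delta> by simp
    ultimately show False using \<delta>(1) by (simp add: G_def)
  qed
  then show thesis using that[of \<theta>] min \<theta>(1) by (auto simp: G_def)
qed

text \<open>If the drift \<open>m\<close> differed from \<open>a\<close>, the local upper bound with
  error slope \<open>\<bar>m - a\<bar> / 2\<close> would make \<open>logmgf t - a * t\<close>
  strictly smaller on the side where \<open>(t - \<theta>) * (m - a)\<close> is negative.\<close>

lemma saddle_point_drift: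
  assumes \<theta>: "\<theta> > 0" and min: "\<And>t. t \<ge> 0 \<Longrightarrow> logmgf \<theta> - a * \<theta> \<le> logmgf t - a * t"
    and l: "l > 0" and r: "\<And>j. r j > 0" and eig: "\<And>j. mapp (M \<theta>) r j = l * r j"
    and p: "pos_chain (tilt l r \<theta>) p"
  shows "pos_chain.drift (tilt l r \<theta>) p h = a"
proof (rule ccontr)
  define m where "m = pos_chain.drift (tilt l r \<theta>) p h"
  assume "pos_chain.drift (tilt l r \<theta>) p h \<noteq> a"
  then have ma: "\<bar>m - a\<bar> > 0" by (simp add: m_def)
  have "\<forall>\<^sub>F s in at 0. logmgf (\<theta> + s) \<le> logmgf \<theta> + s * m + \<bar>m - a\<bar> / 2 * \<bar>s\<bar>"
    unfolding m_def by (rule logmgf_local_upper[OF l r eig p]) (use ma in \<open>simp add: m_def\<close>)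
  then obtain \<delta> where \<delta>: "\<delta> > 0" "\<And>s. s \<noteq> 0 \<Longrightarrow> \<bar>s\<bar> < \<delta> \<Longrightarrow>
      logmgf (\<theta> + s) \<le> logmgf \<theta> + s * m + \<bar>m - a\<bar> / 2 * \<bar>s\<bar>"
    by (auto simp: eventually_at dist_real_def)
  define \<eta> where "\<eta> = min (\<delta> / 2) \<theta>"
  have \<eta>: "\<eta> > 0" "\<eta> < \<delta>" "\<eta> \<le> \<theta>" using \<delta> \<theta> by (auto simp: \<eta>_def)
  \<comment> \<open>The sign is opposite to that of \<open>m - a\<close>; the size is at most
    \<open>\<theta>\<close>, so that \<open>\<theta> + s\<close> stays in the range where minimality
    is known.\<close>
  define s where "s = - sgn (m - a) * \<eta>"
  have s: "s \<noteq> 0" "\<bar>s\<bar> = \<eta>" "s * (m - a) = - (\<eta> * \<bar>m - a\<bar>)" using ma \<eta>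
    by (auto simp: s_def sgn_if abs_if)
  have "logmgf (\<theta> + s) \<le> logmgf \<theta> + s * m + \<bar>m - a\<bar> / 2 * \<bar>s\<bar>" using s \<eta> by (intro \<delta>(2)) auto
  moreover have "logmgf \<theta> - a * \<theta> \<le> logmgf (\<theta> + s) - a * (\<theta> + s)" using s \<eta> by (intro min) linarith
  ultimately have "0 \<le> s * (m - a) + \<bar>m - a\<bar> / 2 * \<eta>" using s(2) by (simp add: algebra_simps)
  also have "\<dots> = - (\<bar>m - a\<bar> * \<eta> / 2)" unfolding s(3) by (simp add: algebra_simps)
  finally show False using mult_pos_pos[OF ma \<eta>(1)] by simp
qed

lemma walk_prod_eq_tilt:
  assumes l: "l > 0" and r: "\<And>j. r j > 0" and ys: "ys \<in> paths N"
  shows "walk_prod P x ys = l ^ N * exp (- \<theta> * walk_sum h x ys) * (r x * walk_prod (tilt l r \<theta>) x ys * (1 / r (walk_end x ys)))"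
proof -
  have "walk_prod (tilt l r \<theta>) x ys = walk_prod P x ys * exp (\<theta> * walk_sum h x ys) * r (walk_end x ys) / (l ^ N * r x)"
    using walk_prod_tilt[OF r l, where A = "M \<theta>" and x = x and ys = ys] ys
    by (simp add: tilt_def[abs_def] M_def[abs_def] walk_prod_exp paths_def)
  then show ?thesis using l r[of x] r[of "walk_end x ys"] by (simp add: exp_minus field_simps)
qed

text \<open>After tilting, \<open>l ^ N\<close> and \<open>exp (- \<theta> * a * N)\<close> cancel
  exactly against the exponential of the rate. For every \<open>N\<close> the rescaled probability
  equals the expectation treated in \<open>walk_exponential_limit\<close>, with starting weight
  \<open>\<nu> x * r x\<close> and end weight \<open>1 / r\<close>.\<close>

lemma tail_expansion:
  assumes a: "0 < a" "a < Bmax h" and p0: "pos_chain P p0" and m0: "pos_chain.drift P p0 h = 0"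
    and nonlattice: "\<not> (\<exists>c r (H :: 's \<Rightarrow> real). r \<noteq> 0 \<and>
        (\<forall>j k. \<exists>m::int. r * h j k = c + H k - H j + 2 * pi * real_of_int m))"
  shows "\<exists>D. (\<lambda>N. sqrt (real N) * ((\<Sum>x\<in>UNIV. \<nu> x * (\<Sum>ys\<in>paths N. walk_prod P x ys *
      (if walk_sum h x ys \<ge> a * real N then 1 else 0))) * exp ((SUP \<theta>\<in>{0<..}. a * \<theta> - logmgf \<theta>) * real N))) \<longlonglongrightarrow> D"
proof -
  obtain \<theta> where \<theta>: "\<theta> > 0" and min: "\<And>t. t \<ge> 0 \<Longrightarrow> logmgf \<theta> - a * \<theta> \<le> logmgf t - a * t"
    using saddle_point_exists[OF a p0 m0] by blast
  have rate: "(SUP \<theta>\<in>{0<..}. a * \<theta> - logmgf \<theta>) = a * \<theta> - logmgf \<theta>"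
  proof (rule cSup_eq_maximum)
    show "a * \<theta> - logmgf \<theta> \<in> (\<lambda>\<theta>. a * \<theta> - logmgf \<theta>) ` {0<..}" using \<theta> by auto
    fix x assume "x \<in> (\<lambda>\<theta>. a * \<theta> - logmgf \<theta>) ` {0<..}"
    then obtain t where "t > 0" "x = a * t - logmgf t" by auto
    then show "x \<le> a * \<theta> - logmgf \<theta>" using min[of t] by simp
  qed
  obtain l r where l: "l > 0" and r: "\<And>j. r j > 0" and eig: "\<And>j. mapp (M \<theta>) r j = l * r j"
    using eigen_exists[of \<theta>] by blast
  obtain p where p: "pos_chain (tilt l r \<theta>) p" using tilt_chain[OF l r eig] by blast
  interpret pc: pos_chain "tilt l r \<theta>" p by (rule p)
  have drift: "pc.drift h = a" by (rule saddle_point_drift[OF \<theta> min l r eig p])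
  define f where "f j k = h j k - a" for j k
  have f0: "pc.drift f = 0" using pc.drift_centre[of h] by (simp add: drift f_def[abs_def])
  have diff: "(f j k + f k l) - (f j k' + f k' l) = (h j k + h k l) - (h j k' + h k' l)" for j k k' l
    by (simp add: f_def)
  have "\<exists>j l k k'. cos (t * ((f j k + f k l) - (f j k' + f k' l))) \<noteq> 1" if "t \<noteq> 0" for t
    unfolding diff by (rule nonlattice_two_step[OF nonlattice that])
  then have "\<exists>D. (\<lambda>N. sqrt (real N) * (\<Sum>x\<in>UNIV. \<Sum>ys\<in>paths N.
      (\<nu> x * r x) * walk_prod (tilt l r \<theta>) x ys * (1 / r (walk_end x ys)) *
      (if walk_sum f x ys \<ge> 0 then exp (- \<theta> * walk_sum f x ys) else 0))) \<longlonglongrightarrow> D"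
    using \<nu>_pos r by (intro pc.walk_exponential_limit[OF f0 _ _ _ \<theta>]) auto
  moreover have "(\<Sum>x\<in>UNIV. \<nu> x * (\<Sum>ys\<in>paths N. walk_prod P x ys *
      (if walk_sum h x ys \<ge> a * real N then 1 else 0))) * exp ((SUP \<theta>\<in>{0<..}. a * \<theta> - logmgf \<theta>) * real N)
    = (\<Sum>x\<in>UNIV. \<Sum>ys\<in>paths N. (\<nu> x * r x) * walk_prod (tilt l r \<theta>) x ys * (1 / r (walk_end x ys)) *
      (if walk_sum f x ys \<ge> 0 then exp (- \<theta> * walk_sum f x ys) else 0))" for N
    unfolding sum_distrib_left sum_distrib_right
  proof (intro sum.cong refl)
    fix x :: 's and ys :: "'s list" assume ys: "ys \<in> paths N"
    have ws: "walk_sum f x ys = walk_sum h x ys - a * real N"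
      using ys by (simp add: f_def[abs_def] walk_sum_diff_const paths_def)
    \<comment> \<open>The rate is evaluated at its maximiser, where \<open>logmgf \<theta>\<close>
      is \<open>ln l\<close>.\<close>
    have "exp ((a * \<theta> - logmgf \<theta>) * real N) = exp (a * \<theta> * real N) / exp (real N * logmgf \<theta>)"
      by (simp add: left_diff_distrib mult.commute[of "real N"] flip: exp_diff)
    also have "exp (real N * logmgf \<theta>) = l ^ N"
      unfolding logmgf_eq[OF l r eig] exp_of_nat_mult using l by simp
    finally have e: "exp ((SUP \<theta>\<in>{0<..}. a * \<theta> - logmgf \<theta>) * real N) = exp (a * \<theta> * real N) / l ^ N"
      unfolding rate .
    have "exp (- \<theta> * walk_sum f x ys) = exp (- \<theta> * walk_sum h x ys) * exp (a * \<theta> * real N)"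
      unfolding ws by (simp add: algebra_simps flip: exp_add)
    moreover have "walk_prod P x ys = l ^ N * exp (- \<theta> * walk_sum h x ys)
        * (r x * walk_prod (tilt l r \<theta>) x ys * (1 / r (walk_end x ys)))"
      by (rule walk_prod_eq_tilt[OF l r ys])
    ultimately show "\<nu> x * (walk_prod P x ys * (if walk_sum h x ys \<ge> a * real N then 1 else 0))
        * exp ((SUP \<theta>\<in>{0<..}. a * \<theta> - logmgf \<theta>) * real N)
      = (\<nu> x * r x) * walk_prod (tilt l r \<theta>) x ys * (1 / r (walk_end x ys)) *
      (if walk_sum f x ys \<ge> 0 then exp (- \<theta> * walk_sum f x ys) else 0)"
      unfolding e using l by (simp add: ws)
  qed
  ultimately show ?thesis by simp
qed

end

section \<open>Transfer from walks to trajectories\<close>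

theorem theorem4p10:
  fixes mu :: "'s::finite \<Rightarrow> real" and P h :: "'s \<Rightarrow> 's \<Rightarrow> real"
  assumes mu_nonneg: "\<forall>j. mu j \<ge> 0" and mu_sum: "(\<Sum>j\<in>UNIV. mu j) = 1"
    and P_pos: "\<forall>j k. P j k > 0" and P_rows: "\<forall>j. (\<Sum>k\<in>UNIV. P j k) = 1"
    and nonlattice: "\<not> (\<exists>c r (H :: 's \<Rightarrow> real). r \<noteq> 0 \<and>
        (\<forall>j k. \<exists>m::int. r * h j k = c + H k - H j + 2 * pi * real_of_int m))"
    and mean_zero: "(\<lambda>N. expect mu P N (SN h N) / real N) \<longlonglongrightarrow> 0"
  shows "\<forall>a\<in>{0<..<Bmax h}. \<exists>D0::real.
     (\<lambda>N. prob_SN_ge mu P h N (a * real N) * exp (rate mu P h a * real N)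
           - D0 * real N powr (-1/2)) \<in> o(\<lambda>N. real N powr (-1/2))"
proof
  fix a assume a: "a \<in> {0<..<Bmax h}"
  \<comment> \<open>The law of x_1, the first state that enters the sum. It charges every state,
    because \<open>mu\<close> has mass somewhere and all entries of \<open>P\<close> are
    positive.\<close>
  define \<nu> where "\<nu> x = (\<Sum>j\<in>UNIV. mu j * P j x)" for x
  have "\<exists>j. mu j > 0"
  proof (rule ccontr)
    assume "\<nexists>j. mu j > 0"
    then have "mu j = 0" for j using mu_nonneg by (meson antisym not_less)
    then show False using mu_sum by simp
  qed
  then obtain j0 where j0: "mu j0 > 0" by blast
  interpret ld_chain \<nu> P h
  proof
    show "\<nu> x > 0" for x unfolding \<nu>_def using j0 P_pos mu_nonneg
      by (intro sum_pos2[of _ j0]) (auto simp: less_imp_le)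
    show "(\<Sum>x\<in>UNIV. \<nu> x) = 1" unfolding \<nu>_def
      by (subst sum.swap) (simp add: sum_distrib_left[symmetric] P_rows mu_sum)
  qed (use P_pos P_rows in auto)
  have walks: "expect mu P N (\<lambda>xs. F (SN h N xs))
      = (\<Sum>x\<in>UNIV. \<nu> x * (\<Sum>ys\<in>paths N. walk_prod P x ys * F (walk_sum h x ys)))" for N and F :: "real \<Rightarrow> real"
    unfolding \<nu>_def by (rule expect_eq_walks)
  have Lambda: "Lambda mu P h \<theta> = logmgf \<theta>" for \<theta>
    unfolding Lambda_def logmgf_def mgf_def using walks[of _ "\<lambda>z. exp (\<theta> * z)"] by simp
  obtain p where p: "pos_chain P p" using pos_chain_exists[of P] P_pos P_rows by blast
  have "(\<lambda>N. expect mu P N (SN h N) / real N) \<longlonglongrightarrow> pos_chain.drift P p h"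
    using pos_chain.mean_walk_sum_tendsto_drift[OF p \<nu>_sum, of h] walks[of _ "\<lambda>z. z"] by simp
  then have "pos_chain.drift P p h = 0" using mean_zero LIMSEQ_unique by blast
  then obtain D where D: "(\<lambda>N. sqrt (real N) * ((\<Sum>x\<in>UNIV. \<nu> x * (\<Sum>ys\<in>paths N. walk_prod P x ys *
      (if walk_sum h x ys \<ge> a * real N then 1 else 0))) * exp ((SUP \<theta>\<in>{0<..}. a * \<theta> - logmgf \<theta>) * real N))) \<longlonglongrightarrow> D"
    using tail_expansion[OF _ _ p _ nonlattice, of a] a by auto
  have X: "(\<lambda>N. sqrt (real N) * (prob_SN_ge mu P h N (a * real N) * exp (rate mu P h a * real N))) \<longlonglongrightarrow> D"
    using D unfolding prob_SN_ge_def rate_def Lambda walks[of _ "\<lambda>z. if z \<ge> a * real _ then 1 else 0"] .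
  have "(\<lambda>N. prob_SN_ge mu P h N (a * real N) * exp (rate mu P h a * real N)
           - D * real N powr (-1/2)) \<in> o(\<lambda>N. real N powr (-1/2))"
  \<comment> \<open>Dividing by \<open>N powr (-1/2)\<close> is multiplying by
    \<open>sqrt N\<close>, so the claim says that the rescaled sequence converges to
    \<open>D\<close>.\<close>
  proof (rule smalloI_tendsto)
    have "(\<lambda>N. sqrt (real N) * (prob_SN_ge mu P h N (a * real N) * exp (rate mu P h a * real N)) - D) \<longlonglongrightarrow> D - D"
      by (intro tendsto_intros X)
    then show "(\<lambda>N. (prob_SN_ge mu P h N (a * real N) * exp (rate mu P h a * real N)
           - D * real N powr (-1/2)) / real N powr (-1/2)) \<longlonglongrightarrow> 0"
      unfolding diff_self
    proof (rule Lim_transform_eventually)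
      show "\<forall>\<^sub>F N in sequentially. sqrt (real N) * (prob_SN_ge mu P h N (a * real N) * exp (rate mu P h a * real N)) - D
        = (prob_SN_ge mu P h N (a * real N) * exp (rate mu P h a * real N)
           - D * real N powr (-1/2)) / real N powr (-1/2)"
        using eventually_gt_at_top[of 0]
      proof eventually_elim
        case (elim N)
        have "real N powr (-1/2) = 1 / sqrt (real N)"
          using elim by (simp add: powr_minus_divide powr_half_sqrt)
        then show ?case using elim by (simp add: field_simps)
      qed
    qed
    show "\<forall>\<^sub>F N in sequentially. real N powr (-1/2) \<noteq> 0"
      using eventually_gt_at_top[of 0] by eventually_elim simp
  qed
  then show "\<exists>D0::real. (\<lambda>N. prob_SN_ge mu P h N (a * real N) * exp (rate mu P h a * real N)
           - D0 * real N powr (-1/2)) \<in> o(\<lambda>N. real N powr (-1/2))" by blast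
qed

end
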